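(* Any $3$-Sasakian manifold $M$ admits an almost cosymplectic sphere of Sasakian structures which is both taut and round; that is, an almost cosymplectic sphere $\{(\eta_\lambda,\Omega_\lambda)\}_{\lambda\in\mathbb{S}^2}$ on $M$, both taut and round, such that for every $\lambda\in\mathbb{S}^2$ the pair $(\eta_\lambda,\Omega_\lambda)$ consists of the $1$-form and the fundamental $2$-form of a Sasakian structure on $M$.
   Context: An almost contact structure on $M$ is a triple $(\phi,\xi,\eta)$ of a $(1,1)$-tensor field, a vector field and a $1$-form with $\phi^2=-I+\eta\otimes\xi$ and $\eta(\xi)=1$. A Riemannian metric $g$ is compatible if $g(\phi X,\phi Y)=g(X,Y)-\eta(X)\eta(Y)$; then $(\phi,\xi,\eta,g)$ is an almost contact metric structure, with fundamental $2$-form $\Omega(X,Y)=g(X,\phi Y)$. It is normal if $\phi^2[X,Y]+[\phi X,\phi Y]-\phi[\phi X,Y]-\phi[X,\phi Y]+\big(X(\eta(Y))-Y(\eta(X))-\eta([X,Y])\big)\xi=0$ for all vector fields $X,Y$. It is Sasakian if it is normal and $d\eta=\Omega$, with the convention $2\,d\eta(X,Y)=X(\eta(Y))-Y(\eta(X))-\eta([X,Y])$. An almost contact metric $3$-structure is a triple of almost contact structures $(\phi_\alpha,\xi_\alpha,\eta_\alpha)$, $\alpha=1,2,3$, with a Riemannian metric $g$ compatible with each of them, such that for every even permutation $(\alpha,\beta,\gamma)$ of $\{1,2,3\}$: $\phi_\gamma=\phi_\alpha\phi_\beta-\eta_\beta\otimes\xi_\alpha=-\phi_\beta\phi_\alpha+\eta_\alpha\otimes\xi_\beta$,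 $\xi_\gamma=\phi_\alpha\xi_\beta=-\phi_\beta\xi_\alpha$, $\eta_\gamma=\eta_\alpha\circ\phi_\beta=-\eta_\beta\circ\phi_\alpha$. A $3$-Sasakian manifold is a manifold with an almost contact metric $3$-structure such that each $(\phi_\alpha,\xi_\alpha,\eta_\alpha,g)$ is Sasakian. An almost cosymplectic structure on a $(2m+1)$-dimensional manifold is a pair $(\eta,\Omega)$ of a $1$-form and a $2$-form with $\eta\wedge\Omega^m$ a volume form; its Reeb vector field $\xi$ is the unique vector field with $i_\xi\eta=1$, $i_\xi\Omega=0$. Three almost cosymplectic structures $(\eta_i,\Omega_i)$ with Reeb vector fields $\xi_i$, $i=1,2,3$, generate an almost cosymplectic sphere if $(\eta_\lambda,\Omega_\lambda):=(\sum_i\lambda_i\eta_i,\sum_i\lambda_i\Omega_i)$ is almost cosymplectic for every $\lambda\in\mathbb{S}^2$. It is taut if $\eta_\lambda\wedge\Omega_\lambda^m$ is independent of $\lambda\in\mathbb{S}^2$, and round if $\sum_i\lambda_i\xi_i$ is the Reeb vector field of $(\eta_\lambda,\Omega_\lambda)$ for every $\lambda\in\mathbb{S}^2$. *)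

theory Defs
  imports
    "HOL-Analysis.Analysis"
    "HOL-Library.Function_Algebras"
begin

text \<open>Functions with values in a real vector space form a real vector space. Tangent vectors,
  vector fields and differential forms below are all functions, so their linear combinations are
  instances of this pointwise structure.\<close>

instantiation "fun" :: (type, real_vector) real_vector
begin

definition scaleR_fun :: "real \<Rightarrow> ('a \<Rightarrow> 'b) \<Rightarrow> 'a \<Rightarrow> 'b"
  where "scaleR_fun c f = (\<lambda>x. c *\<^sub>R f x)"

instance
  by standard (simp_all add: scaleR_fun_def fun_eq_iff scaleR_add_right scaleR_add_left)

end


section \<open>Smooth manifolds\<close>

fun Ck_on :: "nat \<Rightarrow> 'e::euclidean_space set \<Rightarrow> ('e \<Rightarrow> 'f::real_normed_vector) \<Rightarrow> bool" where
  "Ck_on 0 S f \<longleftrightarrow> continuous_on S f"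
| "Ck_on (Suc k) S f \<longleftrightarrow>
     (\<forall>x\<in>S. f differentiable (at x)) \<and>
     (\<forall>v. Ck_on k S (\<lambda>x. frechet_derivative f (at x) v))"

definition Cinf_on :: "'e::euclidean_space set \<Rightarrow> ('e \<Rightarrow> 'f::real_normed_vector) \<Rightarrow> bool" where
  "Cinf_on S f \<longleftrightarrow> (\<forall>k. Ck_on k S f)"

text \<open>The points of the manifold are the elements of the underlying topological space; a chart is
  a pair of its domain and its coordinate map. The dimension is that of the model space.\<close>

record ('a, 'e) manifold =
  top_space :: "'a topology"
  atlas :: "('a set \<times> ('a \<Rightarrow> 'e)) set"

definition points :: "('a, 'e) manifold \<Rightarrow> 'a set" where
  "points M = topspace (top_space M)"

definition mdim :: "('a, 'e::euclidean_space) manifold \<Rightarrow> nat" where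
  "mdim M = DIM('e)"

definition is_chart :: "'a topology \<Rightarrow> 'a set \<Rightarrow> ('a \<Rightarrow> 'e::euclidean_space) \<Rightarrow> bool" where
  "is_chart T U c \<longleftrightarrow>
     openin T U \<and> open (c ` U) \<and>
     homeomorphic_map (subtopology T U) (top_of_set (c ` U)) c"

text \<open>Manifolds are nonempty, so that the dimension is determined by the manifold.
  The atlas need not be maximal.\<close>

definition smooth_manifold :: "('a, 'e::euclidean_space) manifold \<Rightarrow> bool" where
  "smooth_manifold M \<longleftrightarrow>
     points M \<noteq> {} \<and>
     Hausdorff_space (top_space M) \<and>
     second_countable (top_space M) \<and>
     (\<forall>(U, c)\<in>atlas M. is_chart (top_space M) U c) \<and>
     (\<Union>(U, c)\<in>atlas M. U) = points M \<and>
     (\<forall>(U, c)\<in>atlas M. \<forall>(V, d)\<in>atlas M. Cinf_on (c ` (U \<inter> V)) (d \<circ> inv_into U c))"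

definition smooth_fun :: "('a, 'e::euclidean_space) manifold \<Rightarrow> 'a set \<Rightarrow> ('a \<Rightarrow> real) \<Rightarrow> bool" where
  "smooth_fun M U f \<longleftrightarrow>
     openin (top_space M) U \<and>
     (\<forall>(V, c)\<in>atlas M. Cinf_on (c ` (U \<inter> V)) (f \<circ> inv_into V c))"

definition smooth_near :: "('a, 'e::euclidean_space) manifold \<Rightarrow> 'a \<Rightarrow> ('a \<Rightarrow> real) \<Rightarrow> bool" where
  "smooth_near M p f \<longleftrightarrow> (\<exists>U. p \<in> U \<and> smooth_fun M U f)"


section \<open>Tangent vectors and vector fields\<close>

text \<open>Tangent vectors at \<open>p\<close> are derivations at \<open>p\<close> on the functions that are smooth near \<open>p\<close>.
  The Leibniz rule makes such a derivation depend only on the germ of its argument. The value \<open>0\<close>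
  on all other functions makes equality of derivations equality of HOL functions.\<close>

type_synonym 'a tvec = "('a \<Rightarrow> real) \<Rightarrow> real"

definition tangent_space :: "('a, 'e::euclidean_space) manifold \<Rightarrow> 'a \<Rightarrow> 'a tvec set" where
  "tangent_space M p = {v.
     (\<forall>f g. smooth_near M p f \<longrightarrow> smooth_near M p g \<longrightarrow>
        v (\<lambda>x. f x + g x) = v f + v g \<and>
        v (\<lambda>x. f x * g x) = v f * g p + f p * v g) \<and>
     (\<forall>f a. smooth_near M p f \<longrightarrow> v (\<lambda>x. a * f x) = a * v f) \<and>
     (\<forall>f. \<not> smooth_near M p f \<longrightarrow> v f = 0)}"

text \<open>A vector field acts on functions by \<open>(X f)(p) = X p f\<close>.\<close>

definition vector_field ::
    "('a, 'e::euclidean_space) manifold \<Rightarrow> ('a \<Rightarrow> 'a tvec) \<Rightarrow> bool" where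
  "vector_field M X \<longleftrightarrow>
     (\<forall>p\<in>points M. X p \<in> tangent_space M p) \<and>
     (\<forall>U f. smooth_fun M U f \<longrightarrow> smooth_fun M U (\<lambda>p. X p f))"

definition lie_bracket :: "('a, 'e::euclidean_space) manifold \<Rightarrow>
    ('a \<Rightarrow> 'a tvec) \<Rightarrow> ('a \<Rightarrow> 'a tvec) \<Rightarrow> ('a \<Rightarrow> 'a tvec)" where
  "lie_bracket M X Y = (\<lambda>p f.
     if smooth_near M p f then X p (\<lambda>q. Y q f) - Y p (\<lambda>q. X q f) else 0)"


section \<open>Tensor fields and differential forms\<close>

text \<open>Tensor fields are families of multilinear maps on the tangent spaces; smoothness is
  tested on smooth vector fields.\<close>

definition endo_field :: "('a, 'e::euclidean_space) manifold \<Rightarrow>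
    ('a \<Rightarrow> 'a tvec \<Rightarrow> 'a tvec) \<Rightarrow> bool" where
  "endo_field M \<phi> \<longleftrightarrow>
     (\<forall>p\<in>points M. \<forall>u\<in>tangent_space M p. \<forall>v\<in>tangent_space M p. \<forall>a b.
        \<phi> p u \<in> tangent_space M p \<and>
        \<phi> p (a *\<^sub>R u + b *\<^sub>R v) = a *\<^sub>R \<phi> p u + b *\<^sub>R \<phi> p v) \<and>
     (\<forall>X. vector_field M X \<longrightarrow> vector_field M (\<lambda>p. \<phi> p (X p)))"

definition riemannian_metric :: "('a, 'e::euclidean_space) manifold \<Rightarrow>
    ('a \<Rightarrow> 'a tvec \<Rightarrow> 'a tvec \<Rightarrow> real) \<Rightarrow> bool" where
  "riemannian_metric M g \<longleftrightarrow>
     (\<forall>p\<in>points M. \<forall>u\<in>tangent_space M p. \<forall>v\<in>tangent_space M p. \<forall>w\<in>tangent_space M p. \<forall>a b.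
        g p (a *\<^sub>R u + b *\<^sub>R v) w = a * g p u w + b * g p v w \<and>
        g p u v = g p v u \<and>
        (u \<noteq> 0 \<longrightarrow> g p u u > 0)) \<and>
     (\<forall>X Y. vector_field M X \<longrightarrow> vector_field M Y \<longrightarrow>
        smooth_fun M (points M) (\<lambda>p. g p (X p) (Y p)))"

text \<open>A \<open>k\<close>-form takes its arguments as a sequence of tangent vectors, of which only the
  entries with index below \<open>k\<close> matter.\<close>

definition diff_form :: "('a, 'e::euclidean_space) manifold \<Rightarrow> nat \<Rightarrow>
    ('a \<Rightarrow> (nat \<Rightarrow> 'a tvec) \<Rightarrow> real) \<Rightarrow> bool" where
  "diff_form M k \<omega> \<longleftrightarrow>
     (\<forall>p\<in>points M. \<forall>v. (\<forall>i. v i \<in> tangent_space M p) \<longrightarrow>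
        (\<forall>w. (\<forall>i. w i \<in> tangent_space M p) \<longrightarrow> (\<forall>i<k. v i = w i) \<longrightarrow> \<omega> p v = \<omega> p w) \<and>
        (\<forall>i<k. \<forall>x\<in>tangent_space M p. \<forall>y\<in>tangent_space M p. \<forall>a b.
           \<omega> p (v(i := a *\<^sub>R x + b *\<^sub>R y)) = a * \<omega> p (v(i := x)) + b * \<omega> p (v(i := y))) \<and>
        (\<forall>i<k. \<forall>j<k. i \<noteq> j \<longrightarrow> v i = v j \<longrightarrow> \<omega> p v = 0)) \<and>
     (\<forall>X. (\<forall>i. vector_field M (X i)) \<longrightarrow>
        smooth_fun M (points M) (\<lambda>p. \<omega> p (\<lambda>i. X i p)))"

text \<open>Forms of degree one and two are written in curried style.\<close>

definition uncurry1 :: "('v \<Rightarrow> real) \<Rightarrow> (nat \<Rightarrow> 'v) \<Rightarrow> real" where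
  "uncurry1 \<alpha> v = \<alpha> (v 0)"

definition uncurry2 :: "('v \<Rightarrow> 'v \<Rightarrow> real) \<Rightarrow> (nat \<Rightarrow> 'v) \<Rightarrow> real" where
  "uncurry2 \<beta> v = \<beta> (v 0) (v 1)"

definition one_form :: "('a, 'e::euclidean_space) manifold \<Rightarrow>
    ('a \<Rightarrow> 'a tvec \<Rightarrow> real) \<Rightarrow> bool" where
  "one_form M \<eta> \<longleftrightarrow> diff_form M 1 (\<lambda>p. uncurry1 (\<eta> p))"

definition two_form :: "('a, 'e::euclidean_space) manifold \<Rightarrow>
    ('a \<Rightarrow> 'a tvec \<Rightarrow> 'a tvec \<Rightarrow> real) \<Rightarrow> bool" where
  "two_form M \<Omega> \<longleftrightarrow> diff_form M 2 (\<lambda>p. uncurry2 (\<Omega> p))"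

text \<open>Wedge product of a \<open>k\<close>-form and an \<open>l\<close>-form on a vector space. The normalisation by
  \<open>1/(k+l)!\<close> is the one matching the factor \<open>1/2\<close> in the exterior derivative of a 1-form below.\<close>

definition wedge :: "nat \<Rightarrow> nat \<Rightarrow> ((nat \<Rightarrow> 'v) \<Rightarrow> real) \<Rightarrow> ((nat \<Rightarrow> 'v) \<Rightarrow> real) \<Rightarrow>
    (nat \<Rightarrow> 'v) \<Rightarrow> real" where
  "wedge k l \<alpha> \<beta> v =
     (\<Sum>\<sigma> | \<sigma> permutes {..<k + l}.
        of_int (sign \<sigma>) * \<alpha> (\<lambda>i. v (\<sigma> i)) * \<beta> (\<lambda>i. v (\<sigma> (k + i)))) / fact (k + l)"

primrec wedge_power :: "nat \<Rightarrow> ((nat \<Rightarrow> 'v) \<Rightarrow> real) \<Rightarrow> nat \<Rightarrow> (nat \<Rightarrow> 'v) \<Rightarrow> real" where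
  "wedge_power k \<alpha> 0 = (\<lambda>v. 1)"
| "wedge_power k \<alpha> (Suc m) = wedge k (k * m) \<alpha> (wedge_power k \<alpha> m)"

definition volume_form :: "('a, 'e::euclidean_space) manifold \<Rightarrow>
    ('a \<Rightarrow> (nat \<Rightarrow> 'a tvec) \<Rightarrow> real) \<Rightarrow> bool" where
  "volume_form M \<omega> \<longleftrightarrow>
     diff_form M (mdim M) \<omega> \<and>
     (\<forall>p\<in>points M. \<exists>v. (\<forall>i. v i \<in> tangent_space M p) \<and> \<omega> p v \<noteq> 0)"

definition ext_deriv1 :: "('a, 'e::euclidean_space) manifold \<Rightarrow> ('a \<Rightarrow> 'a tvec \<Rightarrow> real) \<Rightarrow>
    ('a \<Rightarrow> 'a tvec) \<Rightarrow> ('a \<Rightarrow> 'a tvec) \<Rightarrow> 'a \<Rightarrow> real" where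
  "ext_deriv1 M \<eta> X Y p =
     (X p (\<lambda>q. \<eta> q (Y q)) - Y p (\<lambda>q. \<eta> q (X q)) - \<eta> p (lie_bracket M X Y p)) / 2"


section \<open>Sasakian and 3-Sasakian structures\<close>

definition almost_contact :: "('a, 'e::euclidean_space) manifold \<Rightarrow>
    ('a \<Rightarrow> 'a tvec \<Rightarrow> 'a tvec) \<Rightarrow> ('a \<Rightarrow> 'a tvec) \<Rightarrow> ('a \<Rightarrow> 'a tvec \<Rightarrow> real) \<Rightarrow> bool" where
  "almost_contact M \<phi> \<xi> \<eta> \<longleftrightarrow>
     endo_field M \<phi> \<and> vector_field M \<xi> \<and> one_form M \<eta> \<and>
     (\<forall>p\<in>points M. \<eta> p (\<xi> p) = 1 \<and>
        (\<forall>v\<in>tangent_space M p. \<phi> p (\<phi> p v) = - v + \<eta> p v *\<^sub>R \<xi> p))"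

definition compatible_metric :: "('a, 'e::euclidean_space) manifold \<Rightarrow>
    ('a \<Rightarrow> 'a tvec \<Rightarrow> 'a tvec) \<Rightarrow> ('a \<Rightarrow> 'a tvec \<Rightarrow> real) \<Rightarrow>
    ('a \<Rightarrow> 'a tvec \<Rightarrow> 'a tvec \<Rightarrow> real) \<Rightarrow> bool" where
  "compatible_metric M \<phi> \<eta> g \<longleftrightarrow>
     riemannian_metric M g \<and>
     (\<forall>p\<in>points M. \<forall>u\<in>tangent_space M p. \<forall>v\<in>tangent_space M p.
        g p (\<phi> p u) (\<phi> p v) = g p u v - \<eta> p u * \<eta> p v)"

definition almost_contact_metric :: "('a, 'e::euclidean_space) manifold \<Rightarrow>
    ('a \<Rightarrow> 'a tvec \<Rightarrow> 'a tvec) \<Rightarrow> ('a \<Rightarrow> 'a tvec) \<Rightarrow> ('a \<Rightarrow> 'a tvec \<Rightarrow> real) \<Rightarrow>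
    ('a \<Rightarrow> 'a tvec \<Rightarrow> 'a tvec \<Rightarrow> real) \<Rightarrow> bool" where
  "almost_contact_metric M \<phi> \<xi> \<eta> g \<longleftrightarrow> almost_contact M \<phi> \<xi> \<eta> \<and> compatible_metric M \<phi> \<eta> g"

definition fundamental_form ::
    "('a \<Rightarrow> 'a tvec \<Rightarrow> 'a tvec) \<Rightarrow> ('a \<Rightarrow> 'a tvec \<Rightarrow> 'a tvec \<Rightarrow> real) \<Rightarrow>
     'a \<Rightarrow> 'a tvec \<Rightarrow> 'a tvec \<Rightarrow> real" where
  "fundamental_form \<phi> g p u v = g p u (\<phi> p v)"

definition normal_structure :: "('a, 'e::euclidean_space) manifold \<Rightarrow>
    ('a \<Rightarrow> 'a tvec \<Rightarrow> 'a tvec) \<Rightarrow> ('a \<Rightarrow> 'a tvec) \<Rightarrow> ('a \<Rightarrow> 'a tvec \<Rightarrow> real) \<Rightarrow> bool" where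
  "normal_structure M \<phi> \<xi> \<eta> \<longleftrightarrow>
     (\<forall>X Y. vector_field M X \<longrightarrow> vector_field M Y \<longrightarrow>
        (let \<phi>X = (\<lambda>q. \<phi> q (X q)); \<phi>Y = (\<lambda>q. \<phi> q (Y q)) in
         \<forall>p\<in>points M.
           \<phi> p (\<phi> p (lie_bracket M X Y p)) + lie_bracket M \<phi>X \<phi>Y p
             - \<phi> p (lie_bracket M \<phi>X Y p) - \<phi> p (lie_bracket M X \<phi>Y p)
             + (X p (\<lambda>q. \<eta> q (Y q)) - Y p (\<lambda>q. \<eta> q (X q)) - \<eta> p (lie_bracket M X Y p)) *\<^sub>R \<xi> p
           = 0))"

definition sasakian :: "('a, 'e::euclidean_space) manifold \<Rightarrow>
    ('a \<Rightarrow> 'a tvec \<Rightarrow> 'a tvec) \<Rightarrow> ('a \<Rightarrow> 'a tvec) \<Rightarrow> ('a \<Rightarrow> 'a tvec \<Rightarrow> real) \<Rightarrow>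
    ('a \<Rightarrow> 'a tvec \<Rightarrow> 'a tvec \<Rightarrow> real) \<Rightarrow> bool" where
  "sasakian M \<phi> \<xi> \<eta> g \<longleftrightarrow>
     almost_contact_metric M \<phi> \<xi> \<eta> g \<and>
     normal_structure M \<phi> \<xi> \<eta> \<and>
     (\<forall>X Y. vector_field M X \<longrightarrow> vector_field M Y \<longrightarrow>
        (\<forall>p\<in>points M. ext_deriv1 M \<eta> X Y p = fundamental_form \<phi> g p (X p) (Y p)))"

text \<open>The three structures are indexed by the three-element type \<open>3\<close>, which is also the index
  type of the ambient space \<open>real ^ 3\<close> of the sphere.\<close>

definition almost_contact_metric_3 :: "('a, 'e::euclidean_space) manifold \<Rightarrow>
    (3 \<Rightarrow> 'a \<Rightarrow> 'a tvec \<Rightarrow> 'a tvec) \<Rightarrow> (3 \<Rightarrow> 'a \<Rightarrow> 'a tvec) \<Rightarrow>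
    (3 \<Rightarrow> 'a \<Rightarrow> 'a tvec \<Rightarrow> real) \<Rightarrow> ('a \<Rightarrow> 'a tvec \<Rightarrow> 'a tvec \<Rightarrow> real) \<Rightarrow> bool" where
  "almost_contact_metric_3 M \<phi> \<xi> \<eta> g \<longleftrightarrow>
     (\<forall>\<alpha>. almost_contact_metric M (\<phi> \<alpha>) (\<xi> \<alpha>) (\<eta> \<alpha>) g) \<and>
     (\<forall>\<sigma>. \<sigma> permutes UNIV \<longrightarrow> evenperm \<sigma> \<longrightarrow>
        (let \<alpha> = \<sigma> 1; \<beta> = \<sigma> 2; \<gamma> = \<sigma> 3 in
         \<forall>p\<in>points M.
           \<xi> \<gamma> p = \<phi> \<alpha> p (\<xi> \<beta> p) \<and> \<xi> \<gamma> p = - \<phi> \<beta> p (\<xi> \<alpha> p) \<and>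
           (\<forall>v\<in>tangent_space M p.
              \<phi> \<gamma> p v = \<phi> \<alpha> p (\<phi> \<beta> p v) - \<eta> \<beta> p v *\<^sub>R \<xi> \<alpha> p \<and>
              \<phi> \<gamma> p v = - \<phi> \<beta> p (\<phi> \<alpha> p v) + \<eta> \<alpha> p v *\<^sub>R \<xi> \<beta> p \<and>
              \<eta> \<gamma> p v = \<eta> \<alpha> p (\<phi> \<beta> p v) \<and>
              \<eta> \<gamma> p v = - \<eta> \<beta> p (\<phi> \<alpha> p v))))"

definition three_sasakian :: "('a, 'e::euclidean_space) manifold \<Rightarrow>
    (3 \<Rightarrow> 'a \<Rightarrow> 'a tvec \<Rightarrow> 'a tvec) \<Rightarrow> (3 \<Rightarrow> 'a \<Rightarrow> 'a tvec) \<Rightarrow>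
    (3 \<Rightarrow> 'a \<Rightarrow> 'a tvec \<Rightarrow> real) \<Rightarrow> ('a \<Rightarrow> 'a tvec \<Rightarrow> 'a tvec \<Rightarrow> real) \<Rightarrow> bool" where
  "three_sasakian M \<phi> \<xi> \<eta> g \<longleftrightarrow>
     almost_contact_metric_3 M \<phi> \<xi> \<eta> g \<and>
     (\<forall>\<alpha>. sasakian M (\<phi> \<alpha>) (\<xi> \<alpha>) (\<eta> \<alpha>) g)"


section \<open>Almost cosymplectic spheres\<close>

text \<open>The form \<open>\<eta> \<and> \<Omega>\<^sup>m\<close> on a manifold of dimension \<open>2m + 1\<close>.\<close>

definition cosymplectic_volume :: "('a, 'e::euclidean_space) manifold \<Rightarrow>
    ('a \<Rightarrow> 'a tvec \<Rightarrow> real) \<Rightarrow> ('a \<Rightarrow> 'a tvec \<Rightarrow> 'a tvec \<Rightarrow> real) \<Rightarrow>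
    'a \<Rightarrow> (nat \<Rightarrow> 'a tvec) \<Rightarrow> real" where
  "cosymplectic_volume M \<eta> \<Omega> p =
     (let m = mdim M div 2 in
      wedge 1 (2 * m) (uncurry1 (\<eta> p)) (wedge_power 2 (uncurry2 (\<Omega> p)) m))"

definition almost_cosymplectic :: "('a, 'e::euclidean_space) manifold \<Rightarrow>
    ('a \<Rightarrow> 'a tvec \<Rightarrow> real) \<Rightarrow> ('a \<Rightarrow> 'a tvec \<Rightarrow> 'a tvec \<Rightarrow> real) \<Rightarrow> bool" where
  "almost_cosymplectic M \<eta> \<Omega> \<longleftrightarrow>
     odd (mdim M) \<and> one_form M \<eta> \<and> two_form M \<Omega> \<and>
     volume_form M (cosymplectic_volume M \<eta> \<Omega>)"

definition reeb_field :: "('a, 'e::euclidean_space) manifold \<Rightarrow>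
    ('a \<Rightarrow> 'a tvec \<Rightarrow> real) \<Rightarrow> ('a \<Rightarrow> 'a tvec \<Rightarrow> 'a tvec \<Rightarrow> real) \<Rightarrow> ('a \<Rightarrow> 'a tvec) \<Rightarrow> bool" where
  "reeb_field M \<eta> \<Omega> \<xi> \<longleftrightarrow>
     vector_field M \<xi> \<and>
     (\<forall>p\<in>points M. \<eta> p (\<xi> p) = 1 \<and> (\<forall>v\<in>tangent_space M p. \<Omega> p (\<xi> p) v = 0))"

definition comb :: "real ^ 3 \<Rightarrow> (3 \<Rightarrow> 'b) \<Rightarrow> 'b::real_vector" where
  "comb l F = (\<Sum>i\<in>UNIV. l $ i *\<^sub>R F i)"

definition almost_cosymplectic_sphere :: "('a, 'e::euclidean_space) manifold \<Rightarrow>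
    (3 \<Rightarrow> 'a \<Rightarrow> 'a tvec \<Rightarrow> real) \<Rightarrow> (3 \<Rightarrow> 'a \<Rightarrow> 'a tvec \<Rightarrow> 'a tvec \<Rightarrow> real) \<Rightarrow>
    (3 \<Rightarrow> 'a \<Rightarrow> 'a tvec) \<Rightarrow> bool" where
  "almost_cosymplectic_sphere M \<eta> \<Omega> \<xi> \<longleftrightarrow>
     (\<forall>i. almost_cosymplectic M (\<eta> i) (\<Omega> i) \<and> reeb_field M (\<eta> i) (\<Omega> i) (\<xi> i)) \<and>
     (\<forall>l\<in>sphere 0 1. almost_cosymplectic M (comb l \<eta>) (comb l \<Omega>))"

definition taut :: "('a, 'e::euclidean_space) manifold \<Rightarrow>
    (3 \<Rightarrow> 'a \<Rightarrow> 'a tvec \<Rightarrow> real) \<Rightarrow> (3 \<Rightarrow> 'a \<Rightarrow> 'a tvec \<Rightarrow> 'a tvec \<Rightarrow> real) \<Rightarrow> bool" where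
  "taut M \<eta> \<Omega> \<longleftrightarrow>
     (\<forall>l\<in>sphere 0 1. \<forall>l'\<in>sphere 0 1. \<forall>p\<in>points M. \<forall>v. (\<forall>i. v i \<in> tangent_space M p) \<longrightarrow>
        cosymplectic_volume M (comb l \<eta>) (comb l \<Omega>) p v =
        cosymplectic_volume M (comb l' \<eta>) (comb l' \<Omega>) p v)"

definition round_sphere :: "('a, 'e::euclidean_space) manifold \<Rightarrow>
    (3 \<Rightarrow> 'a \<Rightarrow> 'a tvec \<Rightarrow> real) \<Rightarrow> (3 \<Rightarrow> 'a \<Rightarrow> 'a tvec \<Rightarrow> 'a tvec \<Rightarrow> real) \<Rightarrow>
    (3 \<Rightarrow> 'a \<Rightarrow> 'a tvec) \<Rightarrow> bool" where
  "round_sphere M \<eta> \<Omega> \<xi> \<longleftrightarrow>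
     (\<forall>l\<in>sphere 0 1. reeb_field M (comb l \<eta>) (comb l \<Omega>) (comb l \<xi>))"

end

theory Submission
  imports Defs
begin

text \<open>For \<open>\<lambda>\<close> in the sphere let \<open>\<phi>\<^sub>\<lambda>\<close>, \<open>\<xi>\<^sub>\<lambda>\<close>, \<open>\<eta>\<^sub>\<lambda>\<close>, \<open>\<Omega>\<^sub>\<lambda>\<close> be the combinations of the three given
  structures with coefficients \<open>\<lambda>\<close>. The relations
  \<open>\<phi>\<^sub>i\<phi>\<^sub>j + \<phi>\<^sub>j\<phi>\<^sub>i = - 2\<delta>\<^sub>i\<^sub>j I + \<eta>\<^sub>j \<otimes> \<xi>\<^sub>i + \<eta>\<^sub>i \<otimes> \<xi>\<^sub>j\<close> say that \<open>(\<phi>\<^sub>\<lambda>, \<xi>\<^sub>\<lambda>, \<eta>\<^sub>\<lambda>, g)\<close> is an almost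
  contact metric structure, and \<open>d\<eta>\<^sub>\<lambda> = \<Omega>\<^sub>\<lambda>\<close> by linearity. Its normality tensor is a quadratic form in
  \<open>\<lambda>\<close> whose diagonal coefficients vanish by hypothesis; the mixed ones vanish because
  \<open>\<phi>\<^sub>\<gamma> = \<phi>\<^sub>\<alpha>\<phi>\<^sub>\<beta> - \<eta>\<^sub>\<beta> \<otimes> \<xi>\<^sub>\<alpha>\<close> gives a second expression for \<open>[\<phi>\<^sub>\<gamma>X, \<phi>\<^sub>\<gamma>Y]\<close>. So all \<open>\<phi>\<^sub>\<lambda>\<close> are Sasakian,
  and the sphere is round since \<open>\<Omega>\<^sub>\<lambda>(\<xi>\<^sub>\<lambda>, v) = \<eta>\<^sub>\<lambda>(\<phi>\<^sub>\<lambda>v) = 0\<close>. On an orthonormal basis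
  \<open>\<xi>, \<phi>u\<^sub>1, u\<^sub>1, \<phi>u\<^sub>2, u\<^sub>2, \<dots>\<close> adapted to an almost contact metric structure, \<open>\<eta> \<and> \<Omega>\<^sup>m\<close> takes a
  positive value \<open>c\<close> depending on \<open>m\<close> only. Hence on a fixed orthonormal basis of a tangent space
  \<open>\<eta>\<^sub>\<lambda> \<and> \<Omega>\<^sub>\<lambda>\<^sup>m\<close> takes one of the values \<open>\<plusminus>c\<close>; by continuity in \<open>\<lambda>\<close> and connectedness of the sphere
  that value is constant, which is tautness.\<close>

section \<open>Calculus of \<open>C\<^sup>k\<close> functions\<close>

text \<open>Tangent vectors are derivations, so it has to be proved that a tangent space has
  dimension \<open>DIM('e)\<close>. This is what the integral calculus is for; orthonormal bases,
  the parity of the dimension and the degree of the volume form all rest on it. The identities on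
  the sphere are quadratic in \<lambda>, so only symmetrised coefficients matter, and the metric
  ones are settled inside a single tangent space. Normality is treated through brackets alone,
  without a connection. The delicate point is that the Leibniz rule leaves terms along
  \<xi>_\<alpha> in the brackets. The comparison is therefore made after applying \<phi>_\<alpha>,
  which kills them, and it determines the mixed tensor only up to a multiple of \<xi>_\<alpha>. That
  multiple is shown to be zero by using d\<eta>_i = \<Omega>_i for all three indices together.
  Determinants of base changes are avoided: that a top-degree form has the same square on all
  orthonormal bases comes from Parseval's identity in each slot. The constant \<open>c\<close> is
  not evaluated; its positivity suffices.\<close>

lemma Ck_on_subset: "Ck_on k S f \<Longrightarrow> T \<subseteq> S \<Longrightarrow> Ck_on k T f"
  by (induction k arbitrary: f) (auto intro: continuous_on_subset)

text \<open>\<open>frechet_derivative\<close> at a point of \<open>S\<close> also sees values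
  outside \<open>S\<close>; openness makes equality on \<open>S\<close> enough.\<close>

lemma Ck_on_cong:
  assumes "open S" "\<And>x. x \<in> S \<Longrightarrow> f x = g x" "Ck_on k S f"
  shows "Ck_on k S g"
  using assms(2,3)
proof (induction k arbitrary: f g)
  case 0
  then show ?case by (simp cong: continuous_on_cong)
next
  case (Suc k)
  have g': "(g has_derivative frechet_derivative f (at x)) (at x)" if "x \<in> S" for x
  proof -
    have "(f has_derivative frechet_derivative f (at x)) (at x)"
      using Suc.prems(2) that by (simp add: frechet_derivative_works[symmetric])
    then show ?thesis
      by (rule has_derivative_transform_within_open[OF _ assms(1) that]) (use Suc.prems(1) in auto)
  qed
  have eq: "frechet_derivative f (at x) v = frechet_derivative g (at x) v" if "x \<in> S" for x v
    using frechet_derivative_at[OF g'[OF that]] by simp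
  have "Ck_on k S (\<lambda>x. frechet_derivative g (at x) v)" for v
    by (rule Suc.IH[of "\<lambda>x. frechet_derivative f (at x) v"]) (use eq Suc.prems(2) in auto)
  with g' show ?case by (auto simp: differentiable_def)
qed

text \<open>Introduction rule that replaces the choice operator in \<open>frechet_derivative\<close>
  by any explicit derivative \<open>F\<close>.\<close>

lemma Ck_on_Suc_has_derivativeI:
  assumes "open S" "\<And>x. x \<in> S \<Longrightarrow> (f has_derivative F x) (at x)"
    and "\<And>v. Ck_on k S (\<lambda>x. F x v)"
  shows "Ck_on (Suc k) S f"
proof -
  have "Ck_on k S (\<lambda>x. frechet_derivative f (at x) v)" for v
    by (rule Ck_on_cong[OF assms(1) _ assms(3)[of v]])
      (use frechet_derivative_at[OF assms(2)] in simp)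
  with assms(2) show ?thesis by (auto simp: differentiable_def)
qed

lemma Ck_on_Suc_has_derivative:
  "Ck_on (Suc k) S f \<Longrightarrow> x \<in> S \<Longrightarrow> (f has_derivative frechet_derivative f (at x)) (at x)"
  by (simp add: frechet_derivative_works[symmetric])

lemma Ck_on_SucD: "Ck_on (Suc k) S f \<Longrightarrow> Ck_on k S f"
proof (induction k arbitrary: f)
  case 0
  then show ?case
    by (auto intro!: continuous_at_imp_continuous_on differentiable_imp_continuous_within)
next
  case (Suc k)
  then show ?case by (metis Ck_on.simps(2))
qed

lemma Ck_on_const [simp]: "Ck_on k S (\<lambda>x. c)"
  by (induction k arbitrary: c) auto

lemma Ck_on_bounded_linear:
  assumes "open S" "bounded_linear L"
  shows "Ck_on k S f \<Longrightarrow> Ck_on k S (\<lambda>x. L (f x))"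
proof (induction k arbitrary: f)
  case 0
  then show ?case
    by (simp add: bounded_linear.continuous_on[OF assms(2)])
next
  case (Suc k)
  show ?case
  proof (rule Ck_on_Suc_has_derivativeI[OF assms(1)])
    show "((\<lambda>x. L (f x)) has_derivative (\<lambda>v. L (frechet_derivative f (at x) v))) (at x)"
      if "x \<in> S" for x
      by (rule bounded_linear.has_derivative[OF assms(2) Ck_on_Suc_has_derivative[OF Suc.prems that]])
    show "Ck_on k S (\<lambda>x. L (frechet_derivative f (at x) v))" for v
      using Suc by simp
  qed
qed

lemma Ck_on_id: "open S \<Longrightarrow> Ck_on k S (\<lambda>x. x)"
  by (cases k) (auto intro!: Ck_on_Suc_has_derivativeI[where F = "\<lambda>x v. v"])

lemma Ck_on_add:
  assumes "open S"
  shows "Ck_on k S f \<Longrightarrow> Ck_on k S g \<Longrightarrow> Ck_on k S (\<lambda>x. f x + g x)"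
proof (induction k arbitrary: f g)
  case 0
  then show ?case by (simp add: continuous_on_add)
next
  case (Suc k)
  show ?case
  proof (rule Ck_on_Suc_has_derivativeI[OF assms(1)])
    show "((\<lambda>x. f x + g x) has_derivative
        (\<lambda>v. frechet_derivative f (at x) v + frechet_derivative g (at x) v)) (at x)"
      if "x \<in> S" for x
      using Ck_on_Suc_has_derivative[OF Suc.prems(1) that]
        Ck_on_Suc_has_derivative[OF Suc.prems(2) that] by (rule has_derivative_add)
    show "Ck_on k S (\<lambda>x. frechet_derivative f (at x) v + frechet_derivative g (at x) v)" for v
      using Suc by simp
  qed
qed

lemma Ck_on_mult:
  fixes f g :: "'e::euclidean_space \<Rightarrow> real"
  assumes "open S"
  shows "Ck_on k S f \<Longrightarrow> Ck_on k S g \<Longrightarrow> Ck_on k S (\<lambda>x. f x * g x)"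
proof (induction k arbitrary: f g)
  case 0
  then show ?case by (simp add: continuous_on_mult)
next
  case (Suc k)
  show ?case
  proof (rule Ck_on_Suc_has_derivativeI[OF assms(1)])
    show "((\<lambda>x. f x * g x) has_derivative
        (\<lambda>v. f x * frechet_derivative g (at x) v + frechet_derivative f (at x) v * g x)) (at x)"
      if "x \<in> S" for x
      using Ck_on_Suc_has_derivative[OF Suc.prems(1) that]
        Ck_on_Suc_has_derivative[OF Suc.prems(2) that] by (rule has_derivative_mult)
    show "Ck_on k S (\<lambda>x. f x * frechet_derivative g (at x) v + frechet_derivative f (at x) v * g x)"
      for v
      using Suc.prems by (intro Ck_on_add[OF assms(1)] Suc.IH) (auto intro: Ck_on_SucD)
  qed
qed

lemma Ck_on_sum:
  assumes "open S" "\<And>i. i \<in> I \<Longrightarrow> Ck_on k S (f i)"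
  shows "Ck_on k S (\<lambda>x. \<Sum>i\<in>I. f i x)"
  using assms(2) by (induction I rule: infinite_finite_induct) (simp_all add: Ck_on_add[OF assms(1)])

lemma Ck_on_compose:
  fixes G :: "'f::euclidean_space \<Rightarrow> real" and T :: "'e::euclidean_space \<Rightarrow> 'f"
  assumes "open S" "open R" "T ` S \<subseteq> R"
  shows "Ck_on k S T \<Longrightarrow> Ck_on k R G \<Longrightarrow> Ck_on k S (\<lambda>x. G (T x))"
proof (induction k arbitrary: G)
  case 0
  then show ?case using assms(3) by (auto intro: continuous_on_compose2)
next
  case (Suc k)
  let ?DT = "\<lambda>x. frechet_derivative T (at x)" and ?DG = "\<lambda>x. frechet_derivative G (at x)"
  show ?case
  proof (rule Ck_on_Suc_has_derivativeI[OF assms(1)])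
    fix x assume x: "x \<in> S"
    have DG: "(G has_derivative ?DG (T x)) (at (T x))"
      using Suc.prems(2) x assms(3) by (intro Ck_on_Suc_has_derivative) auto
    \<comment> \<open>\<open>Ck_on\<close> speaks of derivatives in a fixed direction, but the chain
      rule differentiates \<open>G\<close> in the moving direction \<open>?DT x v\<close>. Expanding
      it in the basis leaves fixed directions with coefficients depending on
      \<open>x\<close>.\<close>
    have expand: "?DG (T x) w = (\<Sum>b\<in>Basis. (w \<bullet> b) * ?DG (T x) b)" for w
    proof -
      interpret linear "?DG (T x)" by (rule has_derivative_linear[OF DG])
      have "?DG (T x) w = ?DG (T x) (\<Sum>b\<in>Basis. (w \<bullet> b) *\<^sub>R b)"
        by (simp only: euclidean_representation)
      then show ?thesis by (simp only: sum scale real_scaleR_def)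
    qed
    have eq: "(\<lambda>v. ?DG (T x) (?DT x v)) = (\<lambda>v. \<Sum>b\<in>Basis. (?DT x v \<bullet> b) * ?DG (T x) b)"
      by (rule ext) (rule expand)
    show "((\<lambda>x. G (T x)) has_derivative
        (\<lambda>v. \<Sum>b\<in>Basis. (?DT x v \<bullet> b) * ?DG (T x) b)) (at x)"
      using has_derivative_compose[OF Ck_on_Suc_has_derivative[OF Suc.prems(1) x] DG]
      unfolding eq .
  next
    fix v
    show "Ck_on k S (\<lambda>x. \<Sum>b\<in>Basis. (?DT x v \<bullet> b) * ?DG (T x) b)"
      using Suc.prems
      by (intro Ck_on_sum Ck_on_mult assms(1) Suc.IH Ck_on_bounded_linear[OF _ bounded_linear_inner_left])
        (auto intro: Ck_on_SucD)
  qed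
qed

section \<open>Integrals along segments and Hadamard's lemma\<close>

lemma ball_segment:
  fixes a :: "'e::euclidean_space"
  assumes "x \<in> ball a r" "t \<in> {0..1}"
  shows "a + t *\<^sub>R (x - a) \<in> ball a r"
proof -
  have "norm (t *\<^sub>R (x - a)) \<le> 1 * norm (x - a)"
    using assms(2) unfolding norm_scaleR by (intro mult_right_mono) auto
  moreover have "norm (x - a) < r" using assms(1) by (simp add: dist_norm norm_minus_commute)
  moreover have "dist a (a + t *\<^sub>R (x - a)) = norm (t *\<^sub>R (x - a))"
    by (metis add_diff_cancel_left' dist_commute dist_norm)
  ultimately show ?thesis unfolding mem_ball by linarith
qed

text \<open>Differentiating under the integral replaces \<open>h\<close> by a directional derivative
  and produces one more factor \<open>t\<close> from the chain rule. The weight \<open>t ^ j\<close>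
  and the assumption for all \<open>k\<close> make the induction survive both changes.\<close>

lemma Ck_on_segment_integral:
  fixes h :: "'e::euclidean_space \<Rightarrow> real"
  assumes "\<And>k. Ck_on k (ball a r) h"
  shows "Ck_on k (ball a r) (\<lambda>x. integral {0..1} (\<lambda>t. t ^ j * h (a + t *\<^sub>R (x - a))))"
  using assms
proof (induction k arbitrary: h j)
  case 0
  have c: "continuous_on (ball a r) h" using 0[of 0] by simp
  have "continuous_on (ball a r \<times> cbox 0 1) (\<lambda>z. h (a + snd z *\<^sub>R (fst z - a)))"
    by (rule continuous_on_compose2[OF c]) (auto intro!: continuous_intros ball_segment)
  then have "continuous_on (ball a r \<times> cbox 0 1) (\<lambda>(x, t). t ^ j * h (a + t *\<^sub>R (x - a)))"
    by (auto simp: case_prod_beta intro!: continuous_intros)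
  from integral_continuous_on_param[OF this] show ?case by simp
next
  case (Suc k)
  let ?Dh = "\<lambda>x. frechet_derivative h (at x)"
  let ?c = "\<lambda>x t. a + t *\<^sub>R (x - a)"
  have Dh: "(h has_derivative ?Dh x) (at x)" if "x \<in> ball a r" for x
    using Ck_on_Suc_has_derivative[OF Suc.prems that] .
  have lin: "bounded_linear (\<lambda>v. t ^ Suc j * ?Dh (?c x t) v)"
    if "x \<in> ball a r" "t \<in> {0..1}" for x t
    using has_derivative_bounded_linear[OF Dh[OF ball_segment[OF that]]]
    by (rule bounded_linear_const_mult)
  \<comment> \<open>\<open>leibniz_rule\<close> expects the derivative as a bounded linear map
    depending continuously on \<open>(x, t)\<close>; continuity is then checked on basis
    vectors.\<close>
  define F where "F = (\<lambda>x t. Blinfun (\<lambda>v. t ^ Suc j * ?Dh (?c x t) v))"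
  have F: "blinfun_apply (F x t) v = t ^ Suc j * ?Dh (?c x t) v"
    if "x \<in> ball a r" "t \<in> {0..1}" for x t v
    unfolding F_def using lin[OF that] by (simp add: bounded_linear_Blinfun_apply)
  have seg: "continuous_on (ball a r \<times> cbox 0 1) (\<lambda>z. f (?c (fst z) (snd z)))"
    if "continuous_on (ball a r) f" for f :: "'e \<Rightarrow> real"
    by (rule continuous_on_compose2[OF that]) (auto intro!: continuous_intros ball_segment)
  have contF: "continuous_on (ball a r \<times> cbox 0 1) (\<lambda>(x, t). F x t)"
  proof (rule continuous_on_blinfun_componentwise)
    fix i :: 'e assume "i \<in> Basis"
    have "continuous_on (ball a r) (\<lambda>x. ?Dh x i)" using Suc.prems[of 1] by simp
    from seg[OF this]
    have "continuous_on (ball a r \<times> cbox 0 1) (\<lambda>z. snd z ^ Suc j * ?Dh (?c (fst z) (snd z)) i)"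
      by (intro continuous_intros)
    then show "continuous_on (ball a r \<times> cbox 0 1) (\<lambda>z. blinfun_apply (case z of (x, t) \<Rightarrow> F x t) i)"
      by (rule continuous_on_eq) (auto simp: F)
  qed
  have contF': "continuous_on {0..1} (F x)" if "x \<in> ball a r" for x
  proof -
    have "continuous_on {0..1} (\<lambda>t::real. (x, t))" by (intro continuous_intros)
    moreover have "(\<lambda>t::real. (x, t)) ` {0..1} \<subseteq> ball a r \<times> cbox 0 1"
      using that by (auto simp: cbox_interval)
    ultimately show ?thesis using continuous_on_compose2[OF contF] by fastforce
  qed
  have hcont: "continuous_on {0..1} (\<lambda>t. t ^ j * h (?c x t))" if x: "x \<in> ball a r" for x
  proof -
    have "continuous_on (ball a r) h" using Suc.prems[of 0] by simp
    then have "continuous_on {0..1} (\<lambda>t. h (?c x t))"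
      by (rule continuous_on_compose2) (auto intro!: continuous_intros ball_segment x)
    then show ?thesis by (intro continuous_intros)
  qed
  show ?case
  proof (rule Ck_on_Suc_has_derivativeI)
    fix x assume x: "x \<in> ball a r"
    have "((\<lambda>x. integral (cbox 0 1) (\<lambda>t. t ^ j * h (?c x t))) has_derivative
        blinfun_apply (integral (cbox 0 1) (F x))) (at x within ball a r)"
    proof (rule leibniz_rule[where fx = F])
      fix y and t :: real assume yt: "y \<in> ball a r" "t \<in> cbox 0 1"
      have d: "((\<lambda>x. ?c x t) has_derivative (\<lambda>v. t *\<^sub>R v)) (at y)"
        by (auto intro!: derivative_eq_intros)
      have D: "(h has_derivative ?Dh (?c y t)) (at (?c y t))"
        using Dh[OF ball_segment] yt by simp
      have "((\<lambda>x. t ^ j * h (?c x t)) has_derivative (\<lambda>v. t ^ j * ?Dh (?c y t) (t *\<^sub>R v))) (at y)"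
        by (rule has_derivative_mult_right[OF has_derivative_compose[OF d D]])
      moreover have "(\<lambda>v. t ^ j * ?Dh (?c y t) (t *\<^sub>R v)) = blinfun_apply (F y t)"
        using yt linear_scale[OF has_derivative_linear[OF D]] by (auto simp: F)
      ultimately show "((\<lambda>x. t ^ j * h (?c x t)) has_derivative blinfun_apply (F y t)) (at y within ball a r)"
        by (auto intro: has_derivative_at_withinI)
    qed (use hcont contF x in \<open>auto intro!: integrable_continuous_real\<close>)
    moreover have "blinfun_apply (integral (cbox 0 1) (F x)) v
        = integral {0..1} (\<lambda>t. t ^ Suc j * ?Dh (?c x t) v)" for v
    proof -
      have "blinfun_apply (integral {0..1} (F x)) v = integral {0..1} (\<lambda>t. blinfun_apply (F x t) v)"
        using integral_linear[OF integrable_continuous_real[OF contF'[OF x]]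
            blinfun.bounded_linear_left[of v]]
        by (simp add: o_def)
      also have "\<dots> = integral {0..1} (\<lambda>t. t ^ Suc j * ?Dh (?c x t) v)"
        by (rule integral_cong) (rule F[OF x])
      finally show ?thesis by (simp only: cbox_interval)
    qed
    then have "blinfun_apply (integral (cbox 0 1) (F x))
        = (\<lambda>v. integral {0..1} (\<lambda>t. t ^ Suc j * ?Dh (?c x t) v))" by blast
    ultimately show "((\<lambda>x. integral {0..1} (\<lambda>t. t ^ j * h (?c x t))) has_derivative
        (\<lambda>v. integral {0..1} (\<lambda>t. t ^ Suc j * ?Dh (?c x t) v))) (at x)"
      using x by (simp add: at_within_open[OF x open_ball])
  next
    show "Ck_on k (ball a r) (\<lambda>x. integral {0..1} (\<lambda>t. t ^ Suc j * ?Dh (?c x t) v))" for v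
    proof (rule Suc.IH)
      show "Ck_on k (ball a r) (\<lambda>x. ?Dh x v)" for k
        using Suc.prems[of "Suc k"] by simp
    qed
  qed simp
qed

text \<open>The coefficients are the integrals of the partial derivatives along the segment from \<open>a\<close>
  to \<open>x\<close>.\<close>

lemma Hadamard:
  fixes h :: "'e::euclidean_space \<Rightarrow> real"
  assumes "Cinf_on (ball a r) h" "0 < r"
  obtains G where "\<And>b. Cinf_on (ball a r) (G b)"
    and "\<And>x. x \<in> ball a r \<Longrightarrow> h x = h a + (\<Sum>b\<in>Basis. ((x - a) \<bullet> b) * G b x)"
    and "\<And>b. G b a = frechet_derivative h (at a) b"
proof
  let ?Dh = "\<lambda>x. frechet_derivative h (at x)"
  let ?c = "\<lambda>x t. a + t *\<^sub>R (x - a)"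
  \<comment> \<open>The factor \<open>t ^ 0\<close> only puts the coefficient into the shape of
    \<open>Ck_on_segment_integral\<close>.\<close>
  let ?G = "\<lambda>b x. integral {0..1} (\<lambda>t. t ^ 0 * ?Dh (?c x t) b)"
  have C: "Ck_on k (ball a r) h" for k using assms(1) by (simp add: Cinf_on_def)
  have CD: "Ck_on k (ball a r) (\<lambda>x. ?Dh x b)" for k b using C[of "Suc k"] by simp
  show "Cinf_on (ball a r) (?G b)" for b
    unfolding Cinf_on_def using Ck_on_segment_integral[OF CD] by blast
  show "?G b a = ?Dh a b" for b by simp
  fix x assume x: "x \<in> ball a r"
  have D: "(h has_derivative ?Dh (?c x t)) (at (?c x t))" if "t \<in> {0..1}" for t
    by (rule Ck_on_Suc_has_derivative[OF C ball_segment[OF x that]])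
  have int: "(\<lambda>t. ?Dh (?c x t) b) integrable_on {0..1}" for b
  proof (rule integrable_continuous_real)
    have "continuous_on (ball a r) (\<lambda>x. ?Dh x b)" using CD[of 0] by simp
    then show "continuous_on {0..1} (\<lambda>t. ?Dh (?c x t) b)"
      by (rule continuous_on_compose2) (auto intro!: continuous_intros ball_segment x)
  qed
  have "((\<lambda>t. ?Dh (?c x t) (x - a)) has_integral (h (?c x 1) - h (?c x 0))) {0..1}"
  proof (rule fundamental_theorem_of_calculus)
    fix t :: real assume t: "t \<in> {0..1}"
    have d: "(?c x has_derivative (\<lambda>s. s *\<^sub>R (x - a))) (at t)"
      by (auto intro!: derivative_eq_intros)
    have "((\<lambda>t. h (?c x t)) has_derivative (\<lambda>s. ?Dh (?c x t) (s *\<^sub>R (x - a)))) (at t)"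
      by (rule has_derivative_compose[OF d D[OF t]])
    then show "((\<lambda>t. h (?c x t)) has_vector_derivative ?Dh (?c x t) (x - a)) (at t within {0..1})"
      unfolding has_vector_derivative_def
      using linear_scale[OF has_derivative_linear[OF D[OF t]]] by (auto intro: has_derivative_at_withinI)
  qed simp
  then have "h x - h a = integral {0..1} (\<lambda>t. ?Dh (?c x t) (x - a))"
    by (simp add: integral_unique)
  also have "\<dots> = integral {0..1} (\<lambda>t. \<Sum>b\<in>Basis. ((x - a) \<bullet> b) * ?Dh (?c x t) b)"
  proof (rule integral_cong)
    fix t :: real assume "t \<in> {0..1}"
    interpret linear "?Dh (?c x t)" by (rule has_derivative_linear[OF D[OF \<open>t \<in> {0..1}\<close>]])
    have "?Dh (?c x t) (x - a) = ?Dh (?c x t) (\<Sum>b\<in>Basis. ((x - a) \<bullet> b) *\<^sub>R b)"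
      by (simp only: euclidean_representation)
    also have "\<dots> = (\<Sum>b\<in>Basis. ((x - a) \<bullet> b) * ?Dh (?c x t) b)"
      by (simp only: sum scale real_scaleR_def)
    finally show "?Dh (?c x t) (x - a) = (\<Sum>b\<in>Basis. ((x - a) \<bullet> b) * ?Dh (?c x t) b)" .
  qed
  also have "\<dots> = (\<Sum>b\<in>Basis. ((x - a) \<bullet> b) * ?G b x)"
    using int by (subst integral_sum) (auto intro!: integrable_on_mult_right)
  finally show "h x = h a + (\<Sum>b\<in>Basis. ((x - a) \<bullet> b) * ?G b x)" by simp
qed

section \<open>Smooth functions and tangent vectors\<close>

lemma sum_fun_app: "(\<Sum>i\<in>I. F i) x = (\<Sum>i\<in>I. F i x)"
  by (induction I rule: infinite_finite_induct) simp_all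

locale smooth_mfd =
  fixes M :: "('a, 'e::euclidean_space) manifold"
  assumes smooth_manifold: "smooth_manifold M"
begin

lemma open_points: "openin (top_space M) (points M)"
  by (simp add: points_def)

section \<open>Charts\<close>

lemma chart_cases:
  assumes "p \<in> points M"
  obtains U c where "(U, c) \<in> atlas M" "p \<in> U"
  using smooth_manifold assms unfolding smooth_manifold_def by blast

lemma is_chart: "(U, c) \<in> atlas M \<Longrightarrow> is_chart (top_space M) U c"
  using smooth_manifold unfolding smooth_manifold_def by auto

lemma chart_open: "(U, c) \<in> atlas M \<Longrightarrow> openin (top_space M) U"
  using is_chart unfolding is_chart_def by blast

lemma chart_inj:
  assumes "(U, c) \<in> atlas M"
  shows "inj_on c U"
proof -
  have "inj_on c (topspace (subtopology (top_space M) U))"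
    using is_chart[OF assms] homeomorphic_imp_injective_map unfolding is_chart_def by blast
  then show ?thesis
    using openin_subset[OF chart_open[OF assms]] by (simp add: Int_absorb1)
qed

lemma chart_image_open:
  assumes "(U, c) \<in> atlas M" "openin (top_space M) W"
  shows "open (c ` (W \<inter> U))"
proof -
  have "open_map (subtopology (top_space M) U) (top_of_set (c ` U)) c"
    using is_chart[OF assms(1)] homeomorphic_imp_open_map unfolding is_chart_def by blast
  moreover have "openin (subtopology (top_space M) U) (W \<inter> U)"
    using assms(2) openin_subtopology by blast
  ultimately have "openin (top_of_set (c ` U)) (c ` (W \<inter> U))"
    unfolding open_map_def by blast
  then show ?thesis
    using is_chart[OF assms(1)] openin_open_trans unfolding is_chart_def by blast
qed

lemma chart_preimage_open:
  assumes "(U, c) \<in> atlas M" "openin (top_space M) W" "open B"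
  shows "openin (top_space M) {q \<in> W \<inter> U. c q \<in> B}"
proof -
  have U: "openin (top_space M) U" by (rule chart_open[OF assms(1)])
  have "continuous_map (subtopology (top_space M) U) (top_of_set (c ` U)) c"
    using is_chart[OF assms(1)] homeomorphic_imp_continuous_map unfolding is_chart_def by blast
  moreover have "openin (top_of_set (c ` U)) (c ` U \<inter> B)"
    using assms(3) by (simp add: openin_open_Int)
  ultimately have "openin (subtopology (top_space M) U)
      {q \<in> topspace (subtopology (top_space M) U). c q \<in> c ` U \<inter> B}"
    by (rule openin_continuous_map_preimage)
  moreover have "{q \<in> topspace (subtopology (top_space M) U). c q \<in> c ` U \<inter> B} = {q \<in> U. c q \<in> B}"
    using openin_subset[OF U] by auto
  ultimately have "openin (top_space M) {q \<in> U. c q \<in> B}"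
    using openin_trans_full U by fastforce
  from openin_Int[OF assms(2) this] show ?thesis by (simp add: Collect_conj_eq Int_assoc)
qed

section \<open>Smooth functions on open sets\<close>

lemma smooth_fun_iff:
  "smooth_fun M W f \<longleftrightarrow> openin (top_space M) W \<and>
    (\<forall>V c k. (V, c) \<in> atlas M \<longrightarrow> Ck_on k (c ` (W \<inter> V)) (\<lambda>x. f (inv_into V c x)))"
  unfolding smooth_fun_def Cinf_on_def by (auto simp: o_def)

lemma smooth_fun_open: "smooth_fun M W f \<Longrightarrow> openin (top_space M) W"
  by (simp add: smooth_fun_def)

lemma smooth_fun_subset:
  assumes "smooth_fun M W f" "openin (top_space M) W'" "W' \<subseteq> W"
  shows "smooth_fun M W' f"
  using assms unfolding smooth_fun_iff by (meson Ck_on_subset Int_mono image_mono order_refl)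

lemma smooth_fun_cong:
  assumes "\<And>q. q \<in> W \<Longrightarrow> f q = g q" "smooth_fun M W f"
  shows "smooth_fun M W g"
  unfolding smooth_fun_iff
proof (intro conjI allI impI)
  show W: "openin (top_space M) W" by (rule smooth_fun_open[OF assms(2)])
  fix V c k assume V: "(V, c) \<in> atlas M"
  show "Ck_on k (c ` (W \<inter> V)) (\<lambda>x. g (inv_into V c x))"
  proof (rule Ck_on_cong[OF chart_image_open[OF V W]])
    show "Ck_on k (c ` (W \<inter> V)) (\<lambda>x. f (inv_into V c x))"
      using assms(2) V unfolding smooth_fun_iff by blast
    show "f (inv_into V c x) = g (inv_into V c x)" if "x \<in> c ` (W \<inter> V)" for x
      using that assms(1) chart_inj[OF V] by auto
  qed
qed

lemma smooth_fun_const: "openin (top_space M) W \<Longrightarrow> smooth_fun M W (\<lambda>q. a)"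
  by (simp add: smooth_fun_iff)

lemma smooth_fun_add:
  "smooth_fun M W f \<Longrightarrow> smooth_fun M W g \<Longrightarrow> smooth_fun M W (\<lambda>q. f q + g q)"
  unfolding smooth_fun_iff by (auto intro!: Ck_on_add chart_image_open)

lemma smooth_fun_mult:
  "smooth_fun M W f \<Longrightarrow> smooth_fun M W g \<Longrightarrow> smooth_fun M W (\<lambda>q. f q * g q)"
  unfolding smooth_fun_iff by (auto intro!: Ck_on_mult chart_image_open)

lemma smooth_fun_cmult: "smooth_fun M W f \<Longrightarrow> smooth_fun M W (\<lambda>q. a * f q)"
  by (intro smooth_fun_mult smooth_fun_const smooth_fun_open)

lemma smooth_fun_sum:
  assumes "openin (top_space M) W" "\<And>i. i \<in> I \<Longrightarrow> smooth_fun M W (f i)"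
  shows "smooth_fun M W (\<lambda>q. \<Sum>i\<in>I. f i q)"
  using assms(2)
  by (induction I rule: infinite_finite_induct)
    (simp_all add: smooth_fun_const[OF assms(1)] smooth_fun_add)

lemma smooth_fun_prod:
  assumes "openin (top_space M) W" "\<And>i. i \<in> I \<Longrightarrow> smooth_fun M W (f i)"
  shows "smooth_fun M W (\<lambda>q. \<Prod>i\<in>I. f i q)"
  using assms(2)
  by (induction I rule: infinite_finite_induct)
    (simp_all add: smooth_fun_const[OF assms(1)] smooth_fun_mult)

text \<open>Read in another chart, the function is \<open>G\<close> after a transition map. This
  turns the coefficients of a Hadamard expansion into smooth functions on the manifold.\<close>

lemma smooth_fun_chart_compose:
  fixes G :: "'e \<Rightarrow> real"
  assumes U: "(U, c) \<in> atlas M" and W: "openin (top_space M) W" "W \<subseteq> U"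
    and G: "open R" "c ` W \<subseteq> R" "Cinf_on R G"
  shows "smooth_fun M W (\<lambda>q. G (c q))"
  unfolding smooth_fun_iff
proof (intro conjI allI impI)
  fix V d k assume V: "(V, d) \<in> atlas M"
  have "Cinf_on (d ` (V \<inter> U)) (c \<circ> inv_into V d)"
    using smooth_manifold U V unfolding smooth_manifold_def by blast
  then have T: "Ck_on k (d ` (W \<inter> V)) (\<lambda>x. c (inv_into V d x))"
    unfolding Cinf_on_def o_def using W(2) by (auto intro: Ck_on_subset)
  show "Ck_on k (d ` (W \<inter> V)) (\<lambda>x. G (c (inv_into V d x)))"
  proof (rule Ck_on_compose[OF chart_image_open[OF V W(1)] G(1) _ T])
    show "(\<lambda>x. c (inv_into V d x)) ` d ` (W \<inter> V) \<subseteq> R"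
      using G(2) chart_inj[OF V] by auto
    show "Ck_on k R G" using G(3) by (simp add: Cinf_on_def)
  qed
qed (use W in simp)

lemma smooth_fun_coordinate:
  "(U, c) \<in> atlas M \<Longrightarrow> smooth_fun M U (\<lambda>q. c q \<bullet> b)"
  by (rule smooth_fun_chart_compose[where R = UNIV])
    (auto simp: Cinf_on_def chart_open intro!: Ck_on_bounded_linear[OF _ bounded_linear_inner_left] Ck_on_id)

lemma smooth_nearI: "smooth_fun M W f \<Longrightarrow> p \<in> W \<Longrightarrow> smooth_near M p f"
  unfolding smooth_near_def by blast

section \<open>Functions smooth near a point\<close>

lemma smooth_near_common:
  assumes "smooth_near M p f" "smooth_near M p g"
  obtains W where "p \<in> W" "smooth_fun M W f" "smooth_fun M W g"
proof -
  obtain W1 W2 where "p \<in> W1" "smooth_fun M W1 f" "p \<in> W2" "smooth_fun M W2 g"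
    using assms unfolding smooth_near_def by blast
  then have "p \<in> W1 \<inter> W2" "smooth_fun M (W1 \<inter> W2) f" "smooth_fun M (W1 \<inter> W2) g"
    using smooth_fun_open by (auto intro: smooth_fun_subset)
  then show ?thesis by (rule that)
qed

lemma smooth_near_const: "p \<in> points M \<Longrightarrow> smooth_near M p (\<lambda>q. a)"
  by (rule smooth_nearI[where W = "points M"]) (simp_all add: points_def smooth_fun_const)

lemma smooth_near_add:
  assumes "smooth_near M p f" "smooth_near M p g"
  shows "smooth_near M p (\<lambda>q. f q + g q)"
proof -
  obtain W where "p \<in> W" "smooth_fun M W f" "smooth_fun M W g"
    using smooth_near_common[OF assms] .
  then show ?thesis by (blast intro: smooth_nearI smooth_fun_add)
qed

lemma smooth_near_mult:
  assumes "smooth_near M p f" "smooth_near M p g"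
  shows "smooth_near M p (\<lambda>q. f q * g q)"
proof -
  obtain W where "p \<in> W" "smooth_fun M W f" "smooth_fun M W g"
    using smooth_near_common[OF assms] .
  then show ?thesis by (blast intro: smooth_nearI smooth_fun_mult)
qed

lemma smooth_near_point: "smooth_near M p f \<Longrightarrow> p \<in> points M"
  unfolding smooth_near_def points_def using smooth_fun_open openin_subset by blast

lemma smooth_near_cmult: "smooth_near M p f \<Longrightarrow> smooth_near M p (\<lambda>q. a * f q)"
  using smooth_near_mult[OF smooth_near_const] smooth_near_point by blast

lemma smooth_near_sum:
  assumes "p \<in> points M" "\<And>i. i \<in> I \<Longrightarrow> smooth_near M p (f i)"
  shows "smooth_near M p (\<lambda>q. \<Sum>i\<in>I. f i q)"
  using assms(2)
  by (induction I rule: infinite_finite_induct)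
    (simp_all add: smooth_near_const[OF assms(1)] smooth_near_add)

lemma smooth_near_cong:
  assumes "openin (top_space M) W" "p \<in> W" "\<And>q. q \<in> W \<Longrightarrow> f q = g q" "smooth_near M p f"
  shows "smooth_near M p g"
proof -
  obtain W' where W': "p \<in> W'" "smooth_fun M W' f"
    using assms(4) unfolding smooth_near_def by blast
  have "smooth_fun M (W \<inter> W') f"
    using W'(2) assms(1) smooth_fun_open by (auto intro: smooth_fun_subset)
  then have "smooth_fun M (W \<inter> W') g" by (rule smooth_fun_cong[rotated]) (use assms(3) in auto)
  then show ?thesis by (rule smooth_nearI) (use W'(1) assms(2) in blast)
qed

section \<open>Tangent vectors as derivations\<close>

lemma tangent_add:
  "v \<in> tangent_space M p \<Longrightarrow> smooth_near M p f \<Longrightarrow> smooth_near M p g \<Longrightarrow>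
    v (\<lambda>q. f q + g q) = v f + v g"
  by (simp add: tangent_space_def)

lemma tangent_mult:
  "v \<in> tangent_space M p \<Longrightarrow> smooth_near M p f \<Longrightarrow> smooth_near M p g \<Longrightarrow>
    v (\<lambda>q. f q * g q) = v f * g p + f p * v g"
  by (simp add: tangent_space_def)

lemma tangent_cmult:
  "v \<in> tangent_space M p \<Longrightarrow> smooth_near M p f \<Longrightarrow> v (\<lambda>q. a * f q) = a * v f"
  by (simp add: tangent_space_def)

lemma tangent_not_smooth: "v \<in> tangent_space M p \<Longrightarrow> \<not> smooth_near M p f \<Longrightarrow> v f = 0"
  by (simp add: tangent_space_def)

lemma tangent_const:
  assumes "v \<in> tangent_space M p" "p \<in> points M"
  shows "v (\<lambda>q. a) = 0"
proof -
  have "v (\<lambda>q. 1 * 1) = v (\<lambda>q. 1) + v (\<lambda>q. 1)"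
    using tangent_mult[OF assms(1) smooth_near_const smooth_near_const, of 1 1] assms(2) by simp
  then have "v (\<lambda>q. 1) = 0" by simp
  then show ?thesis
    using tangent_cmult[OF assms(1) smooth_near_const, of a 1] assms(2) by simp
qed

lemma tangent_sum:
  assumes "v \<in> tangent_space M p" "p \<in> points M" "\<And>i. i \<in> I \<Longrightarrow> smooth_near M p (f i)"
  shows "v (\<lambda>q. \<Sum>i\<in>I. f i q) = (\<Sum>i\<in>I. v (f i))"
  using assms(3)
  by (induction I rule: infinite_finite_induct)
    (simp_all add: tangent_const[OF assms(1,2)] tangent_add[OF assms(1)] smooth_near_sum[OF assms(2)])

text \<open>A derivation kills the indicator function of a neighbourhood, since that function is
  idempotent; so it depends on germs only.\<close>

lemma tangent_cong:
  assumes v: "v \<in> tangent_space M p"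
    and W: "openin (top_space M) W" "p \<in> W" "\<And>q. q \<in> W \<Longrightarrow> f q = g q"
  shows "v f = v g"
proof (cases "smooth_near M p f")
  case False
  then have "\<not> smooth_near M p g" using smooth_near_cong[OF W(1,2), of g f] W(3) by metis
  with False show ?thesis using tangent_not_smooth[OF v] by simp
next
  case f: True
  have g: "smooth_near M p g" by (rule smooth_near_cong[OF W f])
  define i where "i = (\<lambda>q. if q \<in> W then 1 else (0::real))"
  have i: "smooth_near M p i"
    by (rule smooth_near_cong[OF W(1,2) _ smooth_near_const[of p 1]])
      (auto simp: i_def smooth_near_point[OF f])
  have ip: "i p = 1" using W(2) by (simp add: i_def)
  have "(\<lambda>q. i q * i q) = i" by (auto simp: i_def)
  then have "v i = v i + v i" using tangent_mult[OF v i i] by (simp add: ip)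
  then have vi: "v i = 0" by simp
  have "(\<lambda>q. f q * i q) = (\<lambda>q. g q * i q)" using W(3) by (auto simp: i_def)
  moreover have "v (\<lambda>q. f q * i q) = v f" using tangent_mult[OF v f i] by (simp add: vi ip)
  moreover have "v (\<lambda>q. g q * i q) = v g" using tangent_mult[OF v g i] by (simp add: vi ip)
  ultimately show ?thesis by metis
qed

lemma tangent_subspace: "subspace (tangent_space M p)"
  unfolding subspace_def tangent_space_def
  by (auto simp: plus_fun_def scaleR_fun_def zero_fun_def algebra_simps)

lemma tangent_zero [simp]: "0 \<in> tangent_space M p"
  and tangent_plus [simp]: "u \<in> tangent_space M p \<Longrightarrow> v \<in> tangent_space M p \<Longrightarrow> u + v \<in> tangent_space M p"
  and tangent_scaleR [simp]: "u \<in> tangent_space M p \<Longrightarrow> a *\<^sub>R u \<in> tangent_space M p"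
  and tangent_uminus [simp]: "u \<in> tangent_space M p \<Longrightarrow> - u \<in> tangent_space M p"
  and tangent_minus [simp]: "u \<in> tangent_space M p \<Longrightarrow> v \<in> tangent_space M p \<Longrightarrow> u - v \<in> tangent_space M p"
  using tangent_subspace[of p]
  by (auto intro: subspace_0 subspace_add subspace_scale subspace_neg subspace_diff)

subsection \<open>The dimension of the tangent spaces\<close>

text \<open>The basis consists of the partial derivatives in a chart. They are dual to the
  coordinate functions, hence independent; they span because Hadamard's lemma writes a function near
  \<open>p\<close> as a constant plus coordinates times smooth coefficients.\<close>

lemma tangent_space_basis:
  assumes p: "p \<in> points M"
  obtains B where "finite B" "card B = DIM('e)" "independent B" "span B = tangent_space M p"
proof -
  obtain U c where U: "(U, c) \<in> atlas M" "p \<in> U" using chart_cases[OF p] .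
  let ?a = "c p"
  let ?r = "\<lambda>f x. f (inv_into U c x)"
  \<comment> \<open>The value 0 off the smooth germs is the convention of
    \<open>tangent_space\<close>, without which \<open>D b\<close> would not belong to it.\<close>
  define D where "D = (\<lambda>b f. if smooth_near M p f then frechet_derivative (?r f) (at ?a) b else 0)"
  have DD: "(?r f has_derivative (\<lambda>b. D b f)) (at ?a)" if f: "smooth_near M p f" for f
  proof -
    obtain W where W: "p \<in> W" "smooth_fun M W f" using f unfolding smooth_near_def by blast
    then have "Ck_on (Suc 0) (c ` (W \<inter> U)) (?r f)" using U(1) unfolding smooth_fun_iff by blast
    from Ck_on_Suc_has_derivative[OF this, of ?a] W(1) U(2) show ?thesis
      using f by (auto simp: D_def)
  qed
  have D_tangent: "D b \<in> tangent_space M p" for b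
  proof -
    have 1: "D b (\<lambda>q. f q + g q) = D b f + D b g" "D b (\<lambda>q. f q * g q) = D b f * g p + f p * D b g"
      if fg: "smooth_near M p f" "smooth_near M p g" for f g
    proof -
      have "(\<lambda>b. D b (\<lambda>q. f q + g q)) = (\<lambda>b. D b f + D b g)"
        by (rule has_derivative_unique[OF DD[OF smooth_near_add[OF fg]]
              has_derivative_add[OF DD[OF fg(1)] DD[OF fg(2)]]])
      then show "D b (\<lambda>q. f q + g q) = D b f + D b g" by metis
      have "(\<lambda>b. D b (\<lambda>q. f q * g q)) = (\<lambda>b. ?r f ?a * D b g + D b f * ?r g ?a)"
        by (rule has_derivative_unique[OF DD[OF smooth_near_mult[OF fg]]
              has_derivative_mult[OF DD[OF fg(1)] DD[OF fg(2)]]])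
      from fun_cong[OF this, of b]
      show "D b (\<lambda>q. f q * g q) = D b f * g p + f p * D b g"
        using chart_inj[OF U(1)] U(2) by simp
    qed
    have 2: "D b (\<lambda>q. a * f q) = a * D b f" if f: "smooth_near M p f" for f a
    proof -
      have "(\<lambda>b. D b (\<lambda>q. a * f q)) = (\<lambda>b. a * D b f)"
        by (rule has_derivative_unique[OF DD[OF smooth_near_cmult[OF f]]
              has_derivative_mult_right[OF DD[OF f]]])
      then show ?thesis by metis
    qed
    show ?thesis unfolding tangent_space_def using 1 2 by (auto simp: D_def)
  qed
  have coord: "smooth_near M p (\<lambda>q. c q \<bullet> b)" for b
    by (rule smooth_nearI[OF smooth_fun_coordinate[OF U(1)] U(2)])
  have D_coord: "D b (\<lambda>q. c q \<bullet> b') = b \<bullet> b'" for b b'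
  proof -
    have "((\<lambda>x. x \<bullet> b') has_derivative (\<lambda>b. b \<bullet> b')) (at ?a)"
      by (intro bounded_linear_imp_has_derivative bounded_linear_inner_left)
    moreover have "open (c ` U)" using is_chart[OF U(1)] by (simp add: is_chart_def)
    ultimately have "(?r (\<lambda>q. c q \<bullet> b') has_derivative (\<lambda>b. b \<bullet> b')) (at ?a)"
      using U(2) chart_inj[OF U(1)]
      by (elim has_derivative_transform_within_open) (auto simp: f_inv_into_f)
    from has_derivative_unique[OF DD[OF coord] this] show ?thesis by metis
  qed
  have expand: "v = (\<Sum>b\<in>Basis. v (\<lambda>q. c q \<bullet> b) *\<^sub>R D b)" if v: "v \<in> tangent_space M p" for v
  proof
    fix f
    show "v f = (\<Sum>b\<in>Basis. v (\<lambda>q. c q \<bullet> b) *\<^sub>R D b) f"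
    proof (cases "smooth_near M p f")
      case False
      then show ?thesis
        using tangent_not_smooth[OF v False] by (simp add: sum_fun_app scaleR_fun_def D_def)
    next
      case True
      then obtain W where W: "p \<in> W" "smooth_fun M W f" unfolding smooth_near_def by blast
      have oW: "openin (top_space M) W" by (rule smooth_fun_open[OF W(2)])
      have "?a \<in> c ` (W \<inter> U)" using W(1) U(2) by blast
      then obtain r where r: "0 < r" "ball ?a r \<subseteq> c ` (W \<inter> U)"
        using chart_image_open[OF U(1) oW] openE by blast
      have "Cinf_on (ball ?a r) (?r f)"
        using W(2) U(1) r(2) unfolding smooth_fun_iff Cinf_on_def by (blast intro: Ck_on_subset)
      then obtain G where G: "\<And>b. Cinf_on (ball ?a r) (G b)"
        "\<And>x. x \<in> ball ?a r \<Longrightarrow> ?r f x = ?r f ?a + (\<Sum>b\<in>Basis. ((x - ?a) \<bullet> b) * G b x)"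
        "\<And>b. G b ?a = frechet_derivative (?r f) (at ?a) b"
        by (rule Hadamard[OF _ r(1)]) blast
      define W' where "W' = {q \<in> W \<inter> U. c q \<in> ball ?a r}"
      have W': "openin (top_space M) W'" "p \<in> W'"
        unfolding W'_def using chart_preimage_open[OF U(1) oW open_ball] W(1) U(2) r(1) by auto
      have g: "smooth_near M p (\<lambda>q. G b (c q))" for b
        by (rule smooth_nearI[OF smooth_fun_chart_compose[OF U(1) W'(1) _ open_ball _ G(1)] W'(2)])
          (auto simp: W'_def)
      \<comment> \<open>The difference is written as a sum with a constant, so that
        \<open>tangent_add\<close> and \<open>tangent_const\<close> apply to it.\<close>
      have x: "smooth_near M p (\<lambda>q. c q \<bullet> b + - (?a \<bullet> b))" for b
        by (intro smooth_near_add coord smooth_near_const p)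
      have xg: "smooth_near M p (\<lambda>q. (c q \<bullet> b + - (?a \<bullet> b)) * G b (c q))" for b
        by (intro smooth_near_mult x g)
      \<comment> \<open>The expansion holds only near \<open>p\<close>, which suffices since
        \<open>v\<close> depends on germs.\<close>
      have "v f = v (\<lambda>q. f p + (\<Sum>b\<in>Basis. (c q \<bullet> b + - (?a \<bullet> b)) * G b (c q)))"
      proof (rule tangent_cong[OF v W'])
        fix q assume q: "q \<in> W'"
        then have "?r f (c q) = f q" "?r f ?a = f p"
          using chart_inj[OF U(1)] U(2) by (auto simp: W'_def)
        with G(2)[of "c q"] q show "f q = f p + (\<Sum>b\<in>Basis. (c q \<bullet> b + - (?a \<bullet> b)) * G b (c q))"
          by (simp add: W'_def inner_diff_left)
      qed
      also have "\<dots> = (\<Sum>b\<in>Basis. v (\<lambda>q. (c q \<bullet> b + - (?a \<bullet> b)) * G b (c q)))"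
        unfolding tangent_add[OF v smooth_near_const[OF p] smooth_near_sum[OF p xg]]
            tangent_const[OF v p] tangent_sum[OF v p xg] by simp
      \<comment> \<open>The first factor vanishes at \<open>p\<close>, so the Leibniz rule keeps
        only its derivative times the coefficient at \<open>p\<close>, which is the partial
        derivative of \<open>f\<close>.\<close>
      also have "\<dots> = (\<Sum>b\<in>Basis. v (\<lambda>q. c q \<bullet> b) * D b f)"
      proof (rule sum.cong[OF refl])
        fix b :: 'e
        show "v (\<lambda>q. (c q \<bullet> b + - (?a \<bullet> b)) * G b (c q)) = v (\<lambda>q. c q \<bullet> b) * D b f"
          unfolding tangent_mult[OF v x g] tangent_add[OF v coord smooth_near_const[OF p]]
          by (simp add: tangent_const[OF v p] G(3) D_def True)
      qed
      finally show ?thesis by (simp add: sum_fun_app scaleR_fun_def)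
    qed
  qed
  have inj: "inj_on D Basis"
  proof (rule inj_onI)
    fix b b' :: 'e assume b: "b \<in> Basis" "b' \<in> Basis" "D b = D b'"
    then have "b \<bullet> b = b' \<bullet> b" by (metis D_coord)
    with b show "b = b'" by (metis inner_Basis zero_neq_one)
  qed
  have scalars: "u v = 0"
    if 0: "(\<Sum>x\<in>D ` Basis. u x *\<^sub>R x) = 0" and v: "v \<in> D ` Basis" for u v
  proof -
    from v obtain b where b: "b \<in> Basis" "v = D b" by blast
    have "(\<Sum>b'\<in>Basis. u (D b') *\<^sub>R D b') = 0" using 0 inj by (simp add: sum.reindex)
    then have "(\<Sum>b'\<in>Basis. u (D b') *\<^sub>R D b') (\<lambda>q. c q \<bullet> b) = 0" by simp
    then have 0: "(\<Sum>b'\<in>Basis. u (D b') * (b' \<bullet> b)) = 0" by (simp add: sum_fun_app scaleR_fun_def D_coord)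
    have "(\<Sum>b'\<in>Basis. u (D b') * (b' \<bullet> b)) = (\<Sum>b'\<in>Basis. if b' = b then u (D b') else 0)"
      using b(1) by (intro sum.cong) (auto simp: inner_Basis)
    with 0 have "(\<Sum>b'\<in>Basis. if b' = b then u (D b') else 0) = 0" by (simp only:)
    then show "u v = 0" using b(1) unfolding b(2) by (simp only: sum.delta finite_Basis if_True)
  qed
  have "independent (D ` Basis)"
    by (rule independent_if_scalars_zero[OF finite_imageI[OF finite_Basis]]) (use scalars in blast)
  moreover have "span (D ` Basis) = tangent_space M p"
  proof (rule subset_antisym)
    show "span (D ` Basis) \<subseteq> tangent_space M p"
      by (rule span_minimal[OF _ tangent_subspace]) (use D_tangent in blast)
    show "tangent_space M p \<subseteq> span (D ` Basis)"
    proof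
      fix v assume v: "v \<in> tangent_space M p"
      have eq: "(\<Sum>b\<in>Basis. v (\<lambda>q. c q \<bullet> b) *\<^sub>R D b) = v" using expand[OF v] by (rule sym)
      have "(\<Sum>b\<in>Basis. v (\<lambda>q. c q \<bullet> b) *\<^sub>R D b) \<in> span (D ` Basis)"
        by (intro span_sum span_scale span_base imageI)
      then show "v \<in> span (D ` Basis)"
        by (simp only: eq)
    qed
  qed
  ultimately show ?thesis
    using that[of "D ` Basis"] card_image[OF inj] finite_imageI[OF finite_Basis] by blast
qed

section \<open>Vector fields and Lie brackets\<close>

lemma vector_field_tangent: "vector_field M X \<Longrightarrow> p \<in> points M \<Longrightarrow> X p \<in> tangent_space M p"
  by (simp add: vector_field_def)

lemma vector_field_smooth: "vector_field M X \<Longrightarrow> smooth_fun M W f \<Longrightarrow> smooth_fun M W (\<lambda>q. X q f)"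
  by (simp add: vector_field_def)

lemma vector_field_smooth_near:
  "vector_field M X \<Longrightarrow> smooth_near M p f \<Longrightarrow> smooth_near M p (\<lambda>q. X q f)"
  unfolding smooth_near_def using vector_field_smooth by blast

lemma vector_field_add:
  assumes "vector_field M X" "vector_field M Y"
  shows "vector_field M (\<lambda>q. X q + Y q)"
  using assms unfolding vector_field_def by (auto intro: smooth_fun_add)

lemma vector_field_mult:
  assumes f: "smooth_fun M (points M) f" and X: "vector_field M X"
  shows "vector_field M (\<lambda>q. f q *\<^sub>R X q)"
  unfolding vector_field_def scaleR_fun_def[of "f _" "X _"] real_scaleR_def
proof (intro conjI ballI allI impI)
  show "(\<lambda>x. f p * X p x) \<in> tangent_space M p" if "p \<in> points M" for p
    using tangent_scaleR[OF vector_field_tangent[OF X that], of "f p"] by (simp add: scaleR_fun_def)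
  fix W h assume h: "smooth_fun M W h"
  have W: "openin (top_space M) W" by (rule smooth_fun_open[OF h])
  have "smooth_fun M W f"
    by (rule smooth_fun_subset[OF f W]) (use openin_subset[OF W] in \<open>simp add: points_def\<close>)
  then show "smooth_fun M W (\<lambda>q. f q * X q h)"
    by (rule smooth_fun_mult[OF _ vector_field_smooth[OF X h]])
qed

lemma vector_field_scaleR: "vector_field M X \<Longrightarrow> vector_field M (\<lambda>q. a *\<^sub>R X q)"
  by (rule vector_field_mult[OF smooth_fun_const[OF open_points]])

lemma vector_field_diff:
  assumes "vector_field M X" "vector_field M Y"
  shows "vector_field M (\<lambda>q. X q - Y q)"
  using vector_field_add[OF assms(1) vector_field_scaleR[OF assms(2), of "- 1"]] by simp

lemma vector_field_sum:
  assumes "\<And>i. i \<in> I \<Longrightarrow> vector_field M (X i)"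
  shows "vector_field M (\<lambda>q. \<Sum>i\<in>I. X i q)"
  using assms
proof (induction I rule: infinite_finite_induct)
  case (insert i I)
  then have "vector_field M (\<lambda>q. X i q + (\<Sum>i\<in>I. X i q))"
    by (intro vector_field_add) auto
  then show ?case by (simp only: sum.insert[OF insert(1,2)])
qed (auto simp: vector_field_def intro: smooth_fun_const smooth_fun_open)

section \<open>Lie brackets\<close>

lemma lie_bracket_skew: "lie_bracket M X Y p = - lie_bracket M Y X p"
  by (auto simp: lie_bracket_def fun_eq_iff)

text \<open>The cross terms in X(Y(fg)) are symmetric in \<open>X\<close> and \<open>Y\<close> and
  drop out of the commutator.\<close>

lemma lie_bracket_tangent:
  assumes X: "vector_field M X" and Y: "vector_field M Y" and p: "p \<in> points M"
  shows "lie_bracket M X Y p \<in> tangent_space M p"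
proof -
  have add: "X p (\<lambda>q. Y q (\<lambda>x. f x + g x)) = X p (\<lambda>q. Y q f) + X p (\<lambda>q. Y q g)"
    and mult: "X p (\<lambda>q. Y q (\<lambda>x. f x * g x)) =
      X p (\<lambda>q. Y q f) * g p + Y p f * X p g + (X p f * Y p g + f p * X p (\<lambda>q. Y q g))"
    if X: "vector_field M X" and Y: "vector_field M Y"
      and f: "smooth_near M p f" and g: "smooth_near M p g" for X Y f g
  proof -
    obtain W where W: "p \<in> W" "smooth_fun M W f" "smooth_fun M W g"
      using smooth_near_common[OF f g] .
    have oW: "openin (top_space M) W" by (rule smooth_fun_open[OF W(2)])
    have near: "q \<in> points M" "smooth_near M q f" "smooth_near M q g" if "q \<in> W" for q
      using that W smooth_near_point by (auto intro: smooth_nearI)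
    note Xp = vector_field_tangent[OF X p]
    note Yf = vector_field_smooth_near[OF Y f] and Yg = vector_field_smooth_near[OF Y g]
    \<comment> \<open>The rules for \<open>Y q\<close> are available only at points \<open>q\<close>
      near which \<open>f\<close> and \<open>g\<close> are smooth, so the equality under
      \<open>X p\<close> is one of germs.\<close>
    have "X p (\<lambda>q. Y q (\<lambda>x. f x + g x)) = X p (\<lambda>q. Y q f + Y q g)"
      by (rule tangent_cong[OF Xp oW W(1)])
        (use near in \<open>simp add: tangent_add[OF vector_field_tangent[OF Y]]\<close>)
    then show "X p (\<lambda>q. Y q (\<lambda>x. f x + g x)) = X p (\<lambda>q. Y q f) + X p (\<lambda>q. Y q g)"
      by (simp add: tangent_add[OF Xp Yf Yg])
    have "X p (\<lambda>q. Y q (\<lambda>x. f x * g x)) = X p (\<lambda>q. Y q f * g q + f q * Y q g)"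
      by (rule tangent_cong[OF Xp oW W(1)])
        (use near in \<open>simp add: tangent_mult[OF vector_field_tangent[OF Y]]\<close>)
    then show "X p (\<lambda>q. Y q (\<lambda>x. f x * g x)) =
      X p (\<lambda>q. Y q f) * g p + Y p f * X p g + (X p f * Y p g + f p * X p (\<lambda>q. Y q g))"
      by (simp add: tangent_add[OF Xp] tangent_mult[OF Xp] f g Yf Yg smooth_near_mult)
  qed
  \<comment> \<open>Scaling is the product rule with a constant factor, all of whose derivatives
    vanish.\<close>
  have scale: "X p (\<lambda>q. Y q (\<lambda>x. a * f x)) = a * X p (\<lambda>q. Y q f)"
    if X: "vector_field M X" and Y: "vector_field M Y" and f: "smooth_near M p f" for X Y a f
    using mult[OF X Y smooth_near_const[OF p] f, of a]
  proof -
    have "X p (\<lambda>q. Y q (\<lambda>x. a)) = X p (\<lambda>q. 0)"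
      by (rule tangent_cong[OF vector_field_tangent[OF X p] open_points p])
        (simp add: tangent_const[OF vector_field_tangent[OF Y]])
    then show ?thesis
      using mult[OF X Y smooth_near_const[OF p] f, of a]
      by (simp add: tangent_const[OF vector_field_tangent] X Y p)
  qed
  show ?thesis
    unfolding tangent_space_def
    using add[OF X Y] add[OF Y X] mult[OF X Y] mult[OF Y X] scale[OF X Y] scale[OF Y X]
    by (auto simp: lie_bracket_def smooth_near_add smooth_near_mult smooth_near_cmult algebra_simps)
qed

text \<open>Fields are functions on the whole type, while identities between them hold on
  \<open>points M\<close> only; derivations at points of the manifold do not see the
  difference.\<close>

lemma lie_bracket_cong:
  assumes X: "vector_field M X" "vector_field M X'" and Y: "vector_field M Y" "vector_field M Y'"
    and p: "p \<in> points M"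
    and eq: "\<And>q. q \<in> points M \<Longrightarrow> X q = X' q" "\<And>q. q \<in> points M \<Longrightarrow> Y q = Y' q"
  shows "lie_bracket M X Y p = lie_bracket M X' Y' p"
proof -
  have "X p (\<lambda>q. Y q f) = X p (\<lambda>q. Y' q f)" for f
    by (rule tangent_cong[OF vector_field_tangent[OF X(1) p] open_points p]) (simp add: eq(2))
  moreover have "Y p (\<lambda>q. X q f) = Y p (\<lambda>q. X' q f)" for f
    by (rule tangent_cong[OF vector_field_tangent[OF Y(1) p] open_points p]) (simp add: eq(1))
  ultimately show ?thesis by (simp add: lie_bracket_def fun_eq_iff eq p)
qed

lemma lie_bracket_add_left:
  assumes X: "vector_field M X" "vector_field M X'" and Y: "vector_field M Y" and p: "p \<in> points M"
  shows "lie_bracket M (\<lambda>q. X q + X' q) Y p = lie_bracket M X Y p + lie_bracket M X' Y p"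
  using tangent_add[OF vector_field_tangent[OF Y p] vector_field_smooth_near[OF X(1)]
      vector_field_smooth_near[OF X(2)]]
  by (auto simp: lie_bracket_def fun_eq_iff)

text \<open>The extra term is the Leibniz rule for \<open>Y p\<close>. On functions not smooth near
  \<open>p\<close> both sides vanish, the bracket by its convention and \<open>X p\<close> by that
  of \<open>tangent_space\<close>.\<close>

lemma lie_bracket_mult_left:
  assumes f: "smooth_fun M (points M) f" and X: "vector_field M X" and Y: "vector_field M Y"
    and p: "p \<in> points M"
  shows "lie_bracket M (\<lambda>q. f q *\<^sub>R X q) Y p = f p *\<^sub>R lie_bracket M X Y p - Y p f *\<^sub>R X p"
  using tangent_mult[OF vector_field_tangent[OF Y p] smooth_nearI[OF f p] vector_field_smooth_near[OF X]]
    tangent_not_smooth[OF vector_field_tangent[OF X p]]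
  by (auto simp: lie_bracket_def fun_eq_iff scaleR_fun_def algebra_simps)

lemma lie_bracket_scaleR_left:
  assumes X: "vector_field M X" and Y: "vector_field M Y" and p: "p \<in> points M"
  shows "lie_bracket M (\<lambda>q. a *\<^sub>R X q) Y p = a *\<^sub>R lie_bracket M X Y p"
  using lie_bracket_mult_left[OF smooth_fun_const[OF open_points] X Y p, of a]
    tangent_const[OF vector_field_tangent[OF Y p] p] by simp

lemma lie_bracket_sum_left:
  assumes X: "\<And>i. i \<in> I \<Longrightarrow> vector_field M (X i)" and Y: "vector_field M Y" and p: "p \<in> points M"
  shows "lie_bracket M (\<lambda>q. \<Sum>i\<in>I. X i q) Y p = (\<Sum>i\<in>I. lie_bracket M (X i) Y p)"
  using X
proof (induction I rule: infinite_finite_induct)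
  case (insert i I)
  then have X: "vector_field M (X i)" "\<And>j. j \<in> I \<Longrightarrow> vector_field M (X j)" by auto
  have vS: "vector_field M (\<lambda>q. \<Sum>i\<in>I. X i q)" by (rule vector_field_sum) (rule X(2))
  have IH: "lie_bracket M (\<lambda>q. \<Sum>i\<in>I. X i q) Y p = (\<Sum>i\<in>I. lie_bracket M (X i) Y p)"
    by (rule insert(3)) (rule X(2))
  have "lie_bracket M (\<lambda>q. X i q + (\<Sum>i\<in>I. X i q)) Y p
      = lie_bracket M (X i) Y p + (\<Sum>i\<in>I. lie_bracket M (X i) Y p)"
    unfolding lie_bracket_add_left[OF X(1) vS Y p] IH ..
  then show ?case by (simp only: sum.insert[OF insert(1,2)])
qed (auto simp: lie_bracket_def fun_eq_iff tangent_const[OF vector_field_tangent[OF Y p] p])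

lemma lie_bracket_diff_left:
  assumes X: "vector_field M X" "vector_field M X'" and Y: "vector_field M Y" and p: "p \<in> points M"
  shows "lie_bracket M (\<lambda>q. X q - X' q) Y p = lie_bracket M X Y p - lie_bracket M X' Y p"
  using lie_bracket_add_left[OF X(1) vector_field_scaleR[OF X(2), of "- 1"] Y p]
    lie_bracket_scaleR_left[OF X(2) Y p, of "- 1"] by simp

end

section \<open>Multilinear and alternating forms on a subspace\<close>

text \<open>The two clauses are copied from \<open>diff_form\<close> at a point, so that
  \<open>diff_form_iff\<close> is a regrouping of quantifiers.\<close>

definition multilinear_on :: "'v::real_vector set \<Rightarrow> nat \<Rightarrow> ((nat \<Rightarrow> 'v) \<Rightarrow> real) \<Rightarrow> bool" where
  "multilinear_on V k w \<longleftrightarrow>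
     (\<forall>v. (\<forall>i. v i \<in> V) \<longrightarrow>
        (\<forall>u. (\<forall>i. u i \<in> V) \<longrightarrow> (\<forall>i<k. v i = u i) \<longrightarrow> w v = w u) \<and>
        (\<forall>i<k. \<forall>x\<in>V. \<forall>y\<in>V. \<forall>a b.
           w (v(i := a *\<^sub>R x + b *\<^sub>R y)) = a * w (v(i := x)) + b * w (v(i := y))))"

definition alternating_on :: "'v::real_vector set \<Rightarrow> nat \<Rightarrow> ((nat \<Rightarrow> 'v) \<Rightarrow> real) \<Rightarrow> bool" where
  "alternating_on V k w \<longleftrightarrow> multilinear_on V k w \<and>
     (\<forall>v. (\<forall>i. v i \<in> V) \<longrightarrow> (\<forall>i<k. \<forall>j<k. i \<noteq> j \<longrightarrow> v i = v j \<longrightarrow> w v = 0))"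

lemma multilinear_on_cong:
  "multilinear_on V k w \<Longrightarrow> (\<And>i. v i \<in> V) \<Longrightarrow> (\<And>i. u i \<in> V) \<Longrightarrow> (\<And>i. i < k \<Longrightarrow> v i = u i) \<Longrightarrow> w v = w u"
  unfolding multilinear_on_def by blast

lemma multilinear_on_slot:
  "multilinear_on V k w \<Longrightarrow> (\<And>i. v i \<in> V) \<Longrightarrow> i < k \<Longrightarrow> x \<in> V \<Longrightarrow> y \<in> V \<Longrightarrow>
    w (v(i := a *\<^sub>R x + b *\<^sub>R y)) = a * w (v(i := x)) + b * w (v(i := y))"
  unfolding multilinear_on_def by blast

lemma multilinear_on_sum:
  assumes w: "multilinear_on V k w" and V: "subspace V" and v: "\<And>i. v i \<in> V" and i: "i < k"
    and x: "\<And>j. j \<in> J \<Longrightarrow> x j \<in> V"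
  shows "w (v(i := \<Sum>j\<in>J. a j *\<^sub>R x j)) = (\<Sum>j\<in>J. a j * w (v(i := x j)))"
proof -
  have zero: "w (v(i := 0)) = 0"
    using multilinear_on_slot[where v = v and a = 0 and b = 0, OF w v i subspace_0[OF V] subspace_0[OF V]]
    by simp
  show ?thesis using x
  proof (induction J rule: infinite_finite_induct)
    case (insert j J)
    have 1: "(\<Sum>j\<in>J. a j *\<^sub>R x j) \<in> V"
      using insert.prems by (intro subspace_sum[OF V] subspace_scale[OF V]) auto
    have "w (v(i := a j *\<^sub>R x j + 1 *\<^sub>R (\<Sum>j\<in>J. a j *\<^sub>R x j)))
        = a j * w (v(i := x j)) + 1 * w (v(i := \<Sum>j\<in>J. a j *\<^sub>R x j))"
      by (rule multilinear_on_slot[OF w v i _ 1]) (use insert.prems in auto)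
    also have "w (v(i := \<Sum>j\<in>J. a j *\<^sub>R x j)) = (\<Sum>j\<in>J. a j * w (v(i := x j)))"
      using insert by blast
    finally show ?case by (simp only: sum.insert[OF insert(1,2)] scaleR_one mult_1)
  qed (simp_all add: zero)
qed

lemma alternating_on_diff:
  assumes w: "alternating_on V n w" and u: "alternating_on V n u"
  shows "alternating_on V n (\<lambda>v. w v - u v)"
proof -
  note m = w[unfolded alternating_on_def, THEN conjunct1] u[unfolded alternating_on_def, THEN conjunct1]
  have "multilinear_on V n (\<lambda>v. w v - u v)"
    unfolding multilinear_on_def
  proof (intro allI impI conjI ballI)
    fix v v' assume V: "\<forall>i. v i \<in> V" "\<forall>i. v' i \<in> V" "\<forall>i<n. v i = v' i"
    have "w v = w v'" "u v = u v'"
      using V by (auto intro: multilinear_on_cong[OF m(1)] multilinear_on_cong[OF m(2)])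
    then show "w v - u v = w v' - u v'" by simp
  next
    fix v :: "nat \<Rightarrow> 'a" and i x y and a b :: real
    assume "\<forall>i. v i \<in> V" "i < n" "x \<in> V" "y \<in> V"
    then show "w (v(i := a *\<^sub>R x + b *\<^sub>R y)) - u (v(i := a *\<^sub>R x + b *\<^sub>R y))
      = a * (w (v(i := x)) - u (v(i := x))) + b * (w (v(i := y)) - u (v(i := y)))"
      by (simp add: multilinear_on_slot[OF m(1)] multilinear_on_slot[OF m(2)] right_diff_distrib)
  qed
  moreover have "w v - u v = 0"
    if "\<forall>i. v i \<in> V" "i < n" "j < n" "i \<noteq> j" "v i = v j" for v i j
  proof -
    have "w v = 0" "u v = 0" using w u that unfolding alternating_on_def by blast+
    then show ?thesis by simp
  qed
  ultimately show ?thesis unfolding alternating_on_def by blast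
qed

text \<open>Polarisation: the form vanishes with the sum of the two vectors in both slots, and
  expanding that leaves the two mixed terms.\<close>

lemma alternating_on_transpose:
  assumes w: "alternating_on V k w" and V: "subspace V" and v: "\<And>i. v i \<in> V"
    and ab: "a < k" "b < k" "a \<noteq> b"
  shows "w (\<lambda>i. v (Transposition.transpose a b i)) = - w v"
proof -
  let ?F = "\<lambda>x y. w (v(a := x, b := y))"
  have m: "multilinear_on V k w" using w by (simp add: alternating_on_def)
  have F0: "?F x x = 0" if "x \<in> V" for x
    using w v ab that unfolding alternating_on_def
    by (elim conjE allE[of _ "v(a := x, b := x)"]) auto
  have F1: "?F (x + x') y = ?F x y + ?F x' y" if "x \<in> V" "x' \<in> V" "y \<in> V" for x x' y
    using multilinear_on_slot[OF m, of "v(b := y)" a x x' 1 1] v ab that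
    by (simp add: fun_upd_twist)
  have F2: "?F x (y + y') = ?F x y + ?F x y'" if "x \<in> V" "y \<in> V" "y' \<in> V" for x y y'
    using multilinear_on_slot[OF m, of "v(a := x)" b y y' 1 1] v ab that by simp
  have "?F (v a + v b) (v a + v b) = 0" by (rule F0) (simp add: v subspace_add[OF V])
  then have "?F (v b) (v a) = - ?F (v a) (v b)"
    unfolding F1[OF v v subspace_add[OF V v v]] F2[OF v v v] F0[OF v] by linarith
  moreover have "v(a := v b, b := v a) = (\<lambda>i. v (Transposition.transpose a b i))"
    by (auto simp: fun_eq_iff Transposition.transpose_def)
  moreover have "v(a := v a, b := v b) = v" by auto
  ultimately show ?thesis by metis
qed

lemma alternating_on_permute:
  assumes w: "alternating_on V k w" and V: "subspace V" and p: "p permutes {..<k}"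
  shows "(\<And>i. v i \<in> V) \<Longrightarrow> w (\<lambda>i. v (p i)) = of_int (sign p) * w v"
  using finite_lessThan[of k] p
proof (induction arbitrary: v rule: permutes_rev_induct)
  case id
  then show ?case by (simp add: sign_id)
next
  case (swap a b p)
  have "w (\<lambda>i. v ((p \<circ> Transposition.transpose a b) i))
      = w (\<lambda>i. (\<lambda>i. v (p i)) (Transposition.transpose a b i))" by simp
  also have "\<dots> = - w (\<lambda>i. v (p i))"
    by (rule alternating_on_transpose[OF w V]) (use swap in auto)
  also have "\<dots> = - (of_int (sign p) * w v)" using swap.IH[OF swap.prems] by simp
  also have "\<dots> = of_int (sign (p \<circ> Transposition.transpose a b)) * w v"
    using swap.hyps(3) permutes_imp_permutation[OF finite_lessThan swap.hyps(4)]
    by (simp add: sign_compose sign_swap_id permutation_swap_id)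
  finally show ?case .
qed

text \<open>\<open>permutes\<close> demands fixed points outside the set; continuing by the identity
  is harmless because an \<open>n\<close>-form ignores slots from \<open>n\<close> on.\<close>

lemma permutes_of_inj_on:
  fixes s :: "nat \<Rightarrow> nat"
  assumes "inj_on s {..<n}" "\<And>i. i < n \<Longrightarrow> s i < n"
  shows "(\<lambda>i. if i < n then s i else i) permutes {..<n}" (is "?p permutes _")
proof (rule bij_imp_permutes)
  have inj: "inj_on ?p {..<n}" using assms(1) by (auto simp: inj_on_def)
  moreover have "?p ` {..<n} = {..<n}"
    by (rule endo_inj_surj[OF finite_lessThan _ inj]) (use assms(2) in auto)
  ultimately show "bij_betw ?p {..<n} {..<n}" by (simp add: bij_betw_def)
qed simp

section \<open>Orthonormal bases\<close>

text \<open>Tangent spaces are subsets of a function type and \<open>g\<close> varies with the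
  point, so no type class supplies the inner product; orthonormalisation is carried out on a carrier
  set. The parameter \<open>n\<close> is the dimension.\<close>

locale inner_product_subspace =
  fixes V :: "'v::real_vector set" and n :: nat and g :: "'v \<Rightarrow> 'v \<Rightarrow> real"
  assumes V: "subspace V"
    and basis: "\<exists>B. finite B \<and> card B = n \<and> independent B \<and> span B = V"
    and g_linear: "u \<in> V \<Longrightarrow> v \<in> V \<Longrightarrow> w \<in> V \<Longrightarrow> g (a *\<^sub>R u + b *\<^sub>R v) w = a * g u w + b * g v w"
    and g_sym: "u \<in> V \<Longrightarrow> v \<in> V \<Longrightarrow> g u v = g v u"
    and g_pos: "u \<in> V \<Longrightarrow> u \<noteq> 0 \<Longrightarrow> g u u > 0"
begin

lemma V_simps [simp]:
  "0 \<in> V" "u \<in> V \<Longrightarrow> v \<in> V \<Longrightarrow> u + v \<in> V" "u \<in> V \<Longrightarrow> v \<in> V \<Longrightarrow> u - v \<in> V"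
  "u \<in> V \<Longrightarrow> a *\<^sub>R u \<in> V" "u \<in> V \<Longrightarrow> - u \<in> V"
  using V by (auto intro: subspace_0 subspace_add subspace_diff subspace_scale subspace_neg)

lemma g_zero_left [simp]: "w \<in> V \<Longrightarrow> g 0 w = 0"
  using g_linear[of 0 0 w 0 0] by simp

lemma g_add_left: "u \<in> V \<Longrightarrow> v \<in> V \<Longrightarrow> w \<in> V \<Longrightarrow> g (u + v) w = g u w + g v w"
  using g_linear[of u v w 1 1] by simp

lemma g_scale_left: "u \<in> V \<Longrightarrow> w \<in> V \<Longrightarrow> g (a *\<^sub>R u) w = a * g u w"
  using g_linear[of u 0 w a 0] by simp

lemma g_minus_left: "u \<in> V \<Longrightarrow> w \<in> V \<Longrightarrow> g (- u) w = - g u w"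
  using g_scale_left[of u w "- 1"] by simp

lemma g_diff_left: "u \<in> V \<Longrightarrow> v \<in> V \<Longrightarrow> w \<in> V \<Longrightarrow> g (u - v) w = g u w - g v w"
  using g_linear[of u v w 1 "- 1"] by simp

lemma g_add_right: "u \<in> V \<Longrightarrow> v \<in> V \<Longrightarrow> w \<in> V \<Longrightarrow> g w (u + v) = g w u + g w v"
  by (simp add: g_sym[of w] g_add_left)

lemma g_scale_right: "u \<in> V \<Longrightarrow> w \<in> V \<Longrightarrow> g w (a *\<^sub>R u) = a * g w u"
  by (simp add: g_sym[of w] g_scale_left)

lemma g_minus_right: "u \<in> V \<Longrightarrow> w \<in> V \<Longrightarrow> g w (- u) = - g w u"
  by (simp add: g_sym[of w] g_minus_left)

lemma g_diff_right: "u \<in> V \<Longrightarrow> v \<in> V \<Longrightarrow> w \<in> V \<Longrightarrow> g w (u - v) = g w u - g w v"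
  by (simp add: g_sym[of w] g_diff_left)

lemma V_sum: "(\<And>i. i \<in> I \<Longrightarrow> x i \<in> V) \<Longrightarrow> (\<Sum>i\<in>I. x i) \<in> V"
  by (rule subspace_sum[OF V])

lemma g_sum_left:
  "(\<And>i. i \<in> I \<Longrightarrow> x i \<in> V) \<Longrightarrow> w \<in> V \<Longrightarrow> g (\<Sum>i\<in>I. a i *\<^sub>R x i) w = (\<Sum>i\<in>I. a i * g (x i) w)"
proof (induction I rule: infinite_finite_induct)
  case (insert i I)
  then have "(\<Sum>i\<in>I. a i *\<^sub>R x i) \<in> V" by (intro V_sum) auto
  with insert show ?case by (simp add: g_add_left g_scale_left)
qed simp_all

definition orthonormal :: "nat \<Rightarrow> (nat \<Rightarrow> 'v) \<Rightarrow> bool" where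
  "orthonormal k f \<longleftrightarrow> (\<forall>i<k. f i \<in> V) \<and> (\<forall>i<k. \<forall>j<k. g (f i) (f j) = (if i = j then 1 else 0))"

lemma orthonormal_card_le:
  assumes f: "orthonormal k f"
  shows "k \<le> n"
proof -
  obtain B where B: "finite B" "card B = n" "span B = V" using basis by blast
  have inj: "inj_on f {..<k}"
  proof (rule inj_onI)
    fix i j assume ij: "i \<in> {..<k}" "j \<in> {..<k}" "f i = f j"
    have "g (f i) (f i) = 1" using f ij by (simp add: orthonormal_def)
    with ij(3) have "g (f i) (f j) = 1" by simp
    with f ij(1,2) show "i = j" by (auto simp: orthonormal_def split: if_splits)
  qed
  have scalars: "u x = 0" if 0: "(\<Sum>x\<in>f ` {..<k}. u x *\<^sub>R x) = 0" and x: "x \<in> f ` {..<k}" for u x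
  proof -
    obtain j where j: "j < k" "x = f j" using x by blast
    have "(\<Sum>i<k. u (f i) *\<^sub>R f i) = 0" using 0 inj by (simp add: sum.reindex)
    then have "g (\<Sum>i<k. u (f i) *\<^sub>R f i) (f j) = 0" using f j(1) by (simp add: orthonormal_def)
    then have "(\<Sum>i<k. u (f i) * g (f i) (f j)) = 0"
      using f j(1) by (subst (asm) g_sum_left) (auto simp: orthonormal_def)
    moreover have "(\<Sum>i<k. u (f i) * g (f i) (f j)) = (\<Sum>i<k. if i = j then u (f i) else 0)"
      using f j(1) by (intro sum.cong) (auto simp: orthonormal_def)
    ultimately have "(\<Sum>i<k. if i = j then u (f i) else 0) = 0" by simp
    then show ?thesis unfolding j(2) using j(1) by (simp add: sum.delta)
  qed
  have "independent (f ` {..<k})"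
    by (rule independent_if_scalars_zero[OF finite_imageI[OF finite_lessThan]]) (use scalars in blast)
  moreover have "f ` {..<k} \<subseteq> span B" using f B(3) by (auto simp: orthonormal_def)
  ultimately have "card (f ` {..<k}) \<le> card B"
    using independent_span_bound[OF B(1)] by blast
  then show ?thesis by (simp add: card_image[OF inj] B(2))
qed

lemma orthonormal_residue:
  assumes f: "orthonormal k f" and v: "v \<in> V"
  defines "r \<equiv> v - (\<Sum>i<k. g v (f i) *\<^sub>R f i)"
  shows "r \<in> V" "j < k \<Longrightarrow> g r (f j) = 0"
proof -
  have S: "(\<Sum>i<k. g v (f i) *\<^sub>R f i) \<in> V" using f by (intro V_sum) (auto simp: orthonormal_def)
  then show "r \<in> V" using v by (simp add: r_def)
  assume j: "j < k"
  have "g r (f j) = g v (f j) - (\<Sum>i<k. g v (f i) * g (f i) (f j))"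
    unfolding r_def using f v S j
    by (subst g_diff_left, simp_all add: orthonormal_def, subst g_sum_left) auto
  also have "(\<Sum>i<k. g v (f i) * g (f i) (f j)) = (\<Sum>i<k. if i = j then g v (f i) else 0)"
    using f j by (intro sum.cong) (auto simp: orthonormal_def)
  finally show "g r (f j) = 0" using j by simp
qed

lemma exists_unit_orthogonal:
  assumes f: "orthonormal k f" and v: "v \<in> V" "v \<noteq> (\<Sum>i<k. g v (f i) *\<^sub>R f i)"
  obtains u where "u \<in> V" "g u u = 1" "\<And>i. i < k \<Longrightarrow> g u (f i) = 0"
proof -
  let ?r = "v - (\<Sum>i<k. g v (f i) *\<^sub>R f i)"
  note r = orthonormal_residue[OF f v(1)]
  have pos: "g ?r ?r > 0" using g_pos[OF r(1)] v(2) by simp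
  let ?u = "(1 / sqrt (g ?r ?r)) *\<^sub>R ?r"
  have "g ?u ?u = (1 / sqrt (g ?r ?r)) * ((1 / sqrt (g ?r ?r)) * g ?r ?r)"
    using r(1) by (simp only: g_scale_left g_scale_right V_simps)
  also have "\<dots> = 1" using pos by (simp add: field_simps)
  finally have 1: "g ?u ?u = 1" .
  have 2: "g ?u (f i) = 0" if "i < k" for i
  proof -
    have "f i \<in> V" using f that by (simp add: orthonormal_def)
    then show ?thesis using r(2)[OF that] by (simp only: g_scale_left[OF r(1)] mult_zero_right)
  qed
  show ?thesis by (rule that[OF _ 1 2]) (use r(1) in \<open>simp only: V_simps\<close>)
qed

text \<open>If every vector were its own projection, \<open>k\<close> vectors would span a space of
  dimension \<open>n\<close>. Otherwise a normalised residue is the new vector.\<close>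

lemma orthonormal_extend:
  assumes f: "orthonormal k f" and "k < n"
  obtains u where "u \<in> V" "g u u = 1" "\<And>i. i < k \<Longrightarrow> g u (f i) = 0"
proof (cases "\<exists>v\<in>V. v \<noteq> (\<Sum>i<k. g v (f i) *\<^sub>R f i)")
  case True
  then show ?thesis using exists_unit_orthogonal[OF f] that by blast
next
  case False
  obtain B where B: "card B = n" "independent B" "span B = V" using basis by blast
  have "B \<subseteq> span (f ` {..<k})"
  proof
    fix v assume "v \<in> B"
    then have "v \<in> V" using B(3) span_base by blast
    with False have v: "(\<Sum>i<k. g v (f i) *\<^sub>R f i) = v" by force
    have "(\<Sum>i<k. g v (f i) *\<^sub>R f i) \<in> span (f ` {..<k})"
      by (intro span_sum span_scale span_base imageI)
    then show "v \<in> span (f ` {..<k})" by (simp only: v)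
  qed
  then have "card B \<le> card (f ` {..<k})"
    using independent_span_bound[OF finite_imageI[OF finite_lessThan] B(2)] by blast
  also have "\<dots> \<le> k" using card_image_le[of "{..<k}" f] by simp
  finally show ?thesis using B(1) assms(2) by simp
qed

text \<open>A nonzero residue could be normalised to an orthonormal family of \<open>n + 1\<close>
  vectors.\<close>

lemma orthonormal_expand:
  assumes f: "orthonormal n f" and v: "v \<in> V"
  shows "v = (\<Sum>i<n. g v (f i) *\<^sub>R f i)"
proof (rule ccontr)
  assume "v \<noteq> (\<Sum>i<n. g v (f i) *\<^sub>R f i)"
  then obtain u where u: "u \<in> V" "g u u = 1" "\<And>i. i < n \<Longrightarrow> g u (f i) = 0"
    using exists_unit_orthogonal[OF f v] by blast
  have fV: "f k \<in> V" if "k < n" for k using f that by (simp add: orthonormal_def)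
  have gf: "g (f k) u = 0" if "k < n" for k
    using u(3)[OF that] g_sym[OF fV[OF that] u(1)] by simp
  have "(f(n := u)) i \<in> V" if "i < Suc n" for i
    using that u(1) fV by (cases "i = n") simp_all
  moreover have "g ((f(n := u)) i) ((f(n := u)) j) = (if i = j then 1 else 0)"
    if "i < Suc n" "j < Suc n" for i j
  proof (cases "i = n"; cases "j = n")
    assume "i \<noteq> n" "j \<noteq> n"
    then show ?thesis using that f by (simp add: orthonormal_def)
  qed (use that u(2,3) gf in simp_all)
  ultimately have "orthonormal (Suc n) (f(n := u))" unfolding orthonormal_def by blast
  from orthonormal_card_le[OF this] show False by simp
qed

text \<open>Linearity of \<open>L\<close> is asked for in the form that
  \<open>multilinear_on_sum\<close> delivers for one slot of a multilinear form.\<close>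

lemma parseval:
  assumes e: "orthonormal n e" and f: "orthonormal n f"
    and L: "\<And>(a :: nat \<Rightarrow> real) x. (\<And>i. i < n \<Longrightarrow> x i \<in> V) \<Longrightarrow> L (\<Sum>i<n. a i *\<^sub>R x i) = (\<Sum>i<n. a i * L (x i))"
  shows "(\<Sum>i<n. (L (e i))\<^sup>2) = (\<Sum>i<n. (L (f i))\<^sup>2 :: real)"
proof -
  have eV: "e i \<in> V" and fV: "f i \<in> V" if "i < n" for i using e f that by (auto simp: orthonormal_def)
  have Le: "L (e i) = (\<Sum>j<n. g (e i) (f j) * L (f j))" if "i < n" for i
  proof -
    have "L (e i) = L (\<Sum>j<n. g (e i) (f j) *\<^sub>R f j)"
      using orthonormal_expand[OF f eV[OF that]] by simp
    then show ?thesis using L[of f] fV by simp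
  qed
  \<comment> \<open>The matrix of the base change is orthogonal.\<close>
  have orth: "(\<Sum>i<n. g (e i) (f j) * g (e i) (f k)) = (if j = k then 1 else 0)"
    if jk: "j < n" "k < n" for j k
  proof -
    have "g (f j) (f k) = g (\<Sum>i<n. g (f j) (e i) *\<^sub>R e i) (f k)"
      using orthonormal_expand[OF e fV[OF jk(1)]] by simp
    also have "\<dots> = (\<Sum>i<n. g (f j) (e i) * g (e i) (f k))"
      by (rule g_sum_left) (use eV fV jk in auto)
    also have "\<dots> = (\<Sum>i<n. g (e i) (f j) * g (e i) (f k))"
      using eV fV[OF jk(1)] by (intro sum.cong) (auto simp: g_sym[of "f j"])
    finally show ?thesis using f jk by (simp add: orthonormal_def)
  qed
  have "(\<Sum>i<n. (L (e i))\<^sup>2)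
      = (\<Sum>i<n. \<Sum>j<n. \<Sum>k<n. L (f j) * L (f k) * (g (e i) (f j) * g (e i) (f k)))"
    by (rule sum.cong) (auto simp: Le power2_eq_square sum_product intro!: sum.cong)
  also have "\<dots> = (\<Sum>j<n. \<Sum>k<n. \<Sum>i<n. L (f j) * L (f k) * (g (e i) (f j) * g (e i) (f k)))"
    by (subst sum.swap) (intro sum.cong refl sum.swap)
  also have "\<dots> = (\<Sum>j<n. \<Sum>k<n. if j = k then L (f j) * L (f k) else 0)"
    by (intro sum.cong refl) (simp add: sum_distrib_left[symmetric] orth)
  also have "\<dots> = (\<Sum>j<n. (L (f j))\<^sup>2)"
    by (simp add: power2_eq_square)
  finally show ?thesis .
qed

text \<open>Expanding every argument in the basis leaves values on tuples of basis vectors: these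
  vanish when an index repeats and are the value on \<open>e\<close> up to sign otherwise.\<close>

lemma alternating_on_eq_zero:
  assumes w: "alternating_on V n w" and e: "orthonormal n e" and eV: "\<And>i. e i \<in> V"
    and 0: "w e = 0" and v: "\<And>i. v i \<in> V"
  shows "w v = 0"
proof -
  have m: "multilinear_on V n w" using w by (simp add: alternating_on_def)
  have tuple: "w (\<lambda>i. e (s i)) = 0" if s: "\<And>i. s i < n" for s
  proof (cases "inj_on s {..<n}")
    case True
    define p where "p = (\<lambda>i. if i < n then s i else i)"
    have "p permutes {..<n}" unfolding p_def by (rule permutes_of_inj_on[OF True s])
    have "w (\<lambda>i. e (s i)) = w (\<lambda>i. e (p i))"
      by (rule multilinear_on_cong[OF m]) (auto simp: eV p_def)
    then show ?thesis using alternating_on_permute[OF w V \<open>p permutes _\<close>, of e] eV 0 by simp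
  next
    case False
    then obtain i j where "i < n" "j < n" "i \<noteq> j" "s i = s j" by (auto simp: inj_on_def)
    then show ?thesis
      using w eV unfolding alternating_on_def by (elim conjE allE[of _ "\<lambda>i. e (s i)"]) auto
  qed
  \<comment> \<open>The first \<open>k\<close> slots hold basis vectors. The induction descends from
    \<open>k = n\<close>, where all slots do, and frees one slot per step.\<close>
  have "w (\<lambda>i. if i < k then e (s i) else v i) = 0"
    if "k \<le> n" "\<And>i. s i < n" "\<And>i. v i \<in> V" for k s v
    using that
  proof (induction k arbitrary: s v rule: inc_induct)
    case base
    have "w (\<lambda>i. if i < n then e (s i) else v i) = w (\<lambda>i. e (s i))"
      by (rule multilinear_on_cong[OF m]) (use base eV in auto)
    then show ?case using tuple[of s] base by simp
  next
    case (step k)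
    let ?u = "\<lambda>i. if i < k then e (s i) else v i"
    have uV: "?u i \<in> V" for i using step.prems(2) eV by simp
    have upd: "?u(k := e j) = (\<lambda>i. if i < Suc k then e ((s(k := j)) i) else v i)" for j
      by (auto simp: fun_eq_iff)
    have "?u = ?u(k := \<Sum>j<n. g (v k) (e j) *\<^sub>R e j)"
      using orthonormal_expand[OF e step.prems(2)[of k]] by (auto simp: fun_eq_iff)
    then have "w ?u = w (?u(k := \<Sum>j<n. g (v k) (e j) *\<^sub>R e j))" by simp
    also have "\<dots> = (\<Sum>j<n. g (v k) (e j) * w (?u(k := e j)))"
      by (rule multilinear_on_sum[OF m V uV step.hyps(2)]) (rule eV)
    also have "\<dots> = 0"
      unfolding upd by (rule sum.neutral) (use step in auto)
    finally show ?case .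
  qed
  note slots = this
  \<comment> \<open>The index tuple used to start at \<open>k = 0\<close> has values below
    \<open>n\<close>, which requires \<open>n\<close> to be positive.\<close>
  show ?thesis
  proof (cases "n = 0")
    case True
    then have "w v = w e" by (intro multilinear_on_cong[OF m v eV]) simp
    with 0 show ?thesis by simp
  next
    case False
    then show ?thesis using slots[of 0 "\<lambda>i. 0" v] v by simp
  qed
qed

lemma sum_PiE_Suc:
  fixes F :: "(nat \<Rightarrow> nat) \<Rightarrow> real"
  shows "(\<Sum>s\<in>{..<Suc k} \<rightarrow>\<^sub>E A. F s) = (\<Sum>j\<in>A. \<Sum>s\<in>{..<k} \<rightarrow>\<^sub>E A. F (s(k := j)))"
proof -
  have "(\<Sum>s\<in>{..<Suc k} \<rightarrow>\<^sub>E A. F s) = (\<Sum>(j, s)\<in>A \<times> ({..<k} \<rightarrow>\<^sub>E A). F (s(k := j)))"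
    unfolding lessThan_Suc PiE_insert_eq
    by (subst sum.reindex[OF inj_combinator]) (auto simp: case_prod_beta intro!: sum.cong)
  then show ?thesis by (simp add: sum.cartesian_product)
qed

text \<open>The sum of the squares of \<open>w\<close> over all \<open>n\<close>-tuples of basis
  vectors does not depend on the basis, by Parseval in one slot after the other. For an alternating
  form that sum is a fixed positive multiple of one square.\<close>

lemma alternating_on_square_eq:
  assumes w: "alternating_on V n w" and e: "orthonormal n e" "\<And>i. e i \<in> V"
    and f: "orthonormal n f" "\<And>i. f i \<in> V"
  shows "(w e)\<^sup>2 = (w f)\<^sup>2"
proof -
  have m: "multilinear_on V n w" using w by (simp add: alternating_on_def)
  let ?u = "\<lambda>k e s v i. if i < k then e (s i) else v i"
  \<comment> \<open>The first \<open>k\<close> slots run through the basis \<open>e\<close>, the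
    others are frozen at \<open>v\<close>; bases are exchanged by induction on
    \<open>k\<close>.\<close>
  define S where "S = (\<lambda>k e v. \<Sum>s\<in>{..<k} \<rightarrow>\<^sub>E {..<n}. (w (?u k e s v))\<^sup>2)"
  have S_Suc: "S (Suc k) e v = (\<Sum>j<n. S k e (v(k := e j)))" for k e v
    unfolding S_def sum_PiE_Suc
  proof (intro sum.cong refl)
    fix j s assume "s \<in> {..<k} \<rightarrow>\<^sub>E {..<n}"
    have "?u (Suc k) e (s(k := j)) v = ?u k e s (v(k := e j))" by (auto simp: fun_eq_iff)
    then show "(w (?u (Suc k) e (s(k := j)) v))\<^sup>2 = (w (?u k e s (v(k := e j))))\<^sup>2" by simp
  qed
  have "S k e v = S k f v" if "k \<le> n" "\<And>i. v i \<in> V" for k v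
    using that
  proof (induction k arbitrary: v)
    case 0
    then show ?case by (simp add: S_def)
  next
    case (Suc k)
    have "S (Suc k) e v = (\<Sum>j<n. S k f (v(k := e j)))"
      unfolding S_Suc by (intro sum.cong refl Suc.IH) (use Suc.prems e in auto)
    also have "\<dots> = (\<Sum>s\<in>{..<k} \<rightarrow>\<^sub>E {..<n}. \<Sum>j<n. (w (?u k f s (v(k := e j))))\<^sup>2)"
      unfolding S_def by (rule sum.swap)
    also have "\<dots> = (\<Sum>s\<in>{..<k} \<rightarrow>\<^sub>E {..<n}. \<Sum>j<n. (w (?u k f s (v(k := f j))))\<^sup>2)"
    proof (rule sum.cong[OF refl])
      fix s assume s: "s \<in> {..<k} \<rightarrow>\<^sub>E {..<n}"
      have uV: "?u k f s v i \<in> V" for i using Suc.prems f by simp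
      have upd: "?u k f s (v(k := x)) = (?u k f s v)(k := x)" for x by (auto simp: fun_eq_iff)
      show "(\<Sum>j<n. (w (?u k f s (v(k := e j))))\<^sup>2) = (\<Sum>j<n. (w (?u k f s (v(k := f j))))\<^sup>2)"
        unfolding upd
        by (rule parseval[OF e(1) f(1)], rule multilinear_on_sum[OF m V uV]) (use Suc.prems in auto)
    qed
    also have "\<dots> = (\<Sum>j<n. S k f (v(k := f j)))"
      unfolding S_def by (rule sum.swap)
    finally show ?case unfolding S_Suc .
  qed
  from this[of n f] f have "S n e f = S n f f" by simp
  \<comment> \<open>Only injective tuples contribute, each with the same square. Their number
    matters only through being positive. The final \<open>f\<close> is a filler for slots beyond
    \<open>n\<close>.\<close>
  moreover have "S n e f = (\<Sum>s\<in>{..<n} \<rightarrow>\<^sub>E {..<n}. if inj_on s {..<n} then 1 else 0) * (w e)\<^sup>2"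
    if eV: "\<And>i. e i \<in> V" for e
    unfolding S_def sum_distrib_right
  proof (intro sum.cong refl)
    fix s assume s: "s \<in> {..<n} \<rightarrow>\<^sub>E {..<n}"
    define p where "p = (\<lambda>i. if i < n then s i else i)"
    have eq: "w (?u n e s f) = w (\<lambda>i. e (p i))"
      by (rule multilinear_on_cong[OF m]) (use eV f in \<open>auto simp: p_def\<close>)
    show "(w (?u n e s f))\<^sup>2 = (if inj_on s {..<n} then 1 else 0) * (w e)\<^sup>2"
    proof (cases "inj_on s {..<n}")
      case True
      have "p permutes {..<n}"
        unfolding p_def by (rule permutes_of_inj_on[OF True]) (use s in auto)
      from alternating_on_permute[OF w V this, of e] show ?thesis
        unfolding eq using True eV by (simp add: power_mult_distrib sign_def)
    next
      case False
      then obtain i j where "i < n" "j < n" "i \<noteq> j" "s i = s j" by (auto simp: inj_on_def)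
      then have "w (\<lambda>i. e (p i)) = 0"
        using w eV unfolding alternating_on_def
        by (elim conjE allE[of _ "\<lambda>i. e (p i)"]) (auto simp: p_def)
      with False show ?thesis unfolding eq by simp
    qed
  qed
  moreover have "(\<Sum>s\<in>{..<n} \<rightarrow>\<^sub>E {..<n}. if inj_on s {..<n} then 1 else 0) > (0::real)"
  proof (rule sum_pos2)
    show "(\<lambda>i\<in>{..<n}. i) \<in> {..<n} \<rightarrow>\<^sub>E {..<n}" by auto
  qed (auto simp: inj_on_def intro: finite_PiE)
  ultimately show ?thesis using e(2) f(2) by (metis mult_cancel_left order_less_irrefl)
qed

end

section \<open>Exterior products\<close>

text \<open>The antisymmetriser, for arbitrary functions of sequences over any type: it is later
  applied to sequences of indices as well as of vectors.\<close>

definition alternation :: "nat \<Rightarrow> ((nat \<Rightarrow> 'v) \<Rightarrow> real) \<Rightarrow> (nat \<Rightarrow> 'v) \<Rightarrow> real" where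
  "alternation n t v =
     (\<Sum>\<sigma> | \<sigma> permutes {..<n}. of_int (sign \<sigma>) * t (\<lambda>i. v (\<sigma> i))) / fact n"

lemma wedge_eq_alternation:
  "wedge k l \<alpha> \<beta> = alternation (k + l) (\<lambda>u. \<alpha> u * \<beta> (\<lambda>i. u (k + i)))"
  by (simp add: fun_eq_iff wedge_def alternation_def mult.assoc)

text \<open>If two arguments agree, composing permutations on the left with their transposition
  reverses the sign of every summand but permutes the summands, so the sum is its own
  negative.\<close>

lemma alternation_alternating:
  assumes t: "multilinear_on V n t"
  shows "alternating_on V n (alternation n t)"
  unfolding alternating_on_def
proof (intro conjI allI impI)
  show "multilinear_on V n (alternation n t)"
    unfolding multilinear_on_def
  proof (intro allI impI conjI ballI)
    fix v u :: "nat \<Rightarrow> 'a"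
    assume v: "\<forall>i. v i \<in> V" and u: "\<forall>i. u i \<in> V" and eq: "\<forall>i<n. v i = u i"
    have "t (\<lambda>i. v (\<sigma> i)) = t (\<lambda>i. u (\<sigma> i))" if "\<sigma> permutes {..<n}" for \<sigma>
    proof (rule multilinear_on_cong[OF t])
      fix i assume "i < n"
      then have "\<sigma> i < n" using permutes_in_image[OF that, of i] by simp
      with eq show "v (\<sigma> i) = u (\<sigma> i)" by simp
    qed (use v u in auto)
    then show "alternation n t v = alternation n t u" by (simp add: alternation_def)
  next
    fix v :: "nat \<Rightarrow> 'a" and i x y a b
    assume v: "\<forall>i. v i \<in> V" and i: "i < n" and xy: "x \<in> V" "y \<in> V"
    have "t (\<lambda>j. (v(i := a *\<^sub>R x + b *\<^sub>R y)) (\<sigma> j))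
        = a * t (\<lambda>j. (v(i := x)) (\<sigma> j)) + b * t (\<lambda>j. (v(i := y)) (\<sigma> j))"
      if s: "\<sigma> permutes {..<n}" for \<sigma>
    proof -
      \<comment> \<open>Changing argument \<open>i\<close> changes slot
        \<open>inv \<sigma> i\<close> of the permuted sequence.\<close>
      have upd: "(\<lambda>j. (v(i := z)) (\<sigma> j)) = (\<lambda>j. v (\<sigma> j))(inv \<sigma> i := z)" for z
        using permutes_inverses[OF s] by (auto simp: fun_eq_iff)
      have "inv \<sigma> i < n" using permutes_in_image[OF permutes_inv[OF s], of i] i by simp
      then show ?thesis
        unfolding upd using v xy by (intro multilinear_on_slot[OF t]) auto
    qed
    then have "(\<Sum>\<sigma> | \<sigma> permutes {..<n}. of_int (sign \<sigma>) * t (\<lambda>j. (v(i := a *\<^sub>R x + b *\<^sub>R y)) (\<sigma> j)))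
      = (\<Sum>\<sigma> | \<sigma> permutes {..<n}. a * (of_int (sign \<sigma>) * t (\<lambda>j. (v(i := x)) (\<sigma> j)))
          + b * (of_int (sign \<sigma>) * t (\<lambda>j. (v(i := y)) (\<sigma> j))))"
      by (intro sum.cong refl) (simp add: algebra_simps)
    then show "alternation n t (v(i := a *\<^sub>R x + b *\<^sub>R y))
        = a * alternation n t (v(i := x)) + b * alternation n t (v(i := y))"
      unfolding alternation_def by (simp only: sum.distrib sum_distrib_left[symmetric]) (simp add: add_divide_distrib)
  qed
next
  fix v :: "nat \<Rightarrow> 'a" and i j
  assume v: "\<forall>i. v i \<in> V" and ij: "i < n" "j < n" "i \<noteq> j" "v i = v j"
  let ?t = "Transposition.transpose i j" and ?f = "\<lambda>\<sigma>. of_int (sign \<sigma>) * t (\<lambda>k. v (\<sigma> k))"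
  have perm: "?t permutes {..<n}" using ij by (intro permutes_swap_id) auto
  have vt: "v (?t k) = v k" for k using ij(4) by (auto simp: Transposition.transpose_def)
  have "?f (?t \<circ> \<sigma>) = - ?f \<sigma>" if "\<sigma> permutes {..<n}" for \<sigma>
    using permutes_imp_permutation[OF finite_lessThan that] ij(3)
    by (simp add: sign_compose permutation_swap_id sign_swap_id vt)
  then have "(\<Sum>\<sigma> | \<sigma> permutes {..<n}. ?f (?t \<circ> \<sigma>)) = (\<Sum>\<sigma> | \<sigma> permutes {..<n}. - ?f \<sigma>)"
    by (intro sum.cong refl) blast
  then have "sum ?f {\<sigma>. \<sigma> permutes {..<n}} = - sum ?f {\<sigma>. \<sigma> permutes {..<n}}"
    unfolding sum_negf by (rule trans[OF setum_permutations_compose_left[OF perm]])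
  then show "alternation n t v = 0" by (simp add: alternation_def)
qed

lemma multilinear_on_tensor:
  assumes V: "subspace V" and a: "multilinear_on V k \<alpha>" and b: "multilinear_on V l \<beta>"
  shows "multilinear_on V (k + l) (\<lambda>u. \<alpha> u * \<beta> (\<lambda>i. u (k + i)))"
  unfolding multilinear_on_def
proof (intro allI impI conjI ballI)
  fix v u :: "nat \<Rightarrow> 'a"
  assume v: "\<forall>i. v i \<in> V" and u: "\<forall>i. u i \<in> V" and eq: "\<forall>i<k + l. v i = u i"
  have "\<alpha> v = \<alpha> u" by (rule multilinear_on_cong[OF a]) (use u v eq in auto)
  moreover have "\<beta> (\<lambda>i. v (k + i)) = \<beta> (\<lambda>i. u (k + i))"
    by (rule multilinear_on_cong[OF b]) (use u v eq in auto)
  ultimately show "\<alpha> v * \<beta> (\<lambda>i. v (k + i)) = \<alpha> u * \<beta> (\<lambda>i. u (k + i))" by simp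
next
  fix v :: "nat \<Rightarrow> 'a" and i x y r s
  assume v: "\<forall>i. v i \<in> V" and i: "i < k + l" and xy: "x \<in> V" "y \<in> V"
  show "\<alpha> (v(i := r *\<^sub>R x + s *\<^sub>R y)) * \<beta> (\<lambda>j. (v(i := r *\<^sub>R x + s *\<^sub>R y)) (k + j))
    = r * (\<alpha> (v(i := x)) * \<beta> (\<lambda>j. (v(i := x)) (k + j)))
      + s * (\<alpha> (v(i := y)) * \<beta> (\<lambda>j. (v(i := y)) (k + j)))"
  proof (cases "i < k")
    case True
    then have "(\<lambda>j. (v(i := z)) (k + j)) = (\<lambda>j. v (k + j))" for z by (auto simp: fun_eq_iff)
    moreover have "\<alpha> (v(i := r *\<^sub>R x + s *\<^sub>R y)) = r * \<alpha> (v(i := x)) + s * \<alpha> (v(i := y))"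
      by (rule multilinear_on_slot[OF a]) (use v True xy in auto)
    ultimately show ?thesis by (simp add: algebra_simps)
  next
    case False
    have "(\<lambda>j. (v(i := z)) (k + j)) = (\<lambda>j. v (k + j))(i - k := z)" for z
      using False by (auto simp: fun_eq_iff)
    moreover have "\<beta> ((\<lambda>j. v (k + j))(i - k := r *\<^sub>R x + s *\<^sub>R y))
        = r * \<beta> ((\<lambda>j. v (k + j))(i - k := x)) + s * \<beta> ((\<lambda>j. v (k + j))(i - k := y))"
      by (rule multilinear_on_slot[OF b]) (use v i False xy in auto)
    moreover have "\<alpha> (v(i := z)) = \<alpha> v" if "z \<in> V" for z
      by (rule multilinear_on_cong[OF a]) (use v False that in auto)
    moreover have "r *\<^sub>R x + s *\<^sub>R y \<in> V"
      using xy by (intro subspace_add[OF V] subspace_scale[OF V])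
    ultimately show ?thesis using xy by (simp add: algebra_simps)
  qed
qed

lemma wedge_alternating:
  "subspace V \<Longrightarrow> multilinear_on V k \<alpha> \<Longrightarrow> multilinear_on V l \<beta> \<Longrightarrow>
    alternating_on V (k + l) (wedge k l \<alpha> \<beta>)"
  unfolding wedge_eq_alternation by (intro alternation_alternating multilinear_on_tensor)

lemma wedge_power_alternating:
  assumes "subspace V" "multilinear_on V k \<alpha>"
  shows "alternating_on V (k * m) (wedge_power k \<alpha> m)"
proof (induction m)
  case 0
  then show ?case by (simp add: alternating_on_def multilinear_on_def)
next
  case (Suc m)
  then have "multilinear_on V (k * m) (wedge_power k \<alpha> m)" by (simp add: alternating_on_def)
  from wedge_alternating[OF assms this] show ?case by simp
qed

text \<open>The inner antisymmetrisation is absorbed by the outer one: a permutation \<tau> of the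
  last \<open>l\<close> slots can be moved into \<sigma> without changing the outer sum, and the
  \<open>fact l\<close> equal contributions cancel the inner normalisation. The assumption says that
  \<alpha> looks at the first \<open>k\<close> slots only, which \<tau> leaves alone.\<close>

lemma wedge_alternation:
  assumes \<alpha>: "\<And>v u. (\<And>i. i < k \<Longrightarrow> v i = u i) \<Longrightarrow> \<alpha> v = \<alpha> u"
  shows "wedge k l \<alpha> (alternation l t) = alternation (k + l) (\<lambda>u. \<alpha> u * t (\<lambda>i. u (k + i)))"
proof
  fix v :: "nat \<Rightarrow> 'a"
  let ?n = "k + l"
  let ?F = "\<lambda>\<sigma>. of_int (sign \<sigma>) * (\<alpha> (\<lambda>i. v (\<sigma> i)) * t (\<lambda>i. v (\<sigma> (k + i))))"
  let ?P = "\<lambda>n. {\<sigma>. \<sigma> permutes {..<n::nat}}"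
  \<comment> \<open>\<open>\<Phi> \<tau>\<close> is \<tau> acting on the shifted block of indices
    from \<open>k\<close> on.\<close>
  define \<Phi> where "\<Phi> = map_permutation {..<l} (\<lambda>i. k + i)"
  have inj: "inj_on (\<lambda>i. k + i) {..<l}" by simp
  have \<Phi>: "\<Phi> \<tau> permutes {..<?n}" "sign (\<Phi> \<tau>) = sign \<tau>"
    "\<And>i. \<Phi> \<tau> (k + i) = k + \<tau> i" "\<And>i. i < k \<Longrightarrow> \<Phi> \<tau> i = i"
    if \<tau>: "\<tau> permutes {..<l}" for \<tau>
  proof -
    have bij: "bij_betw (\<lambda>i. k + i) {..<l} {k..<?n}"
      by (simp add: bij_betw_def image_add_atLeastLessThan lessThan_atLeast0 add.commute)
    have perm: "\<Phi> \<tau> permutes {k..<?n}"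
      unfolding \<Phi>_def by (rule map_permutation_permutes[OF bij \<tau>])
    show "\<Phi> \<tau> permutes {..<?n}" by (rule permutes_subset[OF perm]) auto
    show "sign (\<Phi> \<tau>) = sign \<tau>" unfolding \<Phi>_def by (rule sign_map_permutation[OF inj \<tau>]) simp
    show "\<Phi> \<tau> i = i" if "i < k" for i using permutes_not_in[OF perm, of i] that by simp
    show "\<Phi> \<tau> (k + i) = k + \<tau> i" for i
    proof (cases "i < l")
      case True
      then show ?thesis unfolding \<Phi>_def using map_permutation_apply[OF inj] by simp
    next
      case False
      then show ?thesis using permutes_not_in[OF perm, of "k + i"] permutes_not_in[OF \<tau>, of i] by simp
    qed
  qed
  have inner: "(\<Sum>\<sigma>\<in>?P ?n. of_int (sign \<sigma>) * (\<alpha> (\<lambda>i. v (\<sigma> i)) * (of_int (sign \<tau>) * t (\<lambda>i. v (\<sigma> (k + \<tau> i))))))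
      = sum ?F (?P ?n)" if \<tau>: "\<tau> permutes {..<l}" for \<tau>
  proof -
    have "sum ?F (?P ?n) = (\<Sum>\<sigma>\<in>?P ?n. ?F (\<sigma> \<circ> \<Phi> \<tau>))"
      by (rule sum_permutations_compose_right[OF \<Phi>(1)[OF \<tau>]])
    also have "\<dots> = (\<Sum>\<sigma>\<in>?P ?n. of_int (sign \<sigma>) * (\<alpha> (\<lambda>i. v (\<sigma> i)) * (of_int (sign \<tau>) * t (\<lambda>i. v (\<sigma> (k + \<tau> i))))))"
    proof (rule sum.cong[OF refl])
      fix \<sigma> assume "\<sigma> \<in> ?P ?n"
      then have "sign (\<sigma> \<circ> \<Phi> \<tau>) = sign \<sigma> * sign \<tau>"
        using permutes_imp_permutation[OF finite_lessThan] \<Phi>(1)[OF \<tau>] \<Phi>(2)[OF \<tau>]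
        by (simp add: sign_compose)
      moreover have "\<alpha> (\<lambda>i. v ((\<sigma> \<circ> \<Phi> \<tau>) i)) = \<alpha> (\<lambda>i. v (\<sigma> i))"
        by (rule \<alpha>) (simp add: \<Phi>(4)[OF \<tau>])
      ultimately show "?F (\<sigma> \<circ> \<Phi> \<tau>)
          = of_int (sign \<sigma>) * (\<alpha> (\<lambda>i. v (\<sigma> i)) * (of_int (sign \<tau>) * t (\<lambda>i. v (\<sigma> (k + \<tau> i)))))"
        by (simp add: \<Phi>(3)[OF \<tau>])
    qed
    finally show ?thesis by simp
  qed
  have "wedge k l \<alpha> (alternation l t) v
      = (\<Sum>\<sigma>\<in>?P ?n. \<Sum>\<tau>\<in>?P l. of_int (sign \<sigma>) * (\<alpha> (\<lambda>i. v (\<sigma> i)) * (of_int (sign \<tau>) * t (\<lambda>i. v (\<sigma> (k + \<tau> i))))))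
        / fact l / fact ?n"
    by (simp add: wedge_def alternation_def sum_distrib_left sum_divide_distrib mult.assoc)
  also have "(\<Sum>\<sigma>\<in>?P ?n. \<Sum>\<tau>\<in>?P l. of_int (sign \<sigma>) * (\<alpha> (\<lambda>i. v (\<sigma> i)) * (of_int (sign \<tau>) * t (\<lambda>i. v (\<sigma> (k + \<tau> i))))))
      = (\<Sum>\<tau>\<in>?P l. sum ?F (?P ?n))"
    by (subst sum.swap) (simp add: inner)
  also have "\<dots> = fact l * sum ?F (?P ?n)"
    using card_permutations[OF card_lessThan finite_lessThan, of l] by simp
  finally have "wedge k l \<alpha> (alternation l t) v = sum ?F (?P ?n) / fact ?n" by simp
  also have "\<dots> = alternation ?n (\<lambda>u. \<alpha> u * t (\<lambda>i. u (k + i))) v" by (simp add: alternation_def)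
  finally show "wedge k l \<alpha> (alternation l t) v = alternation ?n (\<lambda>u. \<alpha> u * t (\<lambda>i. u (k + i))) v" .
qed

lemma wedge_power_uncurry2:
  "wedge_power 2 (uncurry2 \<beta>) m = alternation (2 * m) (\<lambda>u. \<Prod>i<m. \<beta> (u (2 * i)) (u (1 + 2 * i)))"
proof (induction m)
  case 0
  have "{\<sigma>. \<sigma> permutes {}} = {id :: nat \<Rightarrow> nat}" by auto
  then show ?case by (simp add: fun_eq_iff alternation_def sign_id)
next
  case (Suc m)
  have "wedge_power 2 (uncurry2 \<beta>) (Suc m)
      = alternation (2 + 2 * m) (\<lambda>u. uncurry2 \<beta> u * (\<Prod>i<m. \<beta> (u (2 + 2 * i)) (u (2 + (1 + 2 * i)))))"
    unfolding wedge_power.simps Suc.IH by (rule wedge_alternation) (simp add: uncurry2_def)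
  moreover have "uncurry2 \<beta> u * (\<Prod>i<m. \<beta> (u (2 + 2 * i)) (u (2 + (1 + 2 * i))))
      = (\<Prod>i<Suc m. \<beta> (u (2 * i)) (u (1 + 2 * i)))" for u
    unfolding prod.lessThan_Suc_shift by (simp add: uncurry2_def)
  ultimately show ?case by simp
qed

text \<open>A single sum over permutations in place of iterated wedges. Positivity on adapted bases,
  continuity in \<lambda>, smoothness and dependence on tangent vectors only are all read off this
  form.\<close>

lemma wedge_uncurry1_wedge_power:
  "wedge 1 (2 * m) (uncurry1 \<alpha>) (wedge_power 2 (uncurry2 \<beta>) m)
    = alternation (1 + 2 * m) (\<lambda>u. \<alpha> (u 0) * (\<Prod>i<m. \<beta> (u (1 + 2 * i)) (u (2 + 2 * i))))"
  unfolding wedge_power_uncurry2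
  by (subst wedge_alternation) (simp_all add: uncurry1_def)

section \<open>The value of \<open>\<eta> \<and> \<Omega>\<^sup>m\<close> on an adapted basis\<close>

text \<open>The matrix of \<Omega> in a basis \<xi>, \<phi>u, u, \<dots>: index 0 belongs to \<xi>,
  and the indices 2j + 1 and 2j + 2 to a pair \<phi>u, u.\<close>

definition std_pairing :: "nat \<Rightarrow> nat \<Rightarrow> real" where
  "std_pairing a b = (if odd a \<and> b = Suc a then 1 else if odd b \<and> a = Suc b then - 1 else 0)"

text \<open>If the product is nonzero, \<sigma> permutes the pairs {2j + 1, 2j + 2} and flips some
  of them. Permuting pairs as wholes is even; a flip changes both the sign of \<sigma> and the sign
  of one factor.\<close>

lemma std_pairing_nonneg:
  assumes "\<sigma> permutes {..<1 + 2 * m}" "\<sigma> 0 = 0"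
  shows "0 \<le> of_int (sign \<sigma>) * (\<Prod>i<m. std_pairing (\<sigma> (1 + 2 * i)) (\<sigma> (2 + 2 * i)))"
  using assms
proof (induction m arbitrary: \<sigma>)
  case 0
  then have "\<sigma> = id" using permutes_sing[of \<sigma> "0::nat"] by (simp add: lessThan_Suc)
  then show ?case by simp
next
  case (Suc m)
  let ?n = "1 + 2 * Suc m"
  let ?p = "\<lambda>\<sigma> i. std_pairing (\<sigma> (1 + 2 * i)) (\<sigma> (2 + 2 * i))"
  show ?case
  proof (cases "(\<Prod>i<Suc m. ?p \<sigma> i) = 0")
    case True
    then show ?thesis by (simp only: mult_zero_right order_refl)
  next
    case False
    \<comment> \<open>The position of the largest index; the pair of positions containing it is
      brought to the end and split off.\<close>
    define x where "x = inv \<sigma> (2 + 2 * m)"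
    have \<sigma>x: "\<sigma> x = 2 + 2 * m" using permutes_inverses[OF Suc.prems(1)] by (simp add: x_def)
    have "x < ?n" using permutes_in_image[OF Suc.prems(1), of x] \<sigma>x by simp
    moreover have "x \<noteq> 0" using \<sigma>x Suc.prems(2) by (cases "x = 0") auto
    ultimately obtain j where j: "j \<le> m" "x = 1 + 2 * j \<or> x = 2 + 2 * j"
      by (intro that[of "(x - 1) div 2"]) presburger+
    \<comment> \<open>Exchanges the pairs \<open>j\<close> and \<open>m\<close> entry by entry,
      hence is even; it is the identity if \<open>j = m\<close>.\<close>
    define s where "s = Transposition.transpose (1 + 2 * j) (1 + 2 * m) \<circ> Transposition.transpose (2 + 2 * j) (2 + 2 * m)"
    have s_perm: "s permutes {..<?n}"
      unfolding s_def using j(1) by (intro permutes_compose permutes_swap_id) auto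
    have s_odd: "s (1 + 2 * i) = 1 + 2 * Transposition.transpose j m i"
      and s_even: "s (2 + 2 * i) = 2 + 2 * Transposition.transpose j m i" for i
      by (auto simp: s_def Transposition.transpose_def)
    have s0: "s 0 = 0" by (simp add: s_def Transposition.transpose_def)
    have s_sign: "sign s = 1"
      by (simp add: s_def sign_compose permutation_swap_id sign_swap_id)
    define \<tau> where "\<tau> = \<sigma> \<circ> s"
    have \<tau>: "\<tau> permutes {..<?n}" "\<tau> 0 = 0" "sign \<tau> = sign \<sigma>"
      using Suc.prems permutes_compose[OF s_perm] s0 s_sign
        permutes_imp_permutation[OF finite_lessThan] s_perm
      by (auto simp: \<tau>_def sign_compose)
    have "(\<Prod>i<Suc m. ?p \<sigma> i) = (\<Prod>i<Suc m. ?p \<sigma> (Transposition.transpose j m i))"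
      using prod.permute[OF permutes_swap_id[of j "{..<Suc m}" m], of "?p \<sigma>"] j(1) by (simp add: o_def)
    also have "\<dots> = (\<Prod>i<Suc m. ?p \<tau> i)"
      by (simp only: \<tau>_def o_def s_odd s_even)
    finally have prod_\<tau>: "(\<Prod>i<Suc m. ?p \<sigma> i) = (\<Prod>i<Suc m. ?p \<tau> i)" .
    from False have "(\<Prod>i<Suc m. ?p \<tau> i) \<noteq> 0" unfolding prod_\<tau> .
    then have nz: "?p \<tau> m \<noteq> 0" by simp
    have "\<tau> (1 + 2 * m) = \<sigma> (1 + 2 * j)" "\<tau> (2 + 2 * m) = \<sigma> (2 + 2 * j)"
      unfolding \<tau>_def o_def s_odd s_even by simp_all
    then have "\<tau> (1 + 2 * m) = 2 + 2 * m \<or> \<tau> (2 + 2 * m) = 2 + 2 * m"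
      using j(2) \<sigma>x by auto
    \<comment> \<open>One entry of the last pair is the largest index, so a nonzero factor forces
      the other entry. In the flipped case a transposition reduces to the first one, at the cost of
      two signs.\<close>
    with nz consider (stay) "\<tau> (1 + 2 * m) = 1 + 2 * m" "\<tau> (2 + 2 * m) = 2 + 2 * m"
      | (flip) "\<tau> (1 + 2 * m) = 2 + 2 * m" "\<tau> (2 + 2 * m) = 1 + 2 * m"
      by (auto simp: std_pairing_def split: if_splits)
    then have "0 \<le> of_int (sign \<tau>) * (\<Prod>i<Suc m. ?p \<tau> i)"
    proof cases
      case stay
      have "\<tau> permutes {..<1 + 2 * m}"
        by (rule permutes_superset[OF \<tau>(1)]) (use stay in \<open>auto simp: less_Suc_eq\<close>)
      from Suc.IH[OF this \<tau>(2)] show ?thesis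
        using stay by (simp add: std_pairing_def)
    next
      case flip
      let ?t = "Transposition.transpose (1 + 2 * m) (2 + 2 * m)"
      have perm: "\<tau> \<circ> ?t permutes {..<?n}"
        by (intro permutes_compose permutes_swap_id \<tau>(1)) auto
      have "\<tau> \<circ> ?t permutes {..<1 + 2 * m}"
        by (rule permutes_superset[OF perm]) (use flip in \<open>auto simp: less_Suc_eq\<close>)
      moreover have "(\<tau> \<circ> ?t) 0 = 0" using \<tau>(2) by (simp add: Transposition.transpose_def)
      ultimately have "0 \<le> of_int (sign (\<tau> \<circ> ?t)) * (\<Prod>i<m. ?p (\<tau> \<circ> ?t) i)"
        by (rule Suc.IH)
      also have "sign (\<tau> \<circ> ?t) = - sign \<tau>"
        using permutes_imp_permutation[OF finite_lessThan \<tau>(1)]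
        by (simp add: sign_compose permutation_swap_id sign_swap_id)
      also have "(\<Prod>i<m. ?p (\<tau> \<circ> ?t) i) = (\<Prod>i<m. ?p \<tau> i)"
        by (intro prod.cong refl) (simp add: Transposition.transpose_def)
      finally show ?thesis using flip by (simp add: std_pairing_def)
    qed
    then show ?thesis by (simp only: prod_\<tau> \<tau>(3))
  qed
qed

text \<open>The constant \<open>c\<close> of the overview. Evaluated on an adapted basis the form
  depends on indices only, so the antisymmetriser is applied to the identity sequence of
  indices.\<close>

definition std_volume :: "nat \<Rightarrow> real" where
  "std_volume m = alternation (1 + 2 * m)
     (\<lambda>s. (if s 0 = 0 then 1 else 0) * (\<Prod>i<m. std_pairing (s (1 + 2 * i)) (s (2 + 2 * i)))) (\<lambda>i. i)"

text \<open>No summand is negative, and the identity permutation contributes a positive one.\<close>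

lemma std_volume_pos: "0 < std_volume m"
  unfolding std_volume_def alternation_def
proof (rule divide_pos_pos)
  show "0 < (\<Sum>\<sigma> | \<sigma> permutes {..<1 + 2 * m}. of_int (sign \<sigma>) *
      ((if \<sigma> 0 = 0 then 1 else 0) * (\<Prod>i<m. std_pairing (\<sigma> (1 + 2 * i)) (\<sigma> (2 + 2 * i)))) :: real)"
  proof (rule sum_pos2)
    show "finite {\<sigma>. \<sigma> permutes {..<1 + 2 * m}}" by (rule finite_permutations) simp
    show "id \<in> {\<sigma>. \<sigma> permutes {..<1 + 2 * m}}" by (simp add: permutes_id)
    show "0 < of_int (sign id) *
      ((if id (0::nat) = 0 then 1 else 0) * (\<Prod>i<m. std_pairing (id (1 + 2 * i)) (id (2 + 2 * i))) :: real)"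
      by (simp add: std_pairing_def)
    show "0 \<le> of_int (sign \<sigma>) *
      ((if \<sigma> 0 = 0 then 1 else 0) * (\<Prod>i<m. std_pairing (\<sigma> (1 + 2 * i)) (\<sigma> (2 + 2 * i))) :: real)"
      if "\<sigma> \<in> {\<sigma>. \<sigma> permutes {..<1 + 2 * m}}" for \<sigma>
      using std_pairing_nonneg[of \<sigma> m] that by simp
  qed
qed simp

lemma index_cases:
  fixes i :: nat
  assumes "i < 1 + 2 * k"
  obtains "i = 0" | j where "j < k" "i = 1 + 2 * j" | j where "j < k" "i = 2 + 2 * j"
proof (cases "i = 0"; cases "even i")
  assume "i \<noteq> 0" "even i"
  then show ?thesis using assms by (intro that(3)[of "(i - 2) div 2"]) presburger+
next
  assume "i \<noteq> 0" "odd i"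
  then show ?thesis using assms by (intro that(2)[of "i div 2"]) presburger+
qed (use that in auto)

section \<open>Almost contact metric structures on a vector space\<close>

locale acm_subspace = inner_product_subspace V n g
  for V :: "'v::real_vector set" and n g +
  fixes \<phi> :: "'v \<Rightarrow> 'v" and \<xi> :: 'v and \<eta> :: "'v \<Rightarrow> real"
  assumes phi_V [simp]: "u \<in> V \<Longrightarrow> \<phi> u \<in> V"
    and phi_linear: "u \<in> V \<Longrightarrow> v \<in> V \<Longrightarrow> \<phi> (a *\<^sub>R u + b *\<^sub>R v) = a *\<^sub>R \<phi> u + b *\<^sub>R \<phi> v"
    and eta_linear: "u \<in> V \<Longrightarrow> v \<in> V \<Longrightarrow> \<eta> (a *\<^sub>R u + b *\<^sub>R v) = a * \<eta> u + b * \<eta> v"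
    and xi_V [simp]: "\<xi> \<in> V"
    and eta_xi [simp]: "\<eta> \<xi> = 1"
    and phi_phi: "u \<in> V \<Longrightarrow> \<phi> (\<phi> u) = - u + \<eta> u *\<^sub>R \<xi>"
    and compatible: "u \<in> V \<Longrightarrow> v \<in> V \<Longrightarrow> g (\<phi> u) (\<phi> v) = g u v - \<eta> u * \<eta> v"
begin

lemma phi_scale: "u \<in> V \<Longrightarrow> \<phi> (a *\<^sub>R u) = a *\<^sub>R \<phi> u"
  using phi_linear[of u u a 0] by simp

lemma phi_add: "u \<in> V \<Longrightarrow> v \<in> V \<Longrightarrow> \<phi> (u + v) = \<phi> u + \<phi> v"
  using phi_linear[of u v 1 1] by simp

lemma phi_zero [simp]: "\<phi> 0 = 0"
  using phi_scale[of 0 0] by simp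

lemma phi_minus: "u \<in> V \<Longrightarrow> \<phi> (- u) = - \<phi> u"
  using phi_scale[of u "- 1"] by simp

lemma phi_diff: "u \<in> V \<Longrightarrow> v \<in> V \<Longrightarrow> \<phi> (u - v) = \<phi> u - \<phi> v"
  using phi_linear[of u v 1 "- 1"] by simp

lemma eta_scale: "u \<in> V \<Longrightarrow> \<eta> (a *\<^sub>R u) = a * \<eta> u"
  using eta_linear[of u u a 0] by simp

lemma eta_add: "u \<in> V \<Longrightarrow> v \<in> V \<Longrightarrow> \<eta> (u + v) = \<eta> u + \<eta> v"
  using eta_linear[of u v 1 1] by simp

lemma eta_zero [simp]: "\<eta> 0 = 0"
  using eta_scale[of 0 0] by simp

lemma eta_minus: "u \<in> V \<Longrightarrow> \<eta> (- u) = - \<eta> u"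
  using eta_scale[of u "- 1"] by simp

lemma xi_nonzero [simp]: "\<xi> \<noteq> 0"
  using eta_xi eta_zero by force

text \<open>The cube of \<phi> kills \<xi>, which makes \<phi>\<xi> a multiple of \<xi>; applying
  \<phi> once more shows that the factor or the vector is zero.\<close>

lemma phi_xi [simp]: "\<phi> \<xi> = 0"
proof -
  have "\<phi> (\<phi> \<xi>) = 0" by (simp add: phi_phi)
  then have "\<phi> (\<phi> (\<phi> \<xi>)) = 0" by simp
  then have "- \<phi> \<xi> + \<eta> (\<phi> \<xi>) *\<^sub>R \<xi> = 0" using phi_phi[of "\<phi> \<xi>"] by simp
  then have eq: "\<phi> \<xi> = \<eta> (\<phi> \<xi>) *\<^sub>R \<xi>" by (simp add: add_eq_0_iff)
  have "\<eta> (\<phi> \<xi>) *\<^sub>R \<phi> \<xi> = \<phi> (\<eta> (\<phi> \<xi>) *\<^sub>R \<xi>)" by (simp add: phi_scale)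
  also have "\<dots> = 0" using eq \<open>\<phi> (\<phi> \<xi>) = 0\<close> by simp
  finally show ?thesis using eq by auto
qed

text \<open>The cube of \<phi> is computed in two ways: as the square at \<phi>u, and as \<phi> of
  the square at u.\<close>

lemma eta_phi [simp]:
  assumes u: "u \<in> V"
  shows "\<eta> (\<phi> u) = 0"
proof -
  have "\<phi> (\<phi> (\<phi> u)) = - \<phi> u + \<eta> (\<phi> u) *\<^sub>R \<xi>" using u by (intro phi_phi phi_V)
  moreover have "\<phi> (\<phi> (\<phi> u)) = - \<phi> u"
    using u by (subst phi_phi[OF u], subst phi_add) (simp_all add: phi_minus phi_scale)
  ultimately have "- \<phi> u + \<eta> (\<phi> u) *\<^sub>R \<xi> = - \<phi> u" by (simp only:)
  then show ?thesis by simp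
qed

lemma g_xi: "u \<in> V \<Longrightarrow> g u \<xi> = \<eta> u"
  using compatible[of u \<xi>] g_sym[of "\<phi> u" 0] by simp

lemma g_phi_left:
  assumes "u \<in> V" "v \<in> V"
  shows "g (\<phi> u) v = - g u (\<phi> v)"
proof -
  have "g (\<phi> u) (\<phi> (\<phi> v)) = g u (\<phi> v)" using compatible[of u "\<phi> v"] assms by simp
  then show ?thesis
    using assms by (simp add: phi_phi g_diff_right g_scale_right g_xi)
qed

lemma g_phi_self: "u \<in> V \<Longrightarrow> g u (\<phi> u) = 0"
  using g_phi_left[of u u] g_sym[of u "\<phi> u"] by simp

text \<open>In each pair \<phi>u precedes u, so that \<Omega>(\<phi>u, u) = g(\<phi>u, \<phi>u) = 1
  is positive.\<close>

definition adapted :: "nat \<Rightarrow> (nat \<Rightarrow> 'v) \<Rightarrow> bool" where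
  "adapted k f \<longleftrightarrow> orthonormal (1 + 2 * k) f \<and> f 0 = \<xi> \<and> (\<forall>i<k. f (1 + 2 * i) = \<phi> (f (2 + 2 * i)))"

text \<open>The vectors chosen so far span a \<phi>-invariant space, hence \<phi>u is orthogonal to
  them together with u. Two vectors can be added even though the hypothesis leaves room for only
  one, which forces the dimension to be odd.\<close>

lemma adapted_extend:
  assumes f: "adapted k f" and n: "1 + 2 * k < n"
  shows "\<exists>f'. adapted (Suc k) f'"
proof -
  have f_orth: "orthonormal (1 + 2 * k) f" using f by (simp add: adapted_def)
  have fV: "f i \<in> V" if "i < 1 + 2 * k" for i using f_orth that by (simp add: orthonormal_def)
  obtain u where u: "u \<in> V" "g u u = 1" "\<And>i. i < 1 + 2 * k \<Longrightarrow> g u (f i) = 0"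
    using orthonormal_extend[OF f_orth n] by blast
  have eta_u: "\<eta> u = 0" using u(3)[of 0] f g_xi[OF u(1)] by (simp add: adapted_def)
  have phi_u: "g (\<phi> u) (f i) = 0" if i: "i < 1 + 2 * k" for i
  proof -
    consider "i = 0" | j where "j < k" "i = 1 + 2 * j" | j where "j < k" "i = 2 + 2 * j"
      using i by (rule index_cases)
    then show ?thesis
    proof cases
      case 1
      then show ?thesis using f u(1) by (simp add: adapted_def g_xi)
    next
      case 2
      then have "f i = \<phi> (f (2 + 2 * j))" using f by (simp add: adapted_def)
      then show ?thesis using compatible[OF u(1) fV, of "2 + 2 * j"] u(3)[of "2 + 2 * j"] 2 eta_u by simp
    next
      case 3
      then have "f (1 + 2 * j) = \<phi> (f i)" using f by (simp add: adapted_def)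
      then show ?thesis using g_phi_left[OF u(1) fV[OF i]] u(3)[of "1 + 2 * j"] 3 by simp
    qed
  qed
  define f' where "f' = f(1 + 2 * k := \<phi> u, 2 + 2 * k := u)"
  have f': "f' i = f i" if "i < 1 + 2 * k" for i using that by (simp add: f'_def)
  have f'1: "f' (1 + 2 * k) = \<phi> u" and f'2: "f' (2 + 2 * k) = u" by (simp_all add: f'_def)
  have cases3: "i < 1 + 2 * k \<or> i = 1 + 2 * k \<or> i = 2 + 2 * k" if "i < 1 + 2 * Suc k" for i
    using that by auto
  have phi_u_u: "g (\<phi> u) u = 0" "g u (\<phi> u) = 0" "g (\<phi> u) (\<phi> u) = 1"
    using u(1,2) eta_u g_phi_self[OF u(1)] by (simp_all add: g_phi_left[of u u] compatible)
  have "orthonormal (1 + 2 * Suc k) f'"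
    unfolding orthonormal_def
  proof (intro conjI allI impI)
    show "f' i \<in> V" if "i < 1 + 2 * Suc k" for i
      using cases3[OF that] f' f'1 f'2 fV u(1) by auto
    show "g (f' i) (f' j) = (if i = j then 1 else 0)"
      if ij: "i < 1 + 2 * Suc k" "j < 1 + 2 * Suc k" for i j
      using cases3[OF ij(1)] cases3[OF ij(2)]
    proof (elim disjE)
      assume "i < 1 + 2 * k" "j < 1 + 2 * k"
      then show ?thesis using f_orth by (simp add: f' orthonormal_def)
    next
      assume ij: "i < 1 + 2 * k" "j = 1 + 2 * k"
      then show ?thesis using phi_u[OF ij(1)] g_sym[OF fV[OF ij(1)], of "\<phi> u"] u(1) f'1 by (simp add: f')
    next
      assume ij: "i < 1 + 2 * k" "j = 2 + 2 * k"
      then show ?thesis using u(3)[OF ij(1)] g_sym[OF fV[OF ij(1)] u(1)] f'2 by (simp add: f')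
    next
      assume ij: "i = 1 + 2 * k" "j < 1 + 2 * k"
      then show ?thesis using phi_u[OF ij(2)] f'1 by (simp add: f')
    next
      assume ij: "i = 2 + 2 * k" "j < 1 + 2 * k"
      then show ?thesis using u(3)[OF ij(2)] f'2 by (simp add: f')
    qed (use f'1 f'2 phi_u_u u(2) in simp_all)
  qed
  moreover have "f' 0 = \<xi>" using f f'[of 0] by (simp add: adapted_def)
  moreover have "f' (1 + 2 * i) = \<phi> (f' (2 + 2 * i))" if "i < Suc k" for i
  proof (cases "i = k")
    case True
    then show ?thesis using f'1 f'2 by simp
  next
    case False
    then have "i < k" using that by simp
    then show ?thesis using f f'[of "1 + 2 * i"] f'[of "2 + 2 * i"] by (simp add: adapted_def)
  qed
  ultimately show ?thesis unfolding adapted_def by blast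
qed

lemma adapted_exists_below: "2 * k < n \<Longrightarrow> \<exists>f. adapted k f"
proof (induction k)
  case 0
  have "adapted 0 (\<lambda>i. \<xi>)" by (simp add: adapted_def orthonormal_def g_xi)
  then show ?case by blast
next
  case (Suc k)
  then obtain f where "adapted k f" by auto
  then show ?case by (rule adapted_extend) (use Suc.prems in simp)
qed

text \<open>In even dimension an adapted family of n - 1 vectors would exist and extend to n + 1
  orthonormal ones.\<close>

lemma odd_dimension: "odd n"
proof
  assume "even n"
  have "orthonormal 1 (\<lambda>i. \<xi>)" by (simp add: orthonormal_def g_xi)
  then have "n \<noteq> 0" using orthonormal_card_le[of 1] by force
  with \<open>even n\<close> obtain k where k: "n = 2 * Suc k" by (metis dvdE mult_0_right not0_implies_Suc)
  then obtain f where "adapted k f" using adapted_exists_below[of k] by auto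
  from adapted_extend[OF this] k obtain f' where "adapted (Suc k) f'" by auto
  then show False using orthonormal_card_le[of "1 + 2 * Suc k"] k by (auto simp: adapted_def)
qed

lemma adapted_basis:
  obtains f where "adapted (n div 2) f" "orthonormal n f" "\<And>i. f i \<in> V"
proof -
  obtain f where f: "adapted (n div 2) f"
    using adapted_exists_below[of "n div 2"] odd_dimension by (auto elim!: oddE)
  \<comment> \<open>Forms take infinite sequences in \<open>V\<close>; beyond \<open>n\<close> the
    family is set to 0.\<close>
  define f' where "f' = (\<lambda>i. if i < n then f i else 0)"
  have n: "1 + 2 * (n div 2) = n" using odd_dimension by presburger
  have eq: "f' i = f i" if "i < n" for i using that by (simp add: f'_def)
  have o: "orthonormal n f" using f unfolding adapted_def n by blast
  then have o': "orthonormal n f'" by (simp add: orthonormal_def eq)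
  moreover have "f' i \<in> V" for i using o by (simp add: f'_def orthonormal_def)
  moreover have "f' 0 = \<xi>" using f n by (simp add: f'_def adapted_def)
  moreover have "f' (1 + 2 * i) = \<phi> (f' (2 + 2 * i))" if "i < n div 2" for i
    using f that n eq[of "1 + 2 * i"] eq[of "2 + 2 * i"] by (simp add: adapted_def)
  ultimately show ?thesis using that[of f'] unfolding adapted_def n by blast
qed

lemma adapted_eta:
  assumes f: "adapted k f" and a: "a < 1 + 2 * k"
  shows "\<eta> (f a) = (if a = 0 then 1 else 0)"
proof -
  have "f a \<in> V" "g (f a) (f 0) = (if a = 0 then 1 else 0)" "f 0 = \<xi>"
    using f a by (auto simp: adapted_def orthonormal_def)
  then show ?thesis by (simp add: g_xi)
qed

lemma adapted_pairing:
  assumes f: "adapted k f" and a: "a < 1 + 2 * k" and b: "b < 1 + 2 * k"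
  shows "g (f a) (\<phi> (f b)) = std_pairing a b"
proof -
  have fV: "f i \<in> V" if "i < 1 + 2 * k" for i using f that by (simp add: adapted_def orthonormal_def)
  have gf: "g (f i) (f j) = (if i = j then 1 else 0)" if "i < 1 + 2 * k" "j < 1 + 2 * k" for i j
    using f that by (simp add: adapted_def orthonormal_def)
  consider "b = 0" | j where "j < k" "b = 1 + 2 * j" | j where "j < k" "b = 2 + 2 * j"
    using b by (rule index_cases)
  then show ?thesis
  proof cases
    case 1
    then show ?thesis using f g_sym[OF fV[OF a], of 0] fV[OF a] by (simp add: adapted_def std_pairing_def)
  next
    case 2
    then have j: "2 + 2 * j < 1 + 2 * k" by simp
    have "\<phi> (f b) = - f (2 + 2 * j)"
      using f 2 phi_phi[OF fV[OF j]] adapted_eta[OF f j] by (simp add: adapted_def)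
    then have "g (f a) (\<phi> (f b)) = - g (f a) (f (2 + 2 * j))"
      by (simp only: g_minus_right[OF fV[OF j] fV[OF a]])
    then show ?thesis using gf[OF a j] 2 by (auto simp: std_pairing_def)
  next
    case 3
    then have j: "1 + 2 * j < 1 + 2 * k" by simp
    have "\<phi> (f b) = f (1 + 2 * j)" using f 3 by (simp add: adapted_def)
    then show ?thesis using gf[OF a j] 3 by (auto simp: std_pairing_def)
  qed
qed

lemma volume_adapted:
  assumes f: "adapted m f"
  shows "wedge 1 (2 * m) (uncurry1 \<eta>) (wedge_power 2 (uncurry2 (\<lambda>u v. g u (\<phi> v))) m) f = std_volume m"
  unfolding wedge_uncurry1_wedge_power std_volume_def alternation_def
proof (intro arg_cong2[where f = "(/)"] sum.cong refl arg_cong2[where f = "(*)"] prod.cong)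
  fix \<sigma> assume "\<sigma> \<in> {\<sigma>. \<sigma> permutes {..<1 + 2 * m}}"
  then have lt: "\<sigma> i < 1 + 2 * m" if "i < 1 + 2 * m" for i
    using permutes_in_image[of \<sigma> "{..<1 + 2 * m}" i] that by simp
  show "\<eta> (f (\<sigma> 0)) = (if \<sigma> 0 = 0 then 1 else 0)" by (rule adapted_eta[OF f lt]) simp
  show "g (f (\<sigma> (1 + 2 * i))) (\<phi> (f (\<sigma> (2 + 2 * i)))) = std_pairing (\<sigma> (1 + 2 * i)) (\<sigma> (2 + 2 * i))"
    if "i \<in> {..<m}" for i
    by (rule adapted_pairing[OF f lt lt]) (use that in auto)
qed

end

section \<open>Pointwise description of forms and structures\<close>

lemma diff_form_iff:
  "diff_form M k \<omega> \<longleftrightarrow>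
     (\<forall>p\<in>points M. alternating_on (tangent_space M p) k (\<omega> p)) \<and>
     (\<forall>X. (\<forall>i. vector_field M (X i)) \<longrightarrow> smooth_fun M (points M) (\<lambda>p. \<omega> p (\<lambda>i. X i p)))"
  unfolding diff_form_def alternating_on_def multilinear_on_def
  by (simp only: imp_conjR all_conj_distrib conj_assoc)

lemma uncurry1_multilinear_iff:
  assumes "subspace V"
  shows "multilinear_on V 1 (uncurry1 \<alpha>) \<longleftrightarrow>
    (\<forall>u\<in>V. \<forall>v\<in>V. \<forall>a b. \<alpha> (a *\<^sub>R u + b *\<^sub>R v) = a * \<alpha> u + b * \<alpha> v)"
proof
  assume m: "multilinear_on V 1 (uncurry1 \<alpha>)"
  show "\<forall>u\<in>V. \<forall>v\<in>V. \<forall>a b. \<alpha> (a *\<^sub>R u + b *\<^sub>R v) = a * \<alpha> u + b * \<alpha> v"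
    using multilinear_on_slot[OF m, of "\<lambda>_. 0" 0] subspace_0[OF assms]
    by (auto simp: uncurry1_def)
next
  assume "\<forall>u\<in>V. \<forall>v\<in>V. \<forall>a b. \<alpha> (a *\<^sub>R u + b *\<^sub>R v) = a * \<alpha> u + b * \<alpha> v"
  then show "multilinear_on V 1 (uncurry1 \<alpha>)"
    by (auto simp: multilinear_on_def uncurry1_def)
qed

context smooth_mfd
begin

lemma one_form_iff:
  "one_form M \<eta> \<longleftrightarrow>
     (\<forall>p\<in>points M. \<forall>u\<in>tangent_space M p. \<forall>v\<in>tangent_space M p. \<forall>a b.
        \<eta> p (a *\<^sub>R u + b *\<^sub>R v) = a * \<eta> p u + b * \<eta> p v) \<and>
     (\<forall>X. vector_field M X \<longrightarrow> smooth_fun M (points M) (\<lambda>p. \<eta> p (X p)))"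
proof -
  have "alternating_on (tangent_space M p) 1 (uncurry1 (\<eta> p)) \<longleftrightarrow>
      (\<forall>u\<in>tangent_space M p. \<forall>v\<in>tangent_space M p. \<forall>a b.
        \<eta> p (a *\<^sub>R u + b *\<^sub>R v) = a * \<eta> p u + b * \<eta> p v)" for p
    unfolding alternating_on_def uncurry1_multilinear_iff[OF tangent_subspace] by auto
  moreover have "(\<forall>X. (\<forall>i. vector_field M (X i)) \<longrightarrow> smooth_fun M (points M) (\<lambda>p. uncurry1 (\<eta> p) (\<lambda>i. X i p)))
      \<longleftrightarrow> (\<forall>X. vector_field M X \<longrightarrow> smooth_fun M (points M) (\<lambda>p. \<eta> p (X p)))"
    (is "?L \<longleftrightarrow> ?R")
  proof
    show ?R if L: ?L
    proof (intro allI impI)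
      fix X assume "vector_field M X"
      then show "smooth_fun M (points M) (\<lambda>p. \<eta> p (X p))"
        using L[rule_format, of "\<lambda>_. X"] by (simp add: uncurry1_def)
    qed
  qed (simp add: uncurry1_def)
  ultimately show ?thesis unfolding one_form_def diff_form_iff by simp
qed

lemma tangent_acm_subspace:
  assumes acm: "almost_contact_metric M \<phi> \<xi> \<eta> g" and p: "p \<in> points M"
  shows "acm_subspace (tangent_space M p) (mdim M) (g p) (\<phi> p) (\<xi> p) (\<eta> p)"
proof -
  have g: "riemannian_metric M g" and \<phi>: "endo_field M \<phi>" and \<xi>: "vector_field M \<xi>" and \<eta>: "one_form M \<eta>"
    using acm by (auto simp: almost_contact_metric_def compatible_metric_def almost_contact_def)
  show ?thesis
  proof
    obtain B where "finite B" "card B = DIM('e)" "independent B" "span B = tangent_space M p"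
      using tangent_space_basis[OF p] .
    then show "\<exists>B. finite B \<and> card B = mdim M \<and> independent B \<and> span B = tangent_space M p"
      unfolding mdim_def by (intro exI[of _ B] conjI)
    fix u v w a b
    assume T: "u \<in> tangent_space M p" "v \<in> tangent_space M p"
    show "g p (a *\<^sub>R u + b *\<^sub>R v) w = a * g p u w + b * g p v w" if "w \<in> tangent_space M p"
      using g T p that unfolding riemannian_metric_def by blast
    show "g p u v = g p v u" using g T p unfolding riemannian_metric_def by blast
    show "\<phi> p (a *\<^sub>R u + b *\<^sub>R v) = a *\<^sub>R \<phi> p u + b *\<^sub>R \<phi> p v"
      using \<phi> T p by (simp add: endo_field_def)
    show "\<eta> p (a *\<^sub>R u + b *\<^sub>R v) = a * \<eta> p u + b * \<eta> p v"
      using \<eta> T p unfolding one_form_iff by blast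
    show "g p (\<phi> p u) (\<phi> p v) = g p u v - \<eta> p u * \<eta> p v"
      using acm T p by (simp add: almost_contact_metric_def compatible_metric_def)
  next
    fix u assume u: "u \<in> tangent_space M p"
    show "\<phi> p u \<in> tangent_space M p" using \<phi> u p unfolding endo_field_def by blast
    show "\<phi> p (\<phi> p u) = - u + \<eta> p u *\<^sub>R \<xi> p"
      using acm u p by (simp add: almost_contact_metric_def almost_contact_def)
    show "0 < g p u u" if "u \<noteq> 0" using g u p that unfolding riemannian_metric_def by blast
  next
    show "\<xi> p \<in> tangent_space M p" by (rule vector_field_tangent[OF \<xi> p])
    show "\<eta> p (\<xi> p) = 1" using acm p by (simp add: almost_contact_metric_def almost_contact_def)
  qed (rule tangent_subspace)
qed

end

section \<open>The mixed Nijenhuis tensors of a 3-Sasakian structure\<close>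

text \<open>The even permutations of the three indices, listed so that the relations can be used
  without permutations.\<close>

definition cyclic_triple :: "3 \<Rightarrow> 3 \<Rightarrow> 3 \<Rightarrow> bool" where
  "cyclic_triple \<alpha> \<beta> \<gamma> \<longleftrightarrow> (\<alpha>, \<beta>, \<gamma>) \<in> {(1, 2, 3), (2, 3, 1), (3, 1, 2)}"

lemma cyclic_triple_rotate: "cyclic_triple \<alpha> \<beta> \<gamma> \<Longrightarrow> cyclic_triple \<beta> \<gamma> \<alpha>"
  by (auto simp: cyclic_triple_def)

lemma cyclic_triple_exists: "\<beta> \<noteq> \<gamma> \<Longrightarrow> \<exists>\<alpha>. cyclic_triple \<alpha> \<beta> \<gamma> \<or> cyclic_triple \<alpha> \<gamma> \<beta>"
  using exhaust_3[of \<beta>] exhaust_3[of \<gamma>]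
  by (elim disjE) (hypsubst, simp add: cyclic_triple_def)+

lemma cyclic_triple_evenperm:
  assumes "cyclic_triple \<alpha> \<beta> \<gamma>"
  obtains \<sigma> where "\<sigma> permutes (UNIV :: 3 set)" "evenperm \<sigma>" "\<sigma> 1 = \<alpha>" "\<sigma> 2 = \<beta>" "\<sigma> 3 = \<gamma>"
proof -
  let ?t = "Transposition.transpose :: 3 \<Rightarrow> 3 \<Rightarrow> 3 \<Rightarrow> 3"
  have perm: "?t a b \<circ> ?t b c permutes UNIV" for a b c
    by (intro permutes_compose permutes_swap_id) auto
  have even: "evenperm (?t a b \<circ> ?t b c)" if "a \<noteq> b" "b \<noteq> c" for a b c
    using that by (simp add: evenperm_comp permutation_swap_id evenperm_swap)
  consider "(\<alpha>, \<beta>, \<gamma>) = (1, 2, 3)" | "(\<alpha>, \<beta>, \<gamma>) = (2, 3, 1)" | "(\<alpha>, \<beta>, \<gamma>) = (3, 1, 2)"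
    using assms by (auto simp: cyclic_triple_def)
  then show ?thesis
  proof cases
    case 1
    then show ?thesis using that[of id] by (simp add: permutes_id)
  next
    case 2
    then show ?thesis
      using that[OF perm even, of 1 2 3] by (simp add: Transposition.transpose_def)
  next
    case 3
    then show ?thesis
      using that[OF perm even, of 3 2 1] by (simp add: Transposition.transpose_def)
  qed
qed

locale three_sasakian_mfd = smooth_mfd M for M :: "('a, 'e::euclidean_space) manifold" +
  fixes \<phi> :: "3 \<Rightarrow> 'a \<Rightarrow> 'a tvec \<Rightarrow> 'a tvec"
    and \<xi> :: "3 \<Rightarrow> 'a \<Rightarrow> 'a tvec"
    and \<eta> :: "3 \<Rightarrow> 'a \<Rightarrow> 'a tvec \<Rightarrow> real"
    and g :: "'a \<Rightarrow> 'a tvec \<Rightarrow> 'a tvec \<Rightarrow> real"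
  assumes three_sasakian: "three_sasakian M \<phi> \<xi> \<eta> g"
begin

abbreviation J :: "3 \<Rightarrow> ('a \<Rightarrow> 'a tvec) \<Rightarrow> 'a \<Rightarrow> 'a tvec" where
  "J i X \<equiv> \<lambda>q. \<phi> i q (X q)"

abbreviation bracket :: "('a \<Rightarrow> 'a tvec) \<Rightarrow> ('a \<Rightarrow> 'a tvec) \<Rightarrow> 'a \<Rightarrow> 'a tvec" where
  "bracket \<equiv> lie_bracket M"

lemma sasakian: "sasakian M (\<phi> i) (\<xi> i) (\<eta> i) g"
  using three_sasakian by (simp add: three_sasakian_def)

lemma acm: "almost_contact_metric M (\<phi> i) (\<xi> i) (\<eta> i) g"
  using sasakian by (simp add: sasakian_def)

lemma acm_at: "p \<in> points M \<Longrightarrow> acm_subspace (tangent_space M p) (mdim M) (g p) (\<phi> i p) (\<xi> i p) (\<eta> i p)"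
  by (rule tangent_acm_subspace[OF acm])

lemma vector_field_J: "vector_field M X \<Longrightarrow> vector_field M (J i X)"
  using acm[of i] by (auto simp: almost_contact_metric_def almost_contact_def endo_field_def)

lemma vector_field_xi: "vector_field M (\<xi> i)"
  using acm[of i] by (auto simp: almost_contact_metric_def almost_contact_def)

lemma smooth_eta: "vector_field M X \<Longrightarrow> smooth_fun M (points M) (\<lambda>q. \<eta> i q (X q))"
  using acm[of i] one_form_iff by (auto simp: almost_contact_metric_def almost_contact_def)

lemma smooth_near_eta: "vector_field M X \<Longrightarrow> p \<in> points M \<Longrightarrow> smooth_near M p (\<lambda>q. \<eta> i q (X q))"
  by (rule smooth_nearI[OF smooth_eta])

lemma cyclic_relations:
  assumes c: "cyclic_triple \<alpha> \<beta> \<gamma>" and p: "p \<in> points M"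
  shows "\<xi> \<gamma> p = \<phi> \<alpha> p (\<xi> \<beta> p)" "\<xi> \<gamma> p = - \<phi> \<beta> p (\<xi> \<alpha> p)"
    and "v \<in> tangent_space M p \<Longrightarrow> \<phi> \<gamma> p v = \<phi> \<alpha> p (\<phi> \<beta> p v) - \<eta> \<beta> p v *\<^sub>R \<xi> \<alpha> p"
    and "v \<in> tangent_space M p \<Longrightarrow> \<phi> \<gamma> p v = - \<phi> \<beta> p (\<phi> \<alpha> p v) + \<eta> \<alpha> p v *\<^sub>R \<xi> \<beta> p"
    and "v \<in> tangent_space M p \<Longrightarrow> \<eta> \<gamma> p v = \<eta> \<alpha> p (\<phi> \<beta> p v)"
    and "v \<in> tangent_space M p \<Longrightarrow> \<eta> \<gamma> p v = - \<eta> \<beta> p (\<phi> \<alpha> p v)"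
proof -
  obtain \<sigma> where \<sigma>: "\<sigma> permutes (UNIV :: 3 set)" "evenperm \<sigma>" "\<sigma> 1 = \<alpha>" "\<sigma> 2 = \<beta>" "\<sigma> 3 = \<gamma>"
    using cyclic_triple_evenperm[OF c] .
  have acm3: "almost_contact_metric_3 M \<phi> \<xi> \<eta> g" using three_sasakian by (simp add: three_sasakian_def)
  have *: "\<xi> \<gamma> p = \<phi> \<alpha> p (\<xi> \<beta> p) \<and> \<xi> \<gamma> p = - \<phi> \<beta> p (\<xi> \<alpha> p) \<and>
           (\<forall>v\<in>tangent_space M p.
              \<phi> \<gamma> p v = \<phi> \<alpha> p (\<phi> \<beta> p v) - \<eta> \<beta> p v *\<^sub>R \<xi> \<alpha> p \<and>
              \<phi> \<gamma> p v = - \<phi> \<beta> p (\<phi> \<alpha> p v) + \<eta> \<alpha> p v *\<^sub>R \<xi> \<beta> p \<and>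
              \<eta> \<gamma> p v = \<eta> \<alpha> p (\<phi> \<beta> p v) \<and>
              \<eta> \<gamma> p v = - \<eta> \<beta> p (\<phi> \<alpha> p v))"
    using conjunct2[OF acm3[unfolded almost_contact_metric_3_def], rule_format, OF \<sigma>(1,2)]
    unfolding Let_def \<sigma>(3-5) using p by blast
  show "\<xi> \<gamma> p = \<phi> \<alpha> p (\<xi> \<beta> p)" using * by (elim conjE)
  show "\<xi> \<gamma> p = - \<phi> \<beta> p (\<xi> \<alpha> p)" using * by (elim conjE)
  assume v: "v \<in> tangent_space M p"
  note ** = bspec[OF conjunct2[OF conjunct2[OF *]] v]
  show "\<phi> \<gamma> p v = \<phi> \<alpha> p (\<phi> \<beta> p v) - \<eta> \<beta> p v *\<^sub>R \<xi> \<alpha> p" using ** by (elim conjE)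
  show "\<phi> \<gamma> p v = - \<phi> \<beta> p (\<phi> \<alpha> p v) + \<eta> \<alpha> p v *\<^sub>R \<xi> \<beta> p" using ** by (elim conjE)
  show "\<eta> \<gamma> p v = \<eta> \<alpha> p (\<phi> \<beta> p v)" using ** by (elim conjE)
  show "\<eta> \<gamma> p v = - \<eta> \<beta> p (\<phi> \<alpha> p v)" using ** by (elim conjE)
qed

lemma eta_bracket:
  assumes "vector_field M X" "vector_field M Y" "p \<in> points M"
  shows "\<eta> i p (bracket X Y p) =
    X p (\<lambda>q. \<eta> i q (Y q)) - Y p (\<lambda>q. \<eta> i q (X q)) - 2 * g p (X p) (\<phi> i p (Y p))"
  using sasakian[of i] assms unfolding sasakian_def ext_deriv1_def fundamental_form_def
  by (force simp: field_simps)

text \<open>The coefficient of \<xi> in the normality tensor is 2 d\<eta>, hence 2\<Omega>; the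
  derivatives of \<eta> have disappeared.\<close>

lemma normal:
  assumes "vector_field M X" "vector_field M Y" "p \<in> points M"
  shows "\<phi> i p (\<phi> i p (bracket X Y p)) + bracket (J i X) (J i Y) p - \<phi> i p (bracket (J i X) Y p)
    - \<phi> i p (bracket X (J i Y) p) + (2 * g p (X p) (\<phi> i p (Y p))) *\<^sub>R \<xi> i p = 0"
proof -
  have eq: "X p (\<lambda>q. \<eta> i q (Y q)) - Y p (\<lambda>q. \<eta> i q (X q)) - \<eta> i p (bracket X Y p)
      = 2 * g p (X p) (\<phi> i p (Y p))"
    using eta_bracket[OF assms, of i] by simp
  have N: "normal_structure M (\<phi> i) (\<xi> i) (\<eta> i)" using sasakian[of i] by (simp add: sasakian_def)
  show ?thesis
    using N[unfolded normal_structure_def Let_def, rule_format, OF assms] unfolding eq .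
qed

text \<open>Normality on the pair \<xi>, Z: every term containing \<phi>\<xi> or \<Omega>(\<xi>,
  \<cdot>) vanishes. What remains says that \<phi> kills the Lie derivative of \<phi> along \<xi>,
  applied to Z.\<close>

lemma phi_bracket_xi:
  assumes Z: "vector_field M Z" and p: "p \<in> points M"
  shows "\<phi> i p (bracket (\<xi> i) (J i Z) p) = \<phi> i p (\<phi> i p (bracket (\<xi> i) Z p))"
proof -
  interpret a: acm_subspace "tangent_space M p" "mdim M" "g p" "\<phi> i p" "\<xi> i p" "\<eta> i p"
    by (rule acm_at[OF p])
  note \<xi> = vector_field_xi[of i]
  have J\<xi>: "bracket (J i (\<xi> i)) Y p = 0" if Y: "vector_field M Y" for Y
  proof -
    have "bracket (J i (\<xi> i)) Y p = bracket (\<lambda>q. 0 *\<^sub>R \<xi> i q) Y p"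
      by (rule lie_bracket_cong[OF vector_field_J[OF \<xi>] vector_field_scaleR[OF \<xi>] Y Y p])
        (simp_all add: acm_subspace.phi_xi[OF acm_at])
    then show ?thesis using lie_bracket_scaleR_left[OF \<xi> Y p, of 0] by simp
  qed
  have "g p (\<xi> i p) (\<phi> i p (Z p)) = 0"
    using a.g_xi[of "\<phi> i p (Z p)"] a.g_sym[of "\<xi> i p" "\<phi> i p (Z p)"] vector_field_tangent[OF Z p] by simp
  then show ?thesis
    using normal[OF \<xi> Z p, of i] J\<xi>[OF Z] J\<xi>[OF vector_field_J[OF Z]] by simp
qed

text \<open>The coefficient of \<xi>_\<alpha> left over in \<open>mixed_normal\<close>. All six
  brackets are expanded by \<open>eta_bracket\<close>; the derivatives cancel by the relations
  between \<eta>_i and \<phi>_j, the metric terms by compatibility of \<phi>_\<beta> and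
  \<phi>_\<gamma>.\<close>

lemma mixed_eta_bracket:
  assumes c: "cyclic_triple \<alpha> \<beta> \<gamma>"
    and X: "vector_field M X" and Y: "vector_field M Y" and p: "p \<in> points M"
  shows "\<eta> \<alpha> p (bracket (J \<gamma> X) (J \<beta> Y) p) + \<eta> \<alpha> p (bracket (J \<beta> X) (J \<gamma> Y) p)
    + \<eta> \<beta> p (bracket (J \<beta> X) Y p) + \<eta> \<beta> p (bracket X (J \<beta> Y) p)
    = \<eta> \<gamma> p (bracket (J \<gamma> X) Y p) + \<eta> \<gamma> p (bracket X (J \<gamma> Y) p)"
proof -
  interpret a: acm_subspace "tangent_space M p" "mdim M" "g p" "\<phi> \<alpha> p" "\<xi> \<alpha> p" "\<eta> \<alpha> p"
    by (rule acm_at[OF p])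
  interpret b: acm_subspace "tangent_space M p" "mdim M" "g p" "\<phi> \<beta> p" "\<xi> \<beta> p" "\<eta> \<beta> p"
    by (rule acm_at[OF p])
  interpret c: acm_subspace "tangent_space M p" "mdim M" "g p" "\<phi> \<gamma> p" "\<xi> \<gamma> p" "\<eta> \<gamma> p"
    by (rule acm_at[OF p])
  \<comment> \<open>\<open>rel'\<close> holds the relations of the triple (\<gamma>, \<alpha>,
    \<beta>).\<close>
  note rel = cyclic_relations[OF c] and rel' = cyclic_relations[OF cyclic_triple_rotate[OF cyclic_triple_rotate[OF c]]]
  note J = vector_field_J
  have T [simp]: "X p \<in> tangent_space M p" "Y p \<in> tangent_space M p"
    using X Y p by (auto intro: vector_field_tangent)
  have cong: "Z p f = Z p h" if "vector_field M Z" "\<And>q. q \<in> points M \<Longrightarrow> f q = h q" for Z f h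
    by (rule tangent_cong[OF vector_field_tangent[OF that(1) p] open_points p that(2)])
  have \<beta>: "Z p (\<lambda>q. \<eta> \<alpha> q (\<phi> \<beta> q (U q))) = Z p (\<lambda>q. \<eta> \<gamma> q (U q))"
    if "vector_field M Z" "vector_field M U" for Z U
    by (rule cong[OF that(1)]) (simp add: rel(5) vector_field_tangent[OF that(2)])
  have \<gamma>: "Z p (\<lambda>q. \<eta> \<alpha> q (\<phi> \<gamma> q (U q))) = - Z p (\<lambda>q. \<eta> \<beta> q (U q))"
    if Z: "vector_field M Z" and U: "vector_field M U" for Z U
  proof -
    have "Z p (\<lambda>q. \<eta> \<alpha> q (\<phi> \<gamma> q (U q))) = Z p (\<lambda>q. - 1 * \<eta> \<beta> q (U q))"
      by (rule cong[OF Z]) (simp add: rel'(6) vector_field_tangent[OF U])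
    also have "\<dots> = - 1 * Z p (\<lambda>q. \<eta> \<beta> q (U q))"
      by (rule tangent_cmult[OF vector_field_tangent[OF Z p] smooth_near_eta[OF U p]])
    finally show ?thesis by simp
  qed
  have zero: "Z p (\<lambda>q. \<eta> i q (\<phi> i q (U q))) = 0"
    if Z: "vector_field M Z" and U: "vector_field M U" for Z U i
  proof -
    have "Z p (\<lambda>q. \<eta> i q (\<phi> i q (U q))) = Z p (\<lambda>q. 0)"
      by (rule cong[OF Z]) (simp add: acm_subspace.eta_phi[OF acm_at] vector_field_tangent[OF U])
    then show ?thesis using tangent_const[OF vector_field_tangent[OF Z p] p] by simp
  qed
  \<comment> \<open>Composites are reduced to a single \<phi>; the correction along \<xi>_\<alpha>
    is paired by g(\<cdot>, \<xi>_\<alpha>) = \<eta>_\<alpha>.\<close>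
  have g1: "g p (\<phi> \<gamma> p (X p)) (\<phi> \<alpha> p (\<phi> \<beta> p (Y p)))
      = g p (\<phi> \<gamma> p (X p)) (\<phi> \<gamma> p (Y p)) - \<eta> \<beta> p (Y p) * \<eta> \<beta> p (X p)"
  proof -
    have "\<phi> \<alpha> p (\<phi> \<beta> p (Y p)) = \<phi> \<gamma> p (Y p) + \<eta> \<beta> p (Y p) *\<^sub>R \<xi> \<alpha> p"
      using rel(3)[OF p T(2)] by simp
    then show ?thesis
      using rel'(6)[OF p T(1)] by (simp add: a.g_add_right a.g_scale_right a.g_xi)
  qed
  have g2: "g p (\<phi> \<beta> p (X p)) (\<phi> \<alpha> p (\<phi> \<gamma> p (Y p)))
      = - g p (\<phi> \<beta> p (X p)) (\<phi> \<beta> p (Y p)) + \<eta> \<gamma> p (Y p) * \<eta> \<gamma> p (X p)"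
  proof -
    have "\<phi> \<alpha> p (\<phi> \<gamma> p (Y p)) = \<eta> \<gamma> p (Y p) *\<^sub>R \<xi> \<alpha> p - \<phi> \<beta> p (Y p)"
      using rel'(4)[OF p T(2)] by simp
    then show ?thesis
      using rel(5)[OF p T(1)] by (simp add: a.g_diff_right a.g_scale_right a.g_xi)
  qed
  have g3: "g p (X p) (\<phi> i p (\<phi> i p (Y p))) = - g p (\<phi> i p (X p)) (\<phi> i p (Y p))" for i
    using acm_subspace.g_phi_left[OF acm_at[OF p], of "X p" "\<phi> i p (Y p)" i] acm_subspace.phi_V[OF acm_at[OF p]]
    by simp
  show ?thesis
    unfolding eta_bracket[OF J[OF X] J[OF Y] p] eta_bracket[OF J[OF X] Y p] eta_bracket[OF X J[OF Y] p]
      \<beta>[OF J[OF X] Y] \<beta>[OF J[OF Y] X] \<gamma>[OF J[OF X] Y] \<gamma>[OF J[OF Y] X] zero[OF X Y] zero[OF Y X] g1 g2 g3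
    using b.compatible[OF T] c.compatible[OF T] by (simp add: algebra_simps)
qed

text \<open>On the cone over \<open>M\<close> the structures become anticommuting almost complex structures
  \<open>I, J, K = IJ\<close>, whose mixed Nijenhuis tensor of \<open>J\<close> and \<open>K\<close> is obtained by comparing two
  expressions for \<open>[KX, KY] = [IJX, IJY]\<close>. The proof carries out this comparison on \<open>M\<close>.\<close>

lemma mixed_normal:
  assumes c: "cyclic_triple \<alpha> \<beta> \<gamma>"
    and X: "vector_field M X" and Y: "vector_field M Y" and p: "p \<in> points M"
  shows "\<phi> \<beta> p (\<phi> \<gamma> p (bracket X Y p)) + \<phi> \<gamma> p (\<phi> \<beta> p (bracket X Y p))
    + (bracket (J \<gamma> X) (J \<beta> Y) p + bracket (J \<beta> X) (J \<gamma> Y) p)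
    - \<phi> \<beta> p (bracket (J \<gamma> X) Y p + bracket X (J \<gamma> Y) p)
    - \<phi> \<gamma> p (bracket (J \<beta> X) Y p + bracket X (J \<beta> Y) p)
    + (2 * g p (X p) (\<phi> \<gamma> p (Y p))) *\<^sub>R \<xi> \<beta> p + (2 * g p (X p) (\<phi> \<beta> p (Y p))) *\<^sub>R \<xi> \<gamma> p = 0"
proof -
  interpret a: acm_subspace "tangent_space M p" "mdim M" "g p" "\<phi> \<alpha> p" "\<xi> \<alpha> p" "\<eta> \<alpha> p"
    by (rule acm_at[OF p])
  interpret b: acm_subspace "tangent_space M p" "mdim M" "g p" "\<phi> \<beta> p" "\<xi> \<beta> p" "\<eta> \<beta> p"
    by (rule acm_at[OF p])
  interpret c: acm_subspace "tangent_space M p" "mdim M" "g p" "\<phi> \<gamma> p" "\<xi> \<gamma> p" "\<eta> \<gamma> p"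
    by (rule acm_at[OF p])
  note rel = cyclic_relations[OF c] and rel' = cyclic_relations[OF cyclic_triple_rotate[OF cyclic_triple_rotate[OF c]] p]
  note J = vector_field_J and \<xi> = vector_field_xi[of \<alpha>]
  note X2 = J[OF X, of \<beta>] and Y2 = J[OF Y, of \<beta>] and X3 = J[OF X, of \<gamma>] and Y3 = J[OF Y, of \<gamma>]
  note T [simp] = lie_bracket_tangent[OF _ _ p]
  note [simp del] = plus_fun_apply minus_apply uminus_apply
  let ?a = "\<phi> \<alpha> p" and ?b = "\<phi> \<beta> p" and ?c = "\<phi> \<gamma> p" and ?\<xi> = "\<xi> \<alpha> p"
  \<comment> \<open>Substituting for \<phi>_\<gamma> under the bracket costs a Leibniz term along
    \<xi>_\<alpha>, which \<phi>_\<alpha> removes in \<open>phi_left\<close> and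
    \<open>phi_right\<close>.\<close>
  have left: "bracket (J \<gamma> U) Z p = bracket (J \<alpha> (J \<beta> U)) Z p
      - (\<eta> \<beta> p (U p) *\<^sub>R bracket (\<xi> \<alpha>) Z p - Z p (\<lambda>q. \<eta> \<beta> q (U q)) *\<^sub>R ?\<xi>)"
    if U: "vector_field M U" and Z: "vector_field M Z" for U Z
  proof -
    note m = vector_field_mult[OF smooth_eta[OF U, of \<beta>] \<xi>] and U2 = J[OF J[OF U, of \<beta>], of \<alpha>]
    have "bracket (J \<gamma> U) Z p
        = bracket (\<lambda>q. \<phi> \<alpha> q (\<phi> \<beta> q (U q)) - \<eta> \<beta> q (U q) *\<^sub>R \<xi> \<alpha> q) Z p"
      by (rule lie_bracket_cong[OF J[OF U] vector_field_diff[OF U2 m] Z Z p])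
        (simp_all add: rel(3) vector_field_tangent[OF U])
    also have "\<dots> = bracket (J \<alpha> (J \<beta> U)) Z p - bracket (\<lambda>q. \<eta> \<beta> q (U q) *\<^sub>R \<xi> \<alpha> q) Z p"
      by (rule lie_bracket_diff_left[OF U2 m Z p])
    finally show ?thesis unfolding lie_bracket_mult_left[OF smooth_eta[OF U] \<xi> Z p] .
  qed
  have phi_left: "?a (bracket (J \<gamma> U) Z p)
      = ?a (bracket (J \<alpha> (J \<beta> U)) Z p) - \<eta> \<beta> p (U p) *\<^sub>R ?a (bracket (\<xi> \<alpha>) Z p)"
    if U: "vector_field M U" and Z: "vector_field M Z" for U Z
    unfolding left[OF U Z] using U Z \<xi> J by (simp add: a.phi_diff a.phi_scale)
  have phi_right: "?a (bracket Z (J \<gamma> U) p)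
      = ?a (bracket Z (J \<alpha> (J \<beta> U)) p) + \<eta> \<beta> p (U p) *\<^sub>R ?a (bracket (\<xi> \<alpha>) Z p)"
    if U: "vector_field M U" and Z: "vector_field M Z" for U Z
    unfolding lie_bracket_skew[of Z] using phi_left[OF U Z] U Z \<xi> J
    by (simp add: a.phi_minus)
  have \<xi>\<xi>: "bracket (\<xi> \<alpha>) (\<xi> \<alpha>) p = 0"
    by (simp add: lie_bracket_def fun_eq_iff)
  let ?L = "bracket X Y p" and ?W = "bracket (J \<gamma> X) (J \<beta> Y) p + bracket (J \<beta> X) (J \<gamma> Y) p"
    and ?B3 = "bracket (J \<gamma> X) Y p + bracket X (J \<gamma> Y) p"
    and ?B2 = "bracket (J \<beta> X) Y p + bracket X (J \<beta> Y) p"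
    and ?\<Omega>2 = "2 * g p (X p) (\<phi> \<beta> p (Y p))" and ?\<Omega>3 = "2 * g p (X p) (\<phi> \<gamma> p (Y p))"
  have "?a (bracket (J \<gamma> X) (J \<gamma> Y) p) = ?a (bracket (J \<alpha> (J \<beta> X)) (J \<gamma> Y) p)
      - \<eta> \<beta> p (X p) *\<^sub>R ?a (bracket (\<xi> \<alpha>) (J \<gamma> Y) p)"
    by (rule phi_left[OF X Y3])
  also have "?a (bracket (J \<alpha> (J \<beta> X)) (J \<gamma> Y) p)
      = ?a (bracket (J \<alpha> (J \<beta> X)) (J \<alpha> (J \<beta> Y)) p) + \<eta> \<beta> p (Y p) *\<^sub>R ?a (bracket (\<xi> \<alpha>) (J \<alpha> (J \<beta> X)) p)"
    by (rule phi_right[OF Y J[OF X2]])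
  also have "?a (bracket (\<xi> \<alpha>) (J \<gamma> Y) p) = ?a (bracket (\<xi> \<alpha>) (J \<alpha> (J \<beta> Y)) p)"
    using phi_right[OF Y \<xi>] by (simp add: \<xi>\<xi>)
  \<comment> \<open>Normality of \<phi>_\<alpha> on \<open>J \<beta> X\<close> and
    \<open>J \<beta> Y\<close>, with \<phi>_\<alpha> applied: the \<xi>_\<alpha> term dies and the
    cube of \<phi>_\<alpha> is its negative.\<close>
  also have "?a (bracket (J \<alpha> (J \<beta> X)) (J \<alpha> (J \<beta> Y)) p)
      = ?a (?a (bracket (J \<alpha> (J \<beta> X)) (J \<beta> Y) p)) + ?a (?a (bracket (J \<beta> X) (J \<alpha> (J \<beta> Y)) p))
        + ?a (bracket (J \<beta> X) (J \<beta> Y) p)"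
  proof -
    have eq: "bracket (J \<alpha> (J \<beta> X)) (J \<alpha> (J \<beta> Y)) p
        = ?a (bracket (J \<alpha> (J \<beta> X)) (J \<beta> Y) p) + ?a (bracket (J \<beta> X) (J \<alpha> (J \<beta> Y)) p)
          - ?a (?a (bracket (J \<beta> X) (J \<beta> Y) p)) - (2 * g p (J \<beta> X p) (?a (J \<beta> Y p))) *\<^sub>R ?\<xi>"
      using normal[OF X2 Y2 p, of \<alpha>] by (simp add: algebra_simps)
    have cube: "?a (?a (?a (bracket (J \<beta> X) (J \<beta> Y) p))) = - ?a (bracket (J \<beta> X) (J \<beta> Y) p)"
      using X2 Y2 by (subst a.phi_phi) simp_all
    show ?thesis
      unfolding eq using X2 Y2 J[OF X2, of \<alpha>] J[OF Y2, of \<alpha>]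
      by (simp only: a.phi_diff a.phi_add a.phi_scale a.phi_xi cube T a.phi_V a.V_simps a.xi_V) simp
  qed
  also have "?a (bracket (\<xi> \<alpha>) (J \<alpha> (J \<beta> X)) p) = ?a (?a (bracket (\<xi> \<alpha>) (J \<beta> X) p))"
    by (rule phi_bracket_xi[OF X2 p])
  also have "?a (bracket (\<xi> \<alpha>) (J \<alpha> (J \<beta> Y)) p) = ?a (?a (bracket (\<xi> \<alpha>) (J \<beta> Y) p))"
    by (rule phi_bracket_xi[OF Y2 p])
  finally have main: "?a (bracket (J \<gamma> X) (J \<gamma> Y) p)
      = ?a (?a (bracket (J \<alpha> (J \<beta> X)) (J \<beta> Y) p)) + ?a (?a (bracket (J \<beta> X) (J \<alpha> (J \<beta> Y)) p))
        + ?a (bracket (J \<beta> X) (J \<beta> Y) p)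
        + \<eta> \<beta> p (Y p) *\<^sub>R ?a (?a (bracket (\<xi> \<alpha>) (J \<beta> X) p))
        - \<eta> \<beta> p (X p) *\<^sub>R ?a (?a (bracket (\<xi> \<alpha>) (J \<beta> Y) p))" .
  have regroup: "x = (y1 - z5) + (y2 + z4) + y3" if "x = y1 + y2 + y3 + z4 - z5"
    for x y1 y2 y3 z4 z5 :: "'a tvec"
    unfolding that by (simp only: add_ac diff_conv_add_uminus)
  \<comment> \<open>Regrouped so that each correction joins the bracket it came from;
    \<open>phi_left\<close> and \<open>phi_right\<close>, read backwards, then restore
    \<open>J \<gamma>\<close>.\<close>
  have "?a (bracket (J \<gamma> X) (J \<gamma> Y) p)
      = ?a (?a (bracket (J \<alpha> (J \<beta> X)) (J \<beta> Y) p) - \<eta> \<beta> p (X p) *\<^sub>R ?a (bracket (\<xi> \<alpha>) (J \<beta> Y) p))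
      + ?a (?a (bracket (J \<beta> X) (J \<alpha> (J \<beta> Y)) p) + \<eta> \<beta> p (Y p) *\<^sub>R ?a (bracket (\<xi> \<alpha>) (J \<beta> X) p))
      + ?a (bracket (J \<beta> X) (J \<beta> Y) p)"
    using regroup[OF main] X2 Y2 J[OF X2, of \<alpha>] J[OF Y2, of \<alpha>] \<xi>
    by (simp only: a.phi_diff a.phi_add a.phi_scale T a.phi_V a.V_simps)
  then have "?a (bracket (J \<gamma> X) (J \<gamma> Y) p) = ?a (?a ?W) + ?a (bracket (J \<beta> X) (J \<beta> Y) p)"
    unfolding phi_left[OF X Y2, symmetric] phi_right[OF Y X2, symmetric]
    using X2 Y2 X3 Y3 by (simp add: a.phi_add)
  \<comment> \<open>The second expression, from normality of \<phi>_\<gamma> itself; normality of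
    \<phi>_\<beta> then treats the remaining bracket.\<close>
  moreover have "?a (bracket (J \<gamma> X) (J \<gamma> Y) p)
      = - ?b ?B3 + \<eta> \<gamma> p ?B3 *\<^sub>R ?\<xi> + ?b (?c ?L) + ?\<Omega>3 *\<^sub>R \<xi> \<beta> p"
  proof -
    have ac: "?a (?c v) = - ?b v + \<eta> \<gamma> p v *\<^sub>R ?\<xi>" if "v \<in> tangent_space M p" for v
      using rel'(4)[OF that] by simp
    have "bracket (J \<gamma> X) (J \<gamma> Y) p = ?c ?B3 - ?c (?c ?L) - ?\<Omega>3 *\<^sub>R \<xi> \<gamma> p"
      using normal[OF X Y p, of \<gamma>] X Y X3 Y3 by (simp add: c.phi_add algebra_simps)
    then have "?a (bracket (J \<gamma> X) (J \<gamma> Y) p) = ?a (?c ?B3) - ?a (?c (?c ?L)) - ?\<Omega>3 *\<^sub>R ?a (\<xi> \<gamma> p)"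
      using X Y X3 Y3 by (simp add: a.phi_diff a.phi_scale)
    also have "?a (\<xi> \<gamma> p) = - \<xi> \<beta> p" using rel'(2) by simp
    finally show ?thesis using X Y X3 Y3 by (simp add: ac)
  qed
  moreover have "?a (bracket (J \<beta> X) (J \<beta> Y) p)
      = ?c ?B2 + \<eta> \<beta> p ?B2 *\<^sub>R ?\<xi> - ?c (?b ?L) - ?\<Omega>2 *\<^sub>R \<xi> \<gamma> p"
  proof -
    have ab: "?a (?b v) = ?c v + \<eta> \<beta> p v *\<^sub>R ?\<xi>" if "v \<in> tangent_space M p" for v
      using rel(3)[OF p that] by simp
    have "bracket (J \<beta> X) (J \<beta> Y) p = ?b ?B2 - ?b (?b ?L) - ?\<Omega>2 *\<^sub>R \<xi> \<beta> p"
      using normal[OF X Y p, of \<beta>] X Y X2 Y2 by (simp add: b.phi_add algebra_simps)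
    then have "?a (bracket (J \<beta> X) (J \<beta> Y) p) = ?a (?b ?B2) - ?a (?b (?b ?L)) - ?\<Omega>2 *\<^sub>R ?a (\<xi> \<beta> p)"
      using X Y X2 Y2 by (simp add: a.phi_diff a.phi_scale)
    also have "?a (\<xi> \<beta> p) = \<xi> \<gamma> p" using rel(1)[OF p] by simp
    finally show ?thesis using X Y X2 Y2 by (simp add: ab)
  qed
  moreover have "?a (?a ?W) = - ?W + \<eta> \<alpha> p ?W *\<^sub>R ?\<xi>"
    using X2 Y2 X3 Y3 by (intro a.phi_phi) simp
  moreover have "l3 + l2 + w - b3 - b2 + o3 + o2 = rw + r2 - r3"
    if "x = u + y" "x = - b3 + r3 + l3 + o3" "y = b2 + r2 - l2 - o2" "u = - w + rw"
    for x u y w b2 b3 l2 l3 o2 o3 r2 r3 rw :: "'a tvec"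
  proof -
    have "(l3 + l2 + w - b3 - b2 + o3 + o2) - (rw + r2 - r3)
        = (- b3 + r3 + l3 + o3) - ((- w + rw) + (b2 + r2 - l2 - o2))"
      by (simp add: algebra_simps)
    also have "\<dots> = 0" using that by (simp only: diff_self)
    finally show ?thesis by simp
  qed
  ultimately have "?b (?c ?L) + ?c (?b ?L) + ?W - ?b ?B3 - ?c ?B2 + ?\<Omega>3 *\<^sub>R \<xi> \<beta> p + ?\<Omega>2 *\<^sub>R \<xi> \<gamma> p
      = \<eta> \<alpha> p ?W *\<^sub>R ?\<xi> + \<eta> \<beta> p ?B2 *\<^sub>R ?\<xi> - \<eta> \<gamma> p ?B3 *\<^sub>R ?\<xi>"
    by blast
  also have "\<dots> = (\<eta> \<alpha> p ?W + \<eta> \<beta> p ?B2 - \<eta> \<gamma> p ?B3) *\<^sub>R ?\<xi>"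
    by (simp only: scaleR_add_left scaleR_diff_left)
  also have "\<eta> \<alpha> p ?W + \<eta> \<beta> p ?B2 - \<eta> \<gamma> p ?B3 = 0"
    using mixed_eta_bracket[OF c X Y p] X Y X2 Y2 X3 Y3
    by (simp add: a.eta_add b.eta_add c.eta_add)
  also have "0 *\<^sub>R ?\<xi> = 0" by (rule scaleR_zero_left)
  finally show ?thesis .
qed

end

section \<open>The sphere of structures on a vector space\<close>

text \<open>Serves all quadratic identities on the sphere: compatibility, the square of
  \<phi>_\<lambda> and normality.\<close>

lemma antisymmetric_quadratic_sum:
  fixes N :: "'i \<Rightarrow> 'i \<Rightarrow> 'b::real_vector"
  assumes "\<And>i j. N i j + N j i = 0"
  shows "(\<Sum>i\<in>I. \<Sum>j\<in>I. (c i * c j) *\<^sub>R N i j) = 0"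
proof -
  let ?S = "\<Sum>i\<in>I. \<Sum>j\<in>I. (c i * c j) *\<^sub>R N i j"
  have "?S = (\<Sum>i\<in>I. \<Sum>j\<in>I. (c i * c j) *\<^sub>R N j i)"
    by (subst sum.swap) (simp add: mult.commute)
  then have "?S + ?S = (\<Sum>i\<in>I. \<Sum>j\<in>I. (c i * c j) *\<^sub>R (N i j + N j i))"
    by (simp add: sum.distrib scaleR_add_right)
  then have "2 *\<^sub>R ?S = 0" by (simp add: assms scaleR_2)
  then show ?thesis by simp
qed

lemma sum_squares_sphere:
  fixes l :: "real ^ 3"
  assumes "l \<in> sphere 0 1"
  shows "(\<Sum>i\<in>UNIV. l $ i * l $ i) = 1"
  using assms by (simp add: norm_eq_1 inner_vec_def)

context acm_subspace
begin

lemma phi_sum: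
  "(\<And>i. i \<in> I \<Longrightarrow> x i \<in> V) \<Longrightarrow> \<phi> (\<Sum>i\<in>I. a i *\<^sub>R x i) = (\<Sum>i\<in>I. a i *\<^sub>R \<phi> (x i))"
proof (induction I rule: infinite_finite_induct)
  case (insert i I)
  then have "(\<Sum>i\<in>I. a i *\<^sub>R x i) \<in> V" by (intro V_sum) auto
  with insert show ?case by (simp add: phi_add phi_scale)
qed simp_all

lemma eta_sum:
  "(\<And>i. i \<in> I \<Longrightarrow> x i \<in> V) \<Longrightarrow> \<eta> (\<Sum>i\<in>I. a i *\<^sub>R x i) = (\<Sum>i\<in>I. a i * \<eta> (x i))"
proof (induction I rule: infinite_finite_induct)
  case (insert i I)
  then have "(\<Sum>i\<in>I. a i *\<^sub>R x i) \<in> V" by (intro V_sum) auto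
  with insert show ?case by (simp add: eta_add eta_scale)
qed simp_all

lemma g_sum_right:
  "(\<And>i. i \<in> I \<Longrightarrow> x i \<in> V) \<Longrightarrow> w \<in> V \<Longrightarrow> g w (\<Sum>i\<in>I. a i *\<^sub>R x i) = (\<Sum>i\<in>I. a i * g w (x i))"
proof (induction I rule: infinite_finite_induct)
  case (insert i I)
  then have "(\<Sum>i\<in>I. a i *\<^sub>R x i) \<in> V" by (intro V_sum) auto
  with insert show ?case by (simp add: g_add_right g_scale_right)
qed (simp_all add: g_sym[of w 0])

abbreviation Omega :: "'v \<Rightarrow> 'v \<Rightarrow> real" where
  "Omega u v \<equiv> g u (\<phi> v)"

lemma eta_multilinear: "multilinear_on V 1 (uncurry1 \<eta>)"
  unfolding uncurry1_multilinear_iff[OF V] by (simp add: eta_linear)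

lemma Omega_alternating: "alternating_on V 2 (uncurry2 Omega)"
  unfolding alternating_on_def multilinear_on_def uncurry2_def
  by (auto simp: less_2_cases_iff phi_linear g_linear g_phi_self g_add_right g_scale_right)

definition volume :: "(nat \<Rightarrow> 'v) \<Rightarrow> real" where
  "volume = wedge 1 (2 * (n div 2)) (uncurry1 \<eta>) (wedge_power 2 (uncurry2 Omega) (n div 2))"

lemma n_eq: "1 + 2 * (n div 2) = n"
  using odd_dimension by presburger

lemma volume_alternating: "alternating_on V n volume"
proof -
  have O: "multilinear_on V 2 (uncurry2 Omega)" using Omega_alternating by (simp add: alternating_on_def)
  have "multilinear_on V (2 * (n div 2)) (wedge_power 2 (uncurry2 Omega) (n div 2))"
    using wedge_power_alternating[OF V O] by (simp add: alternating_on_def)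
  from wedge_alternating[OF V eta_multilinear this] show ?thesis unfolding volume_def n_eq .
qed

lemma volume_nonzero: "\<exists>v. (\<forall>i. v i \<in> V) \<and> volume v \<noteq> 0"
proof -
  obtain f where f: "adapted (n div 2) f" "\<And>i. f i \<in> V" using adapted_basis by blast
  have "volume f = std_volume (n div 2)" unfolding volume_def by (rule volume_adapted[OF f(1)])
  with f(2) std_volume_pos[of "n div 2"] show ?thesis by (intro exI[of _ f]) auto
qed

lemma volume_orthonormal:
  assumes "orthonormal n e" "\<And>i. e i \<in> V"
  shows "volume e \<in> {std_volume (n div 2), - std_volume (n div 2)}"
proof -
  obtain f where f: "adapted (n div 2) f" "orthonormal n f" "\<And>i. f i \<in> V"
    using adapted_basis by blast
  have "volume f = std_volume (n div 2)" unfolding volume_def by (rule volume_adapted[OF f(1)])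
  moreover have "(volume e)\<^sup>2 = (volume f)\<^sup>2"
    by (rule alternating_on_square_eq[OF volume_alternating assms f(2,3)])
  ultimately show ?thesis by (simp add: power2_eq_iff)
qed

end

lemma wedge_uncurry_cong:
  assumes "\<And>i. v i \<in> V"
    and "\<And>u. u \<in> V \<Longrightarrow> \<alpha> u = \<alpha>' u" "\<And>u w. u \<in> V \<Longrightarrow> w \<in> V \<Longrightarrow> \<beta> u w = \<beta>' u w"
  shows "wedge 1 (2 * m) (uncurry1 \<alpha>) (wedge_power 2 (uncurry2 \<beta>) m) v
    = wedge 1 (2 * m) (uncurry1 \<alpha>') (wedge_power 2 (uncurry2 \<beta>') m) v"
  unfolding wedge_uncurry1_wedge_power alternation_def by (simp add: assms)

text \<open>The cyclic relations enter only through consequences valid for any two distinct indices,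
  which is the form that double sums over all indices require.\<close>

locale acm3_subspace = inner_product_subspace V n g
  for V :: "'v::real_vector set" and n g +
  fixes \<phi> :: "3 \<Rightarrow> 'v \<Rightarrow> 'v" and \<xi> :: "3 \<Rightarrow> 'v" and \<eta> :: "3 \<Rightarrow> 'v \<Rightarrow> real"
  assumes acm_i: "acm_subspace V n g (\<phi> i) (\<xi> i) (\<eta> i)"
    and anticommute: "i \<noteq> j \<Longrightarrow> v \<in> V \<Longrightarrow>
      \<phi> i (\<phi> j v) + \<phi> j (\<phi> i v) = \<eta> j v *\<^sub>R \<xi> i + \<eta> i v *\<^sub>R \<xi> j"
    and eta_xi_neq: "i \<noteq> j \<Longrightarrow> \<eta> i (\<xi> j) = 0"
begin

definition Phi :: "real ^ 3 \<Rightarrow> 'v \<Rightarrow> 'v" where "Phi l u = (\<Sum>i\<in>UNIV. l $ i *\<^sub>R \<phi> i u)"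
definition Xi :: "real ^ 3 \<Rightarrow> 'v" where "Xi l = (\<Sum>i\<in>UNIV. l $ i *\<^sub>R \<xi> i)"
definition Eta :: "real ^ 3 \<Rightarrow> 'v \<Rightarrow> real" where "Eta l u = (\<Sum>i\<in>UNIV. l $ i * \<eta> i u)"

lemma eta_xi_ij: "\<eta> i (\<xi> j) = (if i = j then 1 else 0)"
  using acm_subspace.eta_xi[OF acm_i] eta_xi_neq by simp

lemma phi_i_V [simp]: "u \<in> V \<Longrightarrow> \<phi> i u \<in> V" and xi_i_V [simp]: "\<xi> i \<in> V"
  using acm_subspace.phi_V[OF acm_i] acm_subspace.xi_V[OF acm_i] by auto

lemma anticommute_general:
  assumes "v \<in> V"
  shows "\<phi> i (\<phi> j v) + \<phi> j (\<phi> i v)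
    = \<eta> j v *\<^sub>R \<xi> i + \<eta> i v *\<^sub>R \<xi> j - (if i = j then 2 else 0) *\<^sub>R v"
  using anticommute[OF _ assms, of i j] acm_subspace.phi_phi[OF acm_i assms, of i]
  by (cases "i = j") (simp_all add: scaleR_2)

lemma Phi_acm_subspace:
  assumes l: "l \<in> sphere 0 1"
  shows "acm_subspace V n g (Phi l) (Xi l) (Eta l)"
proof unfold_locales
  note diag = sum_squares_sphere[OF l]
  fix u v a b assume u: "u \<in> V" and v: "v \<in> V"
  show "Phi l (a *\<^sub>R u + b *\<^sub>R v) = a *\<^sub>R Phi l u + b *\<^sub>R Phi l v"
    unfolding Phi_def acm_subspace.phi_linear[OF acm_i u v]
    by (simp add: scaleR_add_right scaleR_sum_right sum.distrib mult.commute)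
  show "Eta l (a *\<^sub>R u + b *\<^sub>R v) = a * Eta l u + b * Eta l v"
    unfolding Eta_def acm_subspace.eta_linear[OF acm_i u v]
    by (simp add: algebra_simps sum_distrib_left sum.distrib)
  \<comment> \<open>The diagonal entries carry the right-hand side: weighted with the squares of the
    coordinates of \<open>l\<close>, they add up to \<open>g u v\<close> on the unit sphere.\<close>
  have "(\<Sum>i\<in>UNIV. \<Sum>j\<in>UNIV. (l $ i * l $ j) *\<^sub>R
      (g (\<phi> i u) (\<phi> j v) + \<eta> i u * \<eta> j v - (if i = j then g u v else 0))) = 0"
  proof (rule antisymmetric_quadratic_sum)
    fix i j
    have "g (\<phi> i u) (\<phi> j v) + g (\<phi> j u) (\<phi> i v) = - g u (\<phi> i (\<phi> j v) + \<phi> j (\<phi> i v))"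
      using u v by (simp add: acm_subspace.g_phi_left[OF acm_i] g_add_right)
    also have "\<dots> = - (\<eta> j v * \<eta> i u + \<eta> i v * \<eta> j u - (if i = j then 2 else 0) * g u v)"
      unfolding anticommute_general[OF v]
      using u v by (simp only: g_add_right g_diff_right g_scale_right V_simps xi_i_V acm_subspace.g_xi[OF acm_i u])
    finally show "(g (\<phi> i u) (\<phi> j v) + \<eta> i u * \<eta> j v - (if i = j then g u v else 0))
      + (g (\<phi> j u) (\<phi> i v) + \<eta> j u * \<eta> i v - (if j = i then g u v else 0)) = 0"
      by (cases "i = j") (simp_all add: algebra_simps)
  qed
  then have "(\<Sum>i\<in>UNIV. \<Sum>j\<in>UNIV. (l $ i * l $ j) * g (\<phi> i u) (\<phi> j v))
      + (\<Sum>i\<in>UNIV. \<Sum>j\<in>UNIV. (l $ i * \<eta> i u) * (l $ j * \<eta> j v)) = (\<Sum>i\<in>UNIV. l $ i * l $ i) * g u v"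
    by (simp add: algebra_simps sum.distrib sum_subtractf sum_distrib_left if_distrib[of "\<lambda>x. _ * x"] cong: if_cong)
  moreover have "g (Phi l u) (Phi l v) = (\<Sum>i\<in>UNIV. \<Sum>j\<in>UNIV. (l $ i * l $ j) * g (\<phi> i u) (\<phi> j v))"
    unfolding Phi_def using u v
    by (subst g_sum_left)
      (simp_all add: acm_subspace.g_sum_right[OF acm_i] V_sum sum_distrib_left mult.assoc)
  ultimately show "g (Phi l u) (Phi l v) = g u v - Eta l u * Eta l v"
    unfolding Eta_def sum_product diag by simp
next
  note diag = sum_squares_sphere[OF l]
  fix u assume u: "u \<in> V"
  show "Phi l u \<in> V" unfolding Phi_def using u by (intro V_sum) simp
  have "(\<Sum>i\<in>UNIV. \<Sum>j\<in>UNIV. (l $ i * l $ j) *\<^sub>R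
      (\<phi> i (\<phi> j u) - \<eta> j u *\<^sub>R \<xi> i + (if i = j then 1 else 0) *\<^sub>R u)) = 0"
  proof (rule antisymmetric_quadratic_sum)
    fix i j
    show "(\<phi> i (\<phi> j u) - \<eta> j u *\<^sub>R \<xi> i + (if i = j then 1 else 0) *\<^sub>R u)
      + (\<phi> j (\<phi> i u) - \<eta> i u *\<^sub>R \<xi> j + (if j = i then 1 else 0) *\<^sub>R u) = 0"
      using anticommute_general[OF u, of i j] by (cases "i = j") (simp_all add: algebra_simps scaleR_2)
  qed
  then have "(\<Sum>i\<in>UNIV. \<Sum>j\<in>UNIV. (l $ i * l $ j) *\<^sub>R \<phi> i (\<phi> j u))
      - (\<Sum>i\<in>UNIV. \<Sum>j\<in>UNIV. (l $ i * l $ j) *\<^sub>R (\<eta> j u *\<^sub>R \<xi> i))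
      + (\<Sum>i\<in>UNIV. \<Sum>j\<in>UNIV. (l $ i * l $ j) *\<^sub>R ((if i = j then 1 else 0) *\<^sub>R u)) = 0"
    by (simp only: scaleR_add_right scaleR_diff_right sum.distrib sum_subtractf)
  moreover have "Phi l (Phi l u) = (\<Sum>i\<in>UNIV. \<Sum>j\<in>UNIV. (l $ i * l $ j) *\<^sub>R \<phi> i (\<phi> j u))"
    unfolding Phi_def using u by (simp add: acm_subspace.phi_sum[OF acm_i] scaleR_sum_right)
  moreover have "Eta l u *\<^sub>R Xi l = (\<Sum>i\<in>UNIV. \<Sum>j\<in>UNIV. (l $ i * l $ j) *\<^sub>R (\<eta> j u *\<^sub>R \<xi> i))"
    unfolding Eta_def Xi_def scaleR_sum_right scaleR_sum_left
    by (rule sum.cong[OF refl])+ (simp add: mult_ac)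
  moreover have "(\<Sum>i\<in>UNIV. \<Sum>j\<in>UNIV. (l $ i * l $ j) *\<^sub>R ((if i = j then 1 else 0) *\<^sub>R u)) = u"
  proof -
    have "(\<Sum>i\<in>UNIV. \<Sum>j\<in>UNIV. (l $ i * l $ j) *\<^sub>R ((if i = j then 1 else 0) *\<^sub>R u))
        = (\<Sum>i\<in>UNIV. l $ i * l $ i) *\<^sub>R u"
      by (simp add: scaleR_sum_left if_distrib[of "\<lambda>x. _ * x"] if_distrib[of "\<lambda>x. x *\<^sub>R _"]
          if_distrib[of "\<lambda>x. _ *\<^sub>R x"] cong: if_cong)
    then show ?thesis by (simp add: diag)
  qed
  ultimately show "Phi l (Phi l u) = - u + Eta l u *\<^sub>R Xi l"
    by (simp add: algebra_simps eq_neg_iff_add_eq_0)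
next
  show "Xi l \<in> V" unfolding Xi_def by (intro V_sum) simp
  have "Eta l (Xi l) = (\<Sum>i\<in>UNIV. \<Sum>j\<in>UNIV. (l $ i * l $ j) * (if i = j then 1 else 0))"
    unfolding Eta_def Xi_def
    by (simp add: acm_subspace.eta_sum[OF acm_i] eta_xi_ij sum_distrib_left mult.assoc)
  also have "\<dots> = (\<Sum>i\<in>UNIV. l $ i * l $ i)" by (simp add: if_distrib cong: if_cong)
  finally show "Eta l (Xi l) = 1" by (simp add: sum_squares_sphere[OF l])
qed

text \<open>On a fixed orthonormal basis the volume forms take the values \<open>c\<close> and \<open>- c\<close> only, so the
  value is constant by continuity.\<close>

lemma volume_constant:
  assumes l: "l \<in> sphere 0 1" "l' \<in> sphere 0 1" and v: "\<And>i. v i \<in> V"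
  shows "acm_subspace.volume n g (Phi l) (Eta l) v = acm_subspace.volume n g (Phi l') (Eta l') v"
proof -
  let ?vol = "\<lambda>l. acm_subspace.volume n g (Phi l) (Eta l)"
  obtain e where e: "orthonormal n e" "\<And>i. e i \<in> V"
    using acm_subspace.adapted_basis[OF Phi_acm_subspace[OF l(1)]] by blast
  \<comment> \<open>With the sum pulled out of \<open>g\<close>, this is a polynomial in the
    coordinates of \<open>l\<close>, so its continuity requires nothing of \<open>g\<close>.\<close>
  define F where "F = (\<lambda>l :: real ^ 3. wedge 1 (2 * (n div 2)) (uncurry1 (Eta l))
    (wedge_power 2 (uncurry2 (\<lambda>u w. \<Sum>i\<in>UNIV. l $ i * g u (\<phi> i w))) (n div 2)) e)"
  have F: "?vol l e = F l" if l: "l \<in> sphere 0 1" for l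
    unfolding F_def acm_subspace.volume_def[OF Phi_acm_subspace[OF l]]
    by (rule wedge_uncurry_cong[OF e(2)])
      (simp_all add: Phi_def acm_subspace.g_sum_right[OF acm_i])
  have cont: "continuous_on (sphere 0 1) F"
    unfolding F_def wedge_uncurry1_wedge_power alternation_def Eta_def
    by (intro continuous_intros) simp
  have "connected (F ` sphere 0 1)"
    by (intro connected_continuous_image[OF cont] connected_sphere) simp
  moreover have F_sub: "F ` sphere 0 1 \<subseteq> {std_volume (n div 2), - std_volume (n div 2)}"
  proof (rule image_subsetI)
    fix l :: "real ^ 3" assume l: "l \<in> sphere 0 1"
    from acm_subspace.volume_orthonormal[OF Phi_acm_subspace[OF l] e]
    show "F l \<in> {std_volume (n div 2), - std_volume (n div 2)}" unfolding F[OF l] .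
  qed
  moreover from F_sub have "finite (F ` sphere 0 1)" by (rule finite_subset) simp
  ultimately have "F ` sphere 0 1 = {} \<or> (\<exists>c. F ` sphere 0 1 = {c})"
    using connected_finite_iff_sing by blast
  then have "F l = F l'" using l by (metis imageI empty_iff singletonD)
  then have eq: "?vol l e = ?vol l' e" using F l by simp
  \<comment> \<open>From the one basis \<open>e\<close> to all arguments: the difference is a
    top-degree form vanishing on \<open>e\<close>.\<close>
  have "alternating_on V n (\<lambda>v. ?vol l v - ?vol l' v)"
    using l by (intro alternating_on_diff acm_subspace.volume_alternating[OF Phi_acm_subspace])
  from alternating_on_eq_zero[OF this e] eq v show ?thesis by simp
qed

end

section \<open>The sphere of Sasakian structures\<close>

lemma comb_endo_app: "comb l \<phi> p u = (\<Sum>i\<in>UNIV. l $ i *\<^sub>R \<phi> i p u)"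
  by (simp add: comb_def sum_fun_app scaleR_fun_def)

lemma comb_field_app: "comb l \<xi> p = (\<Sum>i\<in>UNIV. l $ i *\<^sub>R \<xi> i p)"
  by (simp add: comb_def sum_fun_app scaleR_fun_def)

lemma comb_form_app: "comb l \<eta> p u = (\<Sum>i\<in>UNIV. l $ i * \<eta> i p u)" for \<eta> :: "3 \<Rightarrow> 'a \<Rightarrow> 'v \<Rightarrow> real"
  by (simp add: comb_def sum_fun_app scaleR_fun_def)

lemma comb_form2_app: "comb l \<Omega> p u v = (\<Sum>i\<in>UNIV. l $ i * \<Omega> i p u v)"
  for \<Omega> :: "3 \<Rightarrow> 'a \<Rightarrow> 'v \<Rightarrow> 'v \<Rightarrow> real"
  by (simp add: comb_def sum_fun_app scaleR_fun_def)

context smooth_mfd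
begin

text \<open>\<Omega> is compared with the fundamental form on tangent vectors only, because the
  combination of the fundamental forms agrees with the form of the combined \<phi> by linearity of
  \<open>g\<close>, which holds just there.\<close>

lemma cosymplectic_of_acm:
  assumes acm: "almost_contact_metric M \<phi> \<xi> \<eta> g"
    and \<Omega>: "\<And>p u v. p \<in> points M \<Longrightarrow> u \<in> tangent_space M p \<Longrightarrow> v \<in> tangent_space M p \<Longrightarrow>
      \<Omega> p u v = g p u (\<phi> p v)"
  shows "almost_cosymplectic M \<eta> \<Omega>" "reeb_field M \<eta> \<Omega> \<xi>"
    and "\<And>p v. p \<in> points M \<Longrightarrow> (\<And>i. v i \<in> tangent_space M p) \<Longrightarrow>
      cosymplectic_volume M \<eta> \<Omega> p v = acm_subspace.volume (mdim M) (g p) (\<phi> p) (\<eta> p) v"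
proof -
  have sub: "acm_subspace (tangent_space M p) (mdim M) (g p) (\<phi> p) (\<xi> p) (\<eta> p)" if "p \<in> points M" for p
    by (rule tangent_acm_subspace[OF acm that])
  have \<phi>: "endo_field M \<phi>" and \<xi>: "vector_field M \<xi>" and \<eta>: "one_form M \<eta>"
    and g: "riemannian_metric M g"
    using acm by (auto simp: almost_contact_metric_def compatible_metric_def almost_contact_def)
  \<comment> \<open>Nonemptiness of the manifold turns the parity of a tangent space into that of
    \<open>mdim M\<close>.\<close>
  obtain p0 where p0: "p0 \<in> points M" using smooth_manifold by (auto simp: smooth_manifold_def)
  have odd: "odd (mdim M)" by (rule acm_subspace.odd_dimension[OF sub[OF p0]])
  have smooth_\<eta>: "smooth_fun M (points M) (\<lambda>p. \<eta> p (X p))" if "vector_field M X" for X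
    using \<eta> that unfolding one_form_iff by blast
  have smooth_\<Omega>: "smooth_fun M (points M) (\<lambda>p. \<Omega> p (X p) (Y p))"
    if X: "vector_field M X" and Y: "vector_field M Y" for X Y
  proof -
    have \<phi>Y: "vector_field M (\<lambda>p. \<phi> p (Y p))" using \<phi> Y unfolding endo_field_def by blast
    have S: "smooth_fun M (points M) (\<lambda>p. g p (X p) (\<phi> p (Y p)))"
      by (rule g[unfolded riemannian_metric_def, THEN conjunct2, rule_format, OF X \<phi>Y])
    show ?thesis
      by (rule smooth_fun_cong[OF _ S], rule \<Omega>[symmetric]) (auto intro: vector_field_tangent X Y)
  qed
  have \<Omega>_alt: "alternating_on (tangent_space M p) 2 (uncurry2 (\<Omega> p))" if p: "p \<in> points M" for p
    using acm_subspace.Omega_alternating[OF sub[OF p]] \<Omega>[OF p]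
    unfolding alternating_on_def multilinear_on_def uncurry2_def
    by (auto simp: less_2_cases_iff)
  have two: "two_form M \<Omega>"
    unfolding two_form_def diff_form_iff using \<Omega>_alt smooth_\<Omega> by (simp add: uncurry2_def)
  show vol: "cosymplectic_volume M \<eta> \<Omega> p v = acm_subspace.volume (mdim M) (g p) (\<phi> p) (\<eta> p) v"
    if "p \<in> points M" "\<And>i. v i \<in> tangent_space M p" for p v
    unfolding cosymplectic_volume_def Let_def acm_subspace.volume_def[OF sub[OF that(1)]]
    by (rule wedge_uncurry_cong[OF that(2)]) (simp_all add: \<Omega> that(1))
  have vol_alt: "alternating_on (tangent_space M p) (mdim M) (cosymplectic_volume M \<eta> \<Omega> p)"
    if p: "p \<in> points M" for p
  proof -
    have "multilinear_on (tangent_space M p) 1 (uncurry1 (\<eta> p))"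
      by (rule acm_subspace.eta_multilinear[OF sub[OF p]])
    moreover have "multilinear_on (tangent_space M p) (2 * (mdim M div 2))
        (wedge_power 2 (uncurry2 (\<Omega> p)) (mdim M div 2))"
      using wedge_power_alternating[OF tangent_subspace, of p 2 "uncurry2 (\<Omega> p)"] \<Omega>_alt[OF p]
      by (simp add: alternating_on_def)
    ultimately show ?thesis
      using wedge_alternating[OF tangent_subspace] acm_subspace.n_eq[OF sub[OF p]]
      unfolding cosymplectic_volume_def Let_def by metis
  qed
  have vol_smooth: "smooth_fun M (points M) (\<lambda>p. cosymplectic_volume M \<eta> \<Omega> p (\<lambda>i. X i p))"
    if X: "\<forall>i. vector_field M (X i)" for X
    unfolding cosymplectic_volume_def Let_def wedge_uncurry1_wedge_power alternation_def
      divide_inverse mult.commute[of _ "inverse _"]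
    using X by (intro smooth_fun_cmult smooth_fun_sum smooth_fun_mult smooth_fun_prod
        smooth_\<eta> smooth_\<Omega> open_points) simp_all
  have "\<exists>v. (\<forall>i. v i \<in> tangent_space M p) \<and> cosymplectic_volume M \<eta> \<Omega> p v \<noteq> 0"
    if p: "p \<in> points M" for p
    using acm_subspace.volume_nonzero[OF sub[OF p]] vol[OF p] by metis
  then show "almost_cosymplectic M \<eta> \<Omega>"
    unfolding almost_cosymplectic_def volume_form_def diff_form_iff
    using odd \<eta> two vol_alt vol_smooth by blast
  show "reeb_field M \<eta> \<Omega> \<xi>"
    unfolding reeb_field_def
  proof (intro conjI ballI \<xi>)
    fix p v assume p: "p \<in> points M" and v: "v \<in> tangent_space M p"
    interpret acm_subspace "tangent_space M p" "mdim M" "g p" "\<phi> p" "\<xi> p" "\<eta> p" by (rule sub[OF p])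
    show "\<Omega> p (\<xi> p) v = 0"
      using \<Omega>[OF p xi_V v] g_phi_left[OF xi_V v] v by simp
  qed (rule acm_subspace.eta_xi[OF sub])
qed

end

context three_sasakian_mfd
begin

section \<open>The combined structures on the manifold\<close>

lemma metric: "riemannian_metric M g"
  using acm[of 1] by (simp add: almost_contact_metric_def compatible_metric_def)

lemma acm3_at:
  assumes p: "p \<in> points M"
  shows "acm3_subspace (tangent_space M p) (mdim M) (g p) (\<lambda>i. \<phi> i p) (\<lambda>i. \<xi> i p) (\<lambda>i. \<eta> i p)"
proof -
  \<comment> \<open>The index 1 is arbitrary; the inner product on the tangent space is common to
    all three structures.\<close>
  interpret acm_subspace "tangent_space M p" "mdim M" "g p" "\<phi> 1 p" "\<xi> 1 p" "\<eta> 1 p" by (rule acm_at[OF p])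
  note a = acm_at[OF p]
  have eta_xi: "\<eta> \<alpha> p (\<xi> \<gamma> p) = 0 \<and> \<eta> \<beta> p (\<xi> \<gamma> p) = 0" if c: "cyclic_triple \<alpha> \<beta> \<gamma>" for \<alpha> \<beta> \<gamma>
  proof
    show "\<eta> \<alpha> p (\<xi> \<gamma> p) = 0"
      unfolding cyclic_relations(1)[OF c p] by (rule acm_subspace.eta_phi[OF a acm_subspace.xi_V[OF a]])
    show "\<eta> \<beta> p (\<xi> \<gamma> p) = 0"
      unfolding cyclic_relations(2)[OF c p]
      using acm_subspace.eta_phi[OF acm_at[OF p, of \<beta>], of "\<xi> \<alpha> p"]
        acm_subspace.eta_minus[OF acm_at[OF p, of \<beta>], of "\<phi> \<beta> p (\<xi> \<alpha> p)"]
        acm_subspace.phi_V[OF a] acm_subspace.xi_V[OF a]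
      by simp
  qed
  have anti: "\<phi> \<alpha> p (\<phi> \<beta> p v) + \<phi> \<beta> p (\<phi> \<alpha> p v) = \<eta> \<beta> p v *\<^sub>R \<xi> \<alpha> p + \<eta> \<alpha> p v *\<^sub>R \<xi> \<beta> p"
    if c: "cyclic_triple \<alpha> \<beta> \<gamma>" and v: "v \<in> tangent_space M p" for \<alpha> \<beta> \<gamma> v
  proof -
    have "x + y = a + b" if "x - a = - y + b" for x y a b :: "'a tvec"
      using that by (metis add.commute add_diff_cancel_left' diff_add_cancel diff_add_eq uminus_add_conv_diff)
    then show ?thesis
      using cyclic_relations(3,4)[OF c p v] by metis
  qed
  show ?thesis
  proof (intro acm3_subspace.intro acm3_subspace_axioms.intro inner_product_subspace_axioms)
    show "acm_subspace (tangent_space M p) (mdim M) (g p) (\<phi> i p) (\<xi> i p) (\<eta> i p)" for i by (rule a)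
    fix i j :: 3 assume ij: "i \<noteq> j"
    then obtain k where k: "cyclic_triple k i j \<or> cyclic_triple k j i" using cyclic_triple_exists by blast
    show "\<phi> i p (\<phi> j p v) + \<phi> j p (\<phi> i p v) = \<eta> j p v *\<^sub>R \<xi> i p + \<eta> i p v *\<^sub>R \<xi> j p"
      if v: "v \<in> tangent_space M p" for v
      using k
    proof
      \<comment> \<open>Rotation gives (i, j, k), the order that \<open>anti\<close> reads; the
        opposite orientation is covered by the symmetry of the claim in \<open>i\<close> and
        \<open>j\<close>.\<close>
      assume "cyclic_triple k i j"
      from anti[OF cyclic_triple_rotate[OF this] v] show ?thesis .
    next
      assume "cyclic_triple k j i"
      from anti[OF cyclic_triple_rotate[OF this] v] show ?thesis by (simp only: add.commute)
    qed
    show "\<eta> i p (\<xi> j p) = 0"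
      using k
    proof
      assume "cyclic_triple k i j"
      from eta_xi[OF this] show ?thesis ..
    next
      assume "cyclic_triple k j i"
      from eta_xi[OF cyclic_triple_rotate[OF cyclic_triple_rotate[OF this]]] show ?thesis ..
    qed
  qed
qed

lemma comb_acm:
  assumes l: "l \<in> sphere 0 1"
  shows "almost_contact_metric M (comb l \<phi>) (comb l \<xi>) (comb l \<eta>) g"
proof -
  have sub: "acm_subspace (tangent_space M p) (mdim M) (g p) (comb l \<phi> p) (comb l \<xi> p) (comb l \<eta> p)"
    if p: "p \<in> points M" for p
  proof -
    interpret acm3_subspace "tangent_space M p" "mdim M" "g p" "\<lambda>i. \<phi> i p" "\<lambda>i. \<xi> i p" "\<lambda>i. \<eta> i p"
      by (rule acm3_at[OF p])
    have "Phi l = comb l \<phi> p" "Xi l = comb l \<xi> p" "Eta l = comb l \<eta> p"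
      by (rule ext, simp only: Phi_def comb_endo_app) (simp only: Xi_def comb_field_app,
        rule ext, simp only: Eta_def comb_form_app)
    with Phi_acm_subspace[OF l] show ?thesis by (simp only:)
  qed
  have "endo_field M (comb l \<phi>)"
    unfolding endo_field_def
  proof (intro conjI ballI allI impI)
    fix p u v a b assume "p \<in> points M" "u \<in> tangent_space M p" "v \<in> tangent_space M p"
    then show "comb l \<phi> p u \<in> tangent_space M p"
      and "comb l \<phi> p (a *\<^sub>R u + b *\<^sub>R v) = a *\<^sub>R comb l \<phi> p u + b *\<^sub>R comb l \<phi> p v"
      using acm_subspace.phi_V[OF sub] acm_subspace.phi_linear[OF sub] by blast+
  next
    fix X assume "vector_field M X"
    then show "vector_field M (\<lambda>p. comb l \<phi> p (X p))"
      unfolding comb_endo_app by (intro vector_field_sum vector_field_scaleR vector_field_J)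
  qed
  moreover have "vector_field M (comb l \<xi>)"
  proof -
    have "comb l \<xi> = (\<lambda>p. \<Sum>i\<in>UNIV. l $ i *\<^sub>R \<xi> i p)" by (rule ext) (rule comb_field_app)
    then show ?thesis
      by (simp only:) (intro vector_field_sum vector_field_scaleR vector_field_xi)
  qed
  moreover have "one_form M (comb l \<eta>)"
    unfolding one_form_iff
  proof (intro conjI ballI allI impI)
    fix p u v a b assume "p \<in> points M" "u \<in> tangent_space M p" "v \<in> tangent_space M p"
    then show "comb l \<eta> p (a *\<^sub>R u + b *\<^sub>R v) = a * comb l \<eta> p u + b * comb l \<eta> p v"
      using acm_subspace.eta_linear[OF sub] by blast
  next
    fix X assume "vector_field M X"
    then show "smooth_fun M (points M) (\<lambda>p. comb l \<eta> p (X p))"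
      unfolding comb_form_app by (intro smooth_fun_sum smooth_fun_cmult smooth_eta open_points)
  qed
  ultimately show ?thesis
    unfolding almost_contact_metric_def almost_contact_def compatible_metric_def
    using acm_subspace.eta_xi[OF sub] acm_subspace.phi_phi[OF sub] acm_subspace.compatible[OF sub] metric
    by blast
qed

lemma comb_ext_deriv:
  assumes l: "l \<in> sphere 0 1" and X: "vector_field M X" and Y: "vector_field M Y" and p: "p \<in> points M"
  shows "X p (\<lambda>q. comb l \<eta> q (Y q)) - Y p (\<lambda>q. comb l \<eta> q (X q)) - comb l \<eta> p (bracket X Y p)
    = 2 * g p (X p) (comb l \<phi> p (Y p))"
proof -
  have der: "Z p (\<lambda>q. comb l \<eta> q (U q)) = (\<Sum>i\<in>UNIV. l $ i * Z p (\<lambda>q. \<eta> i q (U q)))"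
    if Z: "vector_field M Z" and U: "vector_field M U" for Z U
    unfolding comb_form_app
    using tangent_sum[OF vector_field_tangent[OF Z p] p, of UNIV "\<lambda>i q. l $ i * \<eta> i q (U q)"]
      tangent_cmult[OF vector_field_tangent[OF Z p] smooth_near_eta[OF U p]]
      smooth_near_cmult[OF smooth_near_eta[OF U p]]
    by simp
  have "g p (X p) (comb l \<phi> p (Y p)) = (\<Sum>i\<in>UNIV. l $ i * g p (X p) (\<phi> i p (Y p)))"
    unfolding comb_endo_app[of l \<phi> p "Y p"]
    using acm_subspace.g_sum_right[OF acm_at[OF p], of UNIV "\<lambda>i. \<phi> i p (Y p)" "X p" "\<lambda>i. l $ i"]
      acm_subspace.phi_V[OF acm_at[OF p]] X Y p vector_field_tangent by simp
  moreover have "l $ i * \<eta> i p (bracket X Y p) = l $ i * X p (\<lambda>q. \<eta> i q (Y q))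
      - l $ i * Y p (\<lambda>q. \<eta> i q (X q)) - 2 * (l $ i * g p (X p) (\<phi> i p (Y p)))" for i
    unfolding eta_bracket[OF X Y p] by (simp add: algebra_simps)
  ultimately show ?thesis
    unfolding der[OF X Y] der[OF Y X] comb_form_app[of l \<eta> p "bracket X Y p"]
    by (simp add: sum_subtractf sum_distrib_left)
qed

lemma comb_normal:
  assumes l: "l \<in> sphere 0 1"
  shows "normal_structure M (comb l \<phi>) (comb l \<xi>) (comb l \<eta>)"
  unfolding normal_structure_def Let_def
proof (intro allI impI ballI)
  fix X Y p assume X: "vector_field M X" and Y: "vector_field M Y" and p: "p \<in> points M"
  note [simp del] = plus_fun_apply minus_apply uminus_apply
  note J = vector_field_J
  let ?T = "tangent_space M p" and ?K = "\<lambda>X q. comb l \<phi> q (X q)"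
  note T [simp] = lie_bracket_tangent[OF _ _ p] and V [simp] = acm_subspace.phi_V[OF acm_at[OF p]]
  note phi_sum = acm_subspace.phi_sum[OF acm_at[OF p]]
  \<comment> \<open>The coefficients of the normality tensor of the combination. They are not
    symmetric in \<open>i\<close> and \<open>j\<close>: the single entries need not vanish off the
    diagonal, but \<open>N i j + N j i\<close> is the mixed tensor.\<close>
  define N where "N = (\<lambda>i j. \<phi> i p (\<phi> j p (bracket X Y p)) + bracket (J i X) (J j Y) p
    - \<phi> i p (bracket (J j X) Y p) - \<phi> i p (bracket X (J j Y) p)
    + (2 * g p (X p) (\<phi> j p (Y p))) *\<^sub>R \<xi> i p)"
  have N_cyclic: "N \<beta> \<gamma> + N \<gamma> \<beta> = 0" if c: "cyclic_triple \<alpha> \<beta> \<gamma>" for \<alpha> \<beta> \<gamma>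
  proof -
    have "N \<beta> \<gamma> + N \<gamma> \<beta> = \<phi> \<beta> p (\<phi> \<gamma> p (bracket X Y p)) + \<phi> \<gamma> p (\<phi> \<beta> p (bracket X Y p))
      + (bracket (J \<gamma> X) (J \<beta> Y) p + bracket (J \<beta> X) (J \<gamma> Y) p)
      - (\<phi> \<beta> p (bracket (J \<gamma> X) Y p) + \<phi> \<beta> p (bracket X (J \<gamma> Y) p))
      - (\<phi> \<gamma> p (bracket (J \<beta> X) Y p) + \<phi> \<gamma> p (bracket X (J \<beta> Y) p))
      + (2 * g p (X p) (\<phi> \<gamma> p (Y p))) *\<^sub>R \<xi> \<beta> p + (2 * g p (X p) (\<phi> \<beta> p (Y p))) *\<^sub>R \<xi> \<gamma> p"
      unfolding N_def by (simp add: algebra_simps)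
    also have "\<dots> = 0"
      using mixed_normal[OF c X Y p] X Y J by (simp only: acm_subspace.phi_add[OF acm_at[OF p]] T)
    finally show ?thesis .
  qed
  have N: "N i j + N j i = 0" for i j
  proof (cases "i = j")
    case True
    then show ?thesis using normal[OF X Y p, of j] by (simp add: N_def)
  next
    case False
    then obtain k where "cyclic_triple k i j \<or> cyclic_triple k j i" using cyclic_triple_exists by blast
    then show ?thesis using N_cyclic add.commute[of "N i j" "N j i"] by metis
  qed
  have quad: "(\<Sum>i\<in>UNIV. \<Sum>j\<in>UNIV. (l $ i * l $ j) *\<^sub>R N i j) = 0"
    by (rule antisymmetric_quadratic_sum) (rule N)
  have left: "bracket (?K U) Z p = (\<Sum>i\<in>UNIV. l $ i *\<^sub>R bracket (J i U) Z p)"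
    if U: "vector_field M U" and Z: "vector_field M Z" for U Z
    unfolding comb_endo_app
    by (simp only: lie_bracket_sum_left[OF vector_field_scaleR[OF J[OF U]] Z p] lie_bracket_scaleR_left[OF J[OF U] Z p])
  have right: "bracket Z (?K U) p = (\<Sum>i\<in>UNIV. l $ i *\<^sub>R bracket Z (J i U) p)"
    if U: "vector_field M U" and Z: "vector_field M Z" for U Z
    unfolding lie_bracket_skew[of Z] left[OF U Z] by (simp add: sum_negf)
  have K: "vector_field M (?K U)" if "vector_field M U" for U
    unfolding comb_endo_app using that by (intro vector_field_sum vector_field_scaleR J)
  have phi2: "comb l \<phi> p (\<Sum>j\<in>UNIV. l $ j *\<^sub>R x j) = (\<Sum>i\<in>UNIV. \<Sum>j\<in>UNIV. (l $ i * l $ j) *\<^sub>R \<phi> i p (x j))"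
    if "\<And>j. x j \<in> ?T" for x :: "3 \<Rightarrow> 'a tvec"
    unfolding comb_endo_app by (simp only: phi_sum that scaleR_sum_right scaleR_scaleR)
  have "comb l \<phi> p (comb l \<phi> p (bracket X Y p))
      = (\<Sum>i\<in>UNIV. \<Sum>j\<in>UNIV. (l $ i * l $ j) *\<^sub>R \<phi> i p (\<phi> j p (bracket X Y p)))"
    unfolding comb_endo_app[of l \<phi> p "bracket X Y p"] by (rule phi2) (simp add: X Y)
  moreover have "bracket (?K X) (?K Y) p
      = (\<Sum>i\<in>UNIV. \<Sum>j\<in>UNIV. (l $ i * l $ j) *\<^sub>R bracket (J i X) (J j Y) p)"
    unfolding left[OF X K[OF Y]] right[OF Y J[OF X]] by (simp only: scaleR_sum_right scaleR_scaleR)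
  moreover have "comb l \<phi> p (bracket (?K X) Y p)
      = (\<Sum>i\<in>UNIV. \<Sum>j\<in>UNIV. (l $ i * l $ j) *\<^sub>R \<phi> i p (bracket (J j X) Y p))"
    unfolding left[OF X Y] by (rule phi2) (simp add: X Y J)
  moreover have "comb l \<phi> p (bracket X (?K Y) p)
      = (\<Sum>i\<in>UNIV. \<Sum>j\<in>UNIV. (l $ i * l $ j) *\<^sub>R \<phi> i p (bracket X (J j Y) p))"
    unfolding right[OF Y X] by (rule phi2) (simp add: X Y J)
  moreover have "(X p (\<lambda>q. comb l \<eta> q (Y q)) - Y p (\<lambda>q. comb l \<eta> q (X q)) - comb l \<eta> p (bracket X Y p))
        *\<^sub>R comb l \<xi> p
      = (\<Sum>i\<in>UNIV. \<Sum>j\<in>UNIV. (l $ i * l $ j) *\<^sub>R ((2 * g p (X p) (\<phi> j p (Y p))) *\<^sub>R \<xi> i p))"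
  proof -
    have "g p (X p) (comb l \<phi> p (Y p)) = (\<Sum>i\<in>UNIV. l $ i * g p (X p) (\<phi> i p (Y p)))"
      unfolding comb_endo_app[of l \<phi> p "Y p"]
      using acm_subspace.g_sum_right[OF acm_at[OF p], of UNIV "\<lambda>i. \<phi> i p (Y p)" "X p" "\<lambda>i. l $ i"]
        X Y p vector_field_tangent by simp
    then show ?thesis
      unfolding comb_ext_deriv[OF l X Y p] comb_field_app[of l \<xi> p]
      by (simp add: scaleR_sum_right scaleR_sum_left sum_distrib_left mult_ac)
  qed
  ultimately show "comb l \<phi> p (comb l \<phi> p (bracket X Y p)) + bracket (?K X) (?K Y) p
    - comb l \<phi> p (bracket (?K X) Y p) - comb l \<phi> p (bracket X (?K Y) p)
    + (X p (\<lambda>q. comb l \<eta> q (Y q)) - Y p (\<lambda>q. comb l \<eta> q (X q)) - comb l \<eta> p (bracket X Y p))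
        *\<^sub>R comb l \<xi> p = 0"
    using quad unfolding N_def
    by (simp only: scaleR_add_right scaleR_diff_right sum.distrib sum_subtractf)
qed

lemma comb_sasakian:
  assumes "l \<in> sphere 0 1"
  shows "sasakian M (comb l \<phi>) (comb l \<xi>) (comb l \<eta>) g"
  unfolding sasakian_def fundamental_form_def ext_deriv1_def
  using comb_acm[OF assms] comb_normal[OF assms] comb_ext_deriv[OF assms] by simp

lemma comb_fundamental_form:
  assumes p: "p \<in> points M" and u: "u \<in> tangent_space M p" and v: "v \<in> tangent_space M p"
  shows "comb l (\<lambda>i. fundamental_form (\<phi> i) g) p u v = g p u (comb l \<phi> p v)"
  unfolding comb_form2_app[of l _ p u v] comb_endo_app[of l \<phi> p v] fundamental_form_def
  using acm_subspace.g_sum_right[OF acm_at[OF p], of UNIV "\<lambda>i. \<phi> i p v" u "\<lambda>i. l $ i"]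
    acm_subspace.phi_V[OF acm_at[OF p] v] u by simp

end

theorem corollary4p8:
  fixes M :: "('a, 'e::euclidean_space) manifold"
    and \<phi> :: "3 \<Rightarrow> 'a \<Rightarrow> 'a tvec \<Rightarrow> 'a tvec"
    and \<xi> :: "3 \<Rightarrow> 'a \<Rightarrow> 'a tvec"
    and \<eta> :: "3 \<Rightarrow> 'a \<Rightarrow> 'a tvec \<Rightarrow> real"
    and g :: "'a \<Rightarrow> 'a tvec \<Rightarrow> 'a tvec \<Rightarrow> real"
  assumes "smooth_manifold M"
    and "three_sasakian M \<phi> \<xi> \<eta> g"
  shows "\<exists>(\<theta> :: 3 \<Rightarrow> 'a \<Rightarrow> 'a tvec \<Rightarrow> real)
          (\<Omega> :: 3 \<Rightarrow> 'a \<Rightarrow> 'a tvec \<Rightarrow> 'a tvec \<Rightarrow> real)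
          (\<zeta> :: 3 \<Rightarrow> 'a \<Rightarrow> 'a tvec).
      almost_cosymplectic_sphere M \<theta> \<Omega> \<zeta> \<and>
      taut M \<theta> \<Omega> \<and>
      round_sphere M \<theta> \<Omega> \<zeta> \<and>
      (\<forall>l\<in>sphere 0 1. \<exists>\<psi> \<rho> h.
         sasakian M \<psi> \<rho> (comb l \<theta>) h \<and>
         (\<forall>p\<in>points M. \<forall>u\<in>tangent_space M p. \<forall>v\<in>tangent_space M p.
            comb l \<Omega> p u v = fundamental_form \<psi> h p u v))"
proof -
  interpret three_sasakian_mfd M \<phi> \<xi> \<eta> g
    using assms by unfold_locales
  let ?\<Omega> = "\<lambda>i. fundamental_form (\<phi> i) g"
  have single: "almost_cosymplectic M (\<eta> i) (?\<Omega> i)" "reeb_field M (\<eta> i) (?\<Omega> i) (\<xi> i)" for i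
    using cosymplectic_of_acm(1,2)[OF acm[of i], of "?\<Omega> i"] by (simp_all add: fundamental_form_def)
  have cosymplectic: "almost_cosymplectic M (comb l \<eta>) (comb l ?\<Omega>)"
    "reeb_field M (comb l \<eta>) (comb l ?\<Omega>) (comb l \<xi>)"
    "p \<in> points M \<Longrightarrow> (\<And>i. v i \<in> tangent_space M p) \<Longrightarrow> cosymplectic_volume M (comb l \<eta>) (comb l ?\<Omega>) p v
      = acm_subspace.volume (mdim M) (g p) (comb l \<phi> p) (comb l \<eta> p) v"
    if l: "l \<in> sphere 0 1" for l p v
    using cosymplectic_of_acm[OF comb_acm[OF l], of "comb l ?\<Omega>"] comb_fundamental_form[of _ _ _ l]
    by blast+
  have "almost_cosymplectic_sphere M \<eta> ?\<Omega> \<xi>"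
    unfolding almost_cosymplectic_sphere_def using cosymplectic(1) single by blast
  moreover have "taut M \<eta> ?\<Omega>"
    unfolding taut_def
  proof (intro ballI allI impI)
    fix l l' :: "real ^ 3" and p and v :: "nat \<Rightarrow> 'a tvec"
    assume l: "l \<in> sphere 0 1" and l': "l' \<in> sphere 0 1" and p: "p \<in> points M"
      and v: "\<forall>i. v i \<in> tangent_space M p"
    interpret acm3_subspace "tangent_space M p" "mdim M" "g p" "\<lambda>i. \<phi> i p" "\<lambda>i. \<xi> i p" "\<lambda>i. \<eta> i p"
      by (rule acm3_at[OF p])
    have eq: "Phi l = comb l \<phi> p" "Eta l = comb l \<eta> p" for l
      by (rule ext, simp only: Phi_def comb_endo_app) (rule ext, simp only: Eta_def comb_form_app)
    \<comment> \<open>Tautness is a statement about each tangent space separately: the sign is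
      constant along the sphere at a fixed point \<open>p\<close>.\<close>
    have "acm_subspace.volume (mdim M) (g p) (comb l \<phi> p) (comb l \<eta> p) v
        = acm_subspace.volume (mdim M) (g p) (comb l' \<phi> p) (comb l' \<eta> p) v"
      using volume_constant[OF l l', of v] v unfolding eq by blast
    then show "cosymplectic_volume M (comb l \<eta>) (comb l ?\<Omega>) p v
        = cosymplectic_volume M (comb l' \<eta>) (comb l' ?\<Omega>) p v"
      using cosymplectic(3)[OF l p] cosymplectic(3)[OF l' p] v by simp
  qed
  moreover have "round_sphere M \<eta> ?\<Omega> \<xi>"
    unfolding round_sphere_def using cosymplectic(2) by blast
  \<comment> \<open>The same metric \<open>g\<close> serves every \<open>l\<close>.\<close>
  moreover have "\<forall>l\<in>sphere 0 1. \<exists>\<psi> \<rho> h. sasakian M \<psi> \<rho> (comb l \<eta>) h \<and>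
      (\<forall>p\<in>points M. \<forall>u\<in>tangent_space M p. \<forall>v\<in>tangent_space M p.
        comb l ?\<Omega> p u v = fundamental_form \<psi> h p u v)"
    using comb_sasakian comb_fundamental_form unfolding fundamental_form_def by blast
  ultimately show ?thesis by blast
qed

end
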